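(* Let $X$ be a $\mathcal D$-measurable $D([0,1]^m)$-valued random variable ($m\ge1$). (i) The following are equivalent: the projective moment $\mathbb E[X^{\widehat\otimes2}]$ exists in Dunford sense; the injective moment $\mathbb E[X^{\check\otimes2}]$ exists in Dunford sense; $\sup_{t\in[0,1]^m}\mathbb E|X(t)|^2<\infty$. (ii) The following are equivalent: the projective moment $\mathbb E[X^{\widehat\otimes2}]$ exists in Pettis sense; the injective moment $\mathbb E[X^{\check\otimes2}]$ exists in Pettis sense; the family $\{|X(t)|^2:t\in[0,1]^m\}$ of random variables is uniformly integrable.
   Context: $D([0,1]^m)$ is the set of functions $f:[0,1]^m\to\mathbb R$ such that at every $t=(t_1,\dots,t_m)\in[0,1]^m$ the limit of $f(s)$ exists (as a finite real number) as $s\to t$ within each set $J_1\times\dots\times J_m$, where each $J_i$ is either $[t_i,1]$ or $[0,t_i)$ (the latter only if $t_i>0$). It is a Banach space with the norm $\|f\|=\sup_{t\in[0,1]^m}|f(t)|$. $\mathcal D$ is the $\sigma$-field on it generated by all point evaluations $f\mapsto f(t)$. A $\mathcal D$-measurable $D([0,1]^m)$-valued random variable is a map $X$ from a probability space $(\Omega,\mathcal F,\mathbb P)$ to $D([0,1]^m)$ such that $X(t)$ is a real random variable for each $t\in[0,1]^m$. For a Banach space $B$, $B^{\widehat\otimes2}$ and $B^{\check\otimes2}$ denote the projective and injective (completed) tensor squares of $B$, and $X^{\widehat\otimes2}$, $X^{\check\otimes2}$ denote $X\otimes X$ regarded as a function from $\Omega$ into $B^{\widehat\otimes2}$, respectively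 $B^{\check\otimes2}$. Here $B=D([0,1]^m)$. A function $F:\Omega\to E$ into a Banach space $E$ is Dunford integrable if $\langle\chi,F\rangle$ is measurable and integrable for every $\chi\in E^*$; its Dunford integral is the unique element $\int_\Omega F\,\mathrm d\mathbb P\in E^{**}$ with $\langle\int_\Omega F\,\mathrm d\mathbb P,\chi\rangle=\int_\Omega\langle\chi,F\rangle\,\mathrm d\mathbb P$ for all $\chi\in E^*$. $F$ is Pettis integrable if it is Dunford integrable and $\int_AF\,\mathrm d\mathbb P\in E$ for every measurable $A\subseteq\Omega$. The projective (injective) moment exists in Dunford or Pettis sense if $X^{\widehat\otimes2}$ (respectively $X^{\check\otimes2}$) is Dunford or Pettis integrable in the corresponding space. *)

theory Defs
  imports "HOL-Probability.Probability"
begin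

section \<open>The canonical embedding into the bidual\<close>

lift_definition bidual_embed :: "'a::real_normed_vector \<Rightarrow> ('a \<Rightarrow>\<^sub>L real) \<Rightarrow>\<^sub>L real"
  is "\<lambda>x \<xi>. blinfun_apply \<xi> x"
  by (rule blinfun.bounded_linear_left)

lemma bidual_embed_add: "bidual_embed (x + y) = bidual_embed x + bidual_embed y"
  by (rule blinfun_eqI) (simp add: bidual_embed.rep_eq blinfun.add_left blinfun.add_right)

lemma bidual_embed_scaleR: "bidual_embed (c *\<^sub>R x) = c *\<^sub>R bidual_embed x"
  by (rule blinfun_eqI) (simp add: bidual_embed.rep_eq blinfun.scaleR_left blinfun.scaleR_right)

lemma linear_bidual_embed: "linear bidual_embed"
  by (simp add: linear_iff bidual_embed_add bidual_embed_scaleR)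

text \<open>
  The Hahn--Banach theorem in the form needed below. A minimal element among the sublinear
  functionals dominated by a given one is linear.
\<close>

definition sublinear :: "('a::real_vector \<Rightarrow> real) \<Rightarrow> bool" where
  "sublinear p \<longleftrightarrow> p 0 = 0 \<and> (\<forall>x y. p (x + y) \<le> p x + p y) \<and> (\<forall>c>0. \<forall>x. p (c *\<^sub>R x) \<le> c * p x)"

lemma sublinear_scaleR:
  assumes "sublinear p" "c \<ge> 0"
  shows "p (c *\<^sub>R x) = c * p x"
proof (cases "c = 0")
  case True
  then show ?thesis using assms by (simp add: sublinear_def)
next
  case False
  with assms have c: "c > 0" by simp
  have "p (inverse c *\<^sub>R (c *\<^sub>R x)) \<le> inverse c * p (c *\<^sub>R x)"
    using assms c unfolding sublinear_def by (metis positive_imp_inverse_positive)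
  then have "c * p x \<le> p (c *\<^sub>R x)" using c by (simp add: field_simps)
  moreover have "p (c *\<^sub>R x) \<le> c * p x" using assms c unfolding sublinear_def by blast
  ultimately show ?thesis by simp
qed

lemma sublinear_neg: "sublinear p \<Longrightarrow> - p (- x) \<le> p x"
  unfolding sublinear_def by (metis add.right_inverse add_le_cancel_right neg_eq_iff_add_eq_0 add.commute)

lemma sublinear_reduce:
  fixes p :: "'a::real_vector \<Rightarrow> real"
  assumes "sublinear p"
  shows "\<exists>q. sublinear q \<and> q \<le> p \<and> q (- x) \<le> - p x"
proof -
  define h where "h y t = p (y + t *\<^sub>R x) - t * p x" for y and t :: real
  define q where "q y = (INF t\<in>{0..}. h y t)" for y
  have sub: "p (a + b) \<le> p a + p b" for a b using assms unfolding sublinear_def by blast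
  have low: "- p (- y) \<le> h y t" if "t \<ge> 0" for y t
  proof -
    have "t * p x = p (t *\<^sub>R x)" using sublinear_scaleR[OF assms that] by simp
    also have "\<dots> \<le> p (y + t *\<^sub>R x) + p (- y)" using sub[of "y + t *\<^sub>R x" "- y"] by simp
    finally show ?thesis unfolding h_def by simp
  qed
  have bdd: "bdd_below (h y ` {0..})" for y
    by (rule bdd_belowI[of _ "- p (- y)"]) (auto intro: low)
  have qle: "q y \<le> h y t" if "t \<ge> 0" for y t
    unfolding q_def using bdd that by (intro cINF_lower) auto
  have qge: "c \<le> q y" if "\<And>t. t \<ge> 0 \<Longrightarrow> c \<le> h y t" for y c
    unfolding q_def using that by (intro cINF_greatest) auto
  have p0: "p 0 = 0" using assms by (simp add: sublinear_def)
  have "q 0 \<le> 0" using qle[of 0 0] p0 by (simp add: h_def)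
  moreover have "0 \<le> q 0" by (rule qge) (use low[of _ 0] p0 in auto)
  ultimately have q0: "q 0 = 0" by simp
  have qadd: "q (a + b) \<le> q a + q b" for a b
  proof -
    have "q (a + b) - q a \<le> q b"
    proof (rule qge)
      fix t :: real assume t: "t \<ge> 0"
      have "q (a + b) - h b t \<le> q a"
      proof (rule qge)
        fix s :: real assume s: "s \<ge> 0"
        have "q (a + b) \<le> h (a + b) (s + t)" using s t by (intro qle) simp
        also have "\<dots> \<le> h a s + h b t"
          using sub[of "a + s *\<^sub>R x" "b + t *\<^sub>R x"] by (simp add: h_def algebra_simps)
        finally show "q (a + b) - h b t \<le> h a s" by simp
      qed
      then show "q (a + b) - q a \<le> h b t" by simp
    qed
    then show ?thesis by simp
  qed
  have qmul: "q (c *\<^sub>R a) \<le> c * q a" if c: "c > 0" for c a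
  proof -
    have "q (c *\<^sub>R a) / c \<le> q a"
    proof (rule qge)
      fix t :: real assume t: "t \<ge> 0"
      have "q (c *\<^sub>R a) \<le> h (c *\<^sub>R a) (c * t)" using c t by (intro qle) simp
      also have "\<dots> = p (c *\<^sub>R (a + t *\<^sub>R x)) - c * t * p x" by (simp add: h_def algebra_simps)
      also have "\<dots> = c * h a t" by (subst sublinear_scaleR[OF assms]) (use c in \<open>auto simp: h_def algebra_simps\<close>)
      finally show "q (c *\<^sub>R a) / c \<le> h a t" using c by (simp add: field_simps)
    qed
    then show ?thesis using c by (simp add: field_simps)
  qed
  have "q \<le> p" using qle[of 0] by (auto simp: le_fun_def h_def)
  moreover have "q (- x) \<le> - p x" using qle[of 1 "- x"] p0 by (simp add: h_def)
  ultimately show ?thesis using q0 qadd qmul unfolding sublinear_def by blast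
qed

lemma sublinear_dominates_linear:
  fixes p :: "'a::real_vector \<Rightarrow> real"
  assumes p: "sublinear p"
  shows "\<exists>f. linear f \<and> f \<le> p"
proof -
  define A where "A = {q. sublinear q \<and> q \<le> p}"
  have low: "- p (- y) \<le> q y" if "q \<in> A" for q y
    using that sublinear_neg[of q y] unfolding A_def le_fun_def
    by (smt (verit, best) mem_Collect_eq)
  have "\<exists>m\<in>A. \<forall>a\<in>A. a \<le> m \<longrightarrow> a = m"
  proof (rule predicate_Zorn)
    show "partial_order_on A (relation_of (\<lambda>x y. y \<le> x) A)"
      by (auto simp: partial_order_on_def preorder_on_def refl_on_def trans_def antisym_def relation_of_def)
  next
    fix C assume C: "C \<in> Chains (relation_of (\<lambda>x y. y \<le> x) A)"
    have CA: "C \<subseteq> A" using C by (auto simp: Chains_def relation_of_def)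
    show "\<exists>u\<in>A. \<forall>a\<in>C. u \<le> a"
    proof (cases "C = {}")
      case True
      then show ?thesis using p by (auto simp: A_def)
    next
      case False
      define u where "u y = (INF q\<in>C. q y)" for y
      have bdd: "bdd_below ((\<lambda>q. q y) ` C)" for y
        by (rule bdd_belowI[of _ "- p (- y)"]) (use CA low in auto)
      have ule: "u y \<le> q y" if "q \<in> C" for y q
        unfolding u_def using bdd that by (intro cINF_lower) auto
      have uge: "c \<le> u y" if "\<And>q. q \<in> C \<Longrightarrow> c \<le> q y" for y c
        unfolding u_def using that False by (intro cINF_greatest) auto
      obtain q0 where q0: "q0 \<in> C" using False by blast
      have sl: "sublinear q" "q \<le> p" if "q \<in> C" for q using that CA by (auto simp: A_def)
      have "u 0 \<le> 0" using ule[OF q0, of 0] sl[OF q0] by (simp add: sublinear_def)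
      moreover have "0 \<le> u 0"
      proof (rule uge)
        fix q assume "q \<in> C"
        then show "0 \<le> q 0" using sl(1)[of q] by (simp add: sublinear_def)
      qed
      moreover have "u (x + y) \<le> u x + u y" for x y
      proof -
        have "u (x + y) - u x \<le> u y"
        proof (rule uge)
          fix q2 assume q2: "q2 \<in> C"
          have "u (x + y) - q2 y \<le> u x"
          proof (rule uge)
            fix q1 assume q1: "q1 \<in> C"
            have "q1 \<le> q2 \<or> q2 \<le> q1" using C q1 q2 by (auto simp: Chains_def relation_of_def)
            then obtain q where q: "q \<in> C" "q \<le> q1" "q \<le> q2" using q1 q2 by blast
            have "u (x + y) \<le> q (x + y)" using ule q by blast
            also have "\<dots> \<le> q x + q y" using sl[OF q(1)] by (simp add: sublinear_def)
            also have "\<dots> \<le> q1 x + q2 y" using q by (intro add_mono) (auto simp: le_fun_def)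
            finally show "u (x + y) - q2 y \<le> q1 x" by simp
          qed
          then show "u (x + y) - u x \<le> q2 y" by simp
        qed
        then show ?thesis by simp
      qed
      moreover have "u (c *\<^sub>R x) \<le> c * u x" if c: "c > 0" for c x
      proof -
        have "u (c *\<^sub>R x) / c \<le> u x"
        proof (rule uge)
          fix q assume q: "q \<in> C"
          have "u (c *\<^sub>R x) \<le> c * q x"
            using ule[OF q, of "c *\<^sub>R x"] sublinear_scaleR[OF sl(1)[OF q], of c x] c by simp
          then show "u (c *\<^sub>R x) / c \<le> q x" using c by (simp add: field_simps)
        qed
        then show ?thesis using c by (simp add: field_simps)
      qed
      ultimately have "sublinear u" unfolding sublinear_def by (simp add: order_antisym)
      moreover have "u \<le> p" using ule[OF q0] sl(2)[OF q0] by (meson le_funI le_funD order_trans)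
      ultimately have "u \<in> A" by (simp add: A_def)
      then show ?thesis using ule by (auto simp: le_fun_def)
    qed
  qed
  then obtain m where m: "sublinear m" "m \<le> p" and min: "\<And>a. sublinear a \<Longrightarrow> a \<le> p \<Longrightarrow> a \<le> m \<Longrightarrow> a = m"
    unfolding A_def by blast
  have sub: "m (a + b) \<le> m a + m b" for a b using m unfolding sublinear_def by blast
  have neg: "m (- x) = - m x" for x
  proof -
    obtain q where q: "sublinear q" "q \<le> m" "q (- x) \<le> - m x" using sublinear_reduce[OF m(1)] by blast
    have "q = m" using min[OF q(1)] q(2) m(2) order_trans by blast
    with q have "m (- x) \<le> - m x" by simp
    then show ?thesis using sublinear_neg[OF m(1), of x] by simp
  qed
  have "m (x + y) = m x + m y" for x y
    using sub[of x y] sub[of "- x" "- y"] neg[of x] neg[of y] neg[of "x + y"] by simp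
  moreover have "m (c *\<^sub>R x) = c * m x" for c x
  proof (cases "c \<ge> 0")
    case True
    then show ?thesis by (rule sublinear_scaleR[OF m(1)])
  next
    case False
    then have "m ((- c) *\<^sub>R x) = (- c) * m x" by (intro sublinear_scaleR[OF m(1)]) simp
    then show ?thesis using neg[of "c *\<^sub>R x"] by simp
  qed
  ultimately have "linear m" by (simp add: linear_iff)
  with m show ?thesis by blast
qed

lemma norming_functional:
  fixes x :: "'a::real_normed_vector"
  shows "\<exists>\<xi>::'a \<Rightarrow>\<^sub>L real. norm \<xi> \<le> 1 \<and> blinfun_apply \<xi> x = norm x"
proof -
  have "sublinear (norm :: 'a \<Rightarrow> real)" by (simp add: sublinear_def norm_triangle_ineq)
  then obtain q where q: "sublinear q" "q \<le> norm" "q (- x) \<le> - norm x"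
    using sublinear_reduce by blast
  obtain f where f: "linear f" "f \<le> q" using sublinear_dominates_linear[OF q(1)] by blast
  have le: "f y \<le> norm y" for y using f(2) q(2) by (meson le_funD order_trans)
  have fneg: "f (- y) = - f y" for y using f(1) by (rule linear_neg)
  have ab: "\<bar>f y\<bar> \<le> norm y" for y using le[of y] le[of "- y"] fneg by simp
  have bl: "bounded_linear f"
    using f(1) ab by (intro bounded_linear_intro[of f 1]) (auto simp: linear_iff)
  have "f (- x) \<le> - norm x" using f(2) q(3) by (meson le_funD order_trans)
  then have "f x = norm x" using le[of x] fneg[of x] by simp
  moreover have "norm (Blinfun f) \<le> 1"
    using ab by (intro norm_blinfun_bound) (auto simp: bounded_linear_Blinfun_apply bl)
  ultimately show ?thesis by (metis bl bounded_linear_Blinfun_apply)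
qed

lemma norm_bidual_embed: "norm (bidual_embed x) = norm x"
proof (rule antisym)
  show "norm (bidual_embed x) \<le> norm x"
  proof (rule norm_blinfun_bound)
    show "norm (blinfun_apply (bidual_embed x) \<xi>) \<le> norm x * norm \<xi>" for \<xi>
      using norm_blinfun[of \<xi> x] by (simp add: bidual_embed.rep_eq mult.commute)
  qed simp
  obtain \<xi> where \<xi>: "norm \<xi> \<le> 1" "blinfun_apply \<xi> x = norm x" using norming_functional by blast
  have "norm x \<le> norm (bidual_embed x) * norm \<xi>"
    using norm_blinfun[of "bidual_embed x" \<xi>] \<xi>(2) by (simp add: bidual_embed.rep_eq)
  also have "\<dots> \<le> norm (bidual_embed x)" using \<xi>(1) by (simp add: mult_left_le)
  finally show "norm x \<le> norm (bidual_embed x)" .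
qed


section \<open>Completion of a normed space\<close>

text \<open>The completion is the closure of the canonical image in the (complete) bidual.\<close>

typedef (overloaded) 'a completion = "closure (range (bidual_embed :: 'a::real_normed_vector \<Rightarrow> _))"
  morphisms Rep_completion Abs_completion
  by (meson closure_subset range_subsetD)

setup_lifting type_definition_completion

lemma subspace_completion: "subspace (closure (range (bidual_embed :: 'a::real_normed_vector \<Rightarrow> _)))"
proof -
  let ?R = "range (bidual_embed :: 'a \<Rightarrow> _)"
  have sub: "subspace ?R"
    by (intro linear_subspace_image linear_bidual_embed subspace_UNIV)
  show ?thesis
    unfolding subspace_def
  proof (intro conjI ballI allI)
    show "0 \<in> closure ?R" by (rule subsetD[OF closure_subset subspace_0[OF sub]])
    fix x assume "x \<in> closure ?R"
    then obtain X where X: "\<And>n. X n \<in> ?R" "X \<longlonglongrightarrow> x" unfolding closure_sequential by metis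
    show "c *\<^sub>R x \<in> closure ?R" for c
      unfolding closure_sequential
      using X by (intro exI[of _ "\<lambda>n. c *\<^sub>R X n"] conjI allI subspace_scale[OF sub] tendsto_intros)
    fix y assume "y \<in> closure ?R"
    then obtain Y where Y: "\<And>n. Y n \<in> ?R" "Y \<longlonglongrightarrow> y" unfolding closure_sequential by metis
    show "x + y \<in> closure ?R"
      unfolding closure_sequential
      using X Y by (intro exI[of _ "\<lambda>n. X n + Y n"] conjI allI subspace_add[OF sub] tendsto_intros)
  qed
qed

instantiation completion :: (real_normed_vector) real_normed_vector
begin

lift_definition zero_completion :: "'a completion" is 0
  by (rule subspace_0[OF subspace_completion])
lift_definition plus_completion :: "'a completion \<Rightarrow> 'a completion \<Rightarrow> 'a completion" is "(+)"
  by (rule subspace_add[OF subspace_completion])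
lift_definition minus_completion :: "'a completion \<Rightarrow> 'a completion \<Rightarrow> 'a completion" is "(-)"
  by (rule subspace_diff[OF subspace_completion])
lift_definition uminus_completion :: "'a completion \<Rightarrow> 'a completion" is uminus
  by (rule subspace_neg[OF subspace_completion])
lift_definition scaleR_completion :: "real \<Rightarrow> 'a completion \<Rightarrow> 'a completion" is scaleR
  by (rule subspace_scale[OF subspace_completion])
lift_definition norm_completion :: "'a completion \<Rightarrow> real" is norm .
lift_definition dist_completion :: "'a completion \<Rightarrow> 'a completion \<Rightarrow> real" is dist .
definition sgn_completion :: "'a completion \<Rightarrow> 'a completion"
  where "sgn_completion x = scaleR (inverse (norm x)) x"
definition uniformity_completion :: "('a completion \<times> 'a completion) filter"
  where "uniformity_completion = (INF e\<in>{0 <..}. principal {(x, y). dist x y < e})"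
definition open_completion :: "'a completion set \<Rightarrow> bool"
  where "open_completion S = (\<forall>x\<in>S. \<forall>\<^sub>F (x', y) in uniformity. x' = x \<longrightarrow> y \<in> S)"

instance
proof
  fix x y z :: "'a completion" and a b :: real
  show "x + y + z = x + (y + z)" by transfer simp
  show "x + y = y + x" by transfer simp
  show "0 + x = x" by transfer simp
  show "- x + x = 0" by transfer simp
  show "x - y = x + - y" by transfer simp
  show "a *\<^sub>R (x + y) = a *\<^sub>R x + a *\<^sub>R y" by transfer (simp add: scaleR_add_right)
  show "(a + b) *\<^sub>R x = a *\<^sub>R x + b *\<^sub>R x" by transfer (simp add: scaleR_add_left)
  show "a *\<^sub>R b *\<^sub>R x = (a * b) *\<^sub>R x" by transfer simp
  show "1 *\<^sub>R x = x" by transfer simp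
  show "(norm x = 0) = (x = 0)" by transfer simp
  show "norm (x + y) \<le> norm x + norm y" by transfer (rule norm_triangle_ineq)
  show "norm (a *\<^sub>R x) = \<bar>a\<bar> * norm x" by transfer simp
  show "dist x y = norm (x - y)" by transfer (rule dist_norm)
qed (simp_all add: sgn_completion_def uniformity_completion_def open_completion_def)

end

instance completion :: (real_normed_vector) banach
proof
  fix X :: "nat \<Rightarrow> 'a completion"
  assume "Cauchy X"
  then have "Cauchy (\<lambda>n. Rep_completion (X n))"
    unfolding Cauchy_def dist_completion.rep_eq .
  then obtain l where l: "(\<lambda>n. Rep_completion (X n)) \<longlonglongrightarrow> l"
    using Cauchy_convergent convergent_def by blast
  have "l \<in> closure (range (bidual_embed :: 'a \<Rightarrow> _))"
    by (rule closed_sequentially[OF closed_closure _ l]) (rule Rep_completion)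
  then have "Rep_completion (Abs_completion l) = l" by (rule Abs_completion_inverse)
  with l have "X \<longlonglongrightarrow> Abs_completion l"
    by (simp add: tendsto_iff dist_completion.rep_eq)
  then show "convergent X" by (rule convergentI)
qed

lift_definition to_completion :: "'a::real_normed_vector \<Rightarrow> 'a completion" is bidual_embed
  by (meson closure_subset range_subsetD)

lemma linear_to_completion: "linear to_completion"
  unfolding linear_iff by (intro conjI allI; transfer; simp add: bidual_embed_add bidual_embed_scaleR)

lemma norm_to_completion: "norm (to_completion x) = norm x"
  by transfer (rule norm_bidual_embed)

lemma dense_to_completion: "closure (range to_completion) = UNIV"
proof -
  have "x \<in> closure (range to_completion)" for x :: "'a completion"
    unfolding closure_approachable
  proof (intro allI impI)
    fix e :: real assume "e > 0"
    then obtain y where "dist (bidual_embed y) (Rep_completion x) < e"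
      using Rep_completion[of x] unfolding closure_approachable by blast
    then have "dist (to_completion y) x < e" by (simp add: dist_completion.rep_eq to_completion.rep_eq)
    then show "\<exists>y\<in>range to_completion. dist y x < e" by blast
  qed
  then show ?thesis by blast
qed


section \<open>Algebraic tensor product\<close>

text \<open>
  An element of the tensor product is represented by a finite formal sum of pairs \<open>(x, y)\<close>,
  standing for \<open>x \<otimes> y\<close>. Two formal sums denote the same tensor iff every (not necessarily bounded)
  bilinear form takes the same value on them.
\<close>

definition tensor_sum :: "('a \<Rightarrow> 'b \<Rightarrow> real) \<Rightarrow> ('a \<times> 'b) list \<Rightarrow> real" where
  "tensor_sum b xs = (\<Sum>(x, y)\<leftarrow>xs. b x y)"

lemma tensor_sum_simps [simp]:
  "tensor_sum b [] = 0"
  "tensor_sum b ((x, y) # xs) = b x y + tensor_sum b xs"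
  "tensor_sum b (xs @ ys) = tensor_sum b xs + tensor_sum b ys"
  by (simp_all add: tensor_sum_def)

lemma tensor_sum_scale: "bilinear b \<Longrightarrow> tensor_sum b (map (\<lambda>(x, y). (c *\<^sub>R x, y)) xs) = c * tensor_sum b xs"
  by (induction xs) (auto simp: bilinear_lmul distrib_left)

quotient_type (overloaded) ('a, 'b) tensor = "('a::real_vector \<times> 'b::real_vector) list" /
  "\<lambda>u v. \<forall>b. bilinear b \<longrightarrow> tensor_sum b u = tensor_sum b v"
  morphisms rep_tensor abs_tensor
  by (auto intro!: equivpI reflpI sympI transpI)

lift_definition tensor_pair :: "'a::real_vector \<Rightarrow> 'b::real_vector \<Rightarrow> ('a, 'b) tensor"
  is "\<lambda>x y. [(x, y)]" .

instantiation tensor :: (real_vector, real_vector) real_vector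
begin

lift_definition zero_tensor :: "('a, 'b) tensor" is "[]" .
lift_definition plus_tensor :: "('a, 'b) tensor \<Rightarrow> ('a, 'b) tensor \<Rightarrow> ('a, 'b) tensor" is "(@)"
  by simp
lift_definition scaleR_tensor :: "real \<Rightarrow> ('a, 'b) tensor \<Rightarrow> ('a, 'b) tensor"
  is "\<lambda>c. map (\<lambda>(x, y). (c *\<^sub>R x, y))"
  by (simp add: tensor_sum_scale)
definition uminus_tensor :: "('a, 'b) tensor \<Rightarrow> ('a, 'b) tensor" where "uminus_tensor u = (-1) *\<^sub>R u"
definition minus_tensor :: "('a, 'b) tensor \<Rightarrow> ('a, 'b) tensor \<Rightarrow> ('a, 'b) tensor"
  where "minus_tensor u v = u + - v"

instance
proof
  fix x y z :: "('a, 'b) tensor" and a b :: real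
  show "x + y + z = x + (y + z)" by transfer simp
  show "x + y = y + x" by transfer simp
  show "0 + x = x" by transfer simp
  show "- x + x = 0"
    unfolding uminus_tensor_def by transfer (simp add: tensor_sum_scale[where c = "-1", simplified])
  show "x - y = x + - y" by (rule minus_tensor_def)
  show "a *\<^sub>R (x + y) = a *\<^sub>R x + a *\<^sub>R y" by transfer simp
  show "(a + b) *\<^sub>R x = a *\<^sub>R x + b *\<^sub>R x" by transfer (simp add: tensor_sum_scale distrib_right)
  show "a *\<^sub>R b *\<^sub>R x = (a * b) *\<^sub>R x"
    by transfer (simp add: tensor_sum_scale mult.assoc del: map_map)
  show "1 *\<^sub>R x = x" by transfer (simp add: tensor_sum_scale)
qed

end

lemma abs_tensor_surj: "\<exists>xs. abs_tensor xs = u"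
  by (induct u rule: tensor.abs_induct) blast

lemma bilinear_tensor_pair: "bilinear tensor_pair"
  unfolding bilinear_def linear_iff
  by (intro conjI allI; transfer; simp add: bilinear_ladd bilinear_radd bilinear_lmul bilinear_rmul)

lemma abs_tensor_eq_sum: "abs_tensor xs = (\<Sum>(x, y)\<leftarrow>xs. tensor_pair x y)"
proof (induction xs)
  case Nil
  then show ?case by (simp add: zero_tensor.abs_eq)
next
  case (Cons p xs)
  obtain x y where p: "p = (x, y)" by fastforce
  have "abs_tensor (p # xs) = tensor_pair x y + abs_tensor xs"
    by (simp add: tensor_pair.abs_eq plus_tensor.abs_eq p)
  then show ?case using Cons p by simp
qed

text \<open>The value at a tensor of the linear functional induced by a bilinear form.\<close>

lift_definition tensor_form :: "('a::real_vector \<Rightarrow> 'b::real_vector \<Rightarrow> real) \<Rightarrow> ('a, 'b) tensor \<Rightarrow> real"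
  is "\<lambda>b xs. if bilinear b then tensor_sum b xs else 0"
  by simp

lemma tensor_form_abs: "bilinear b \<Longrightarrow> tensor_form b (abs_tensor xs) = tensor_sum b xs"
  by (simp add: tensor_form.abs_eq)

lemma tensor_form_add: "tensor_form b (u + v) = tensor_form b u + tensor_form b v"
  by transfer simp

lemma tensor_form_scaleR: "tensor_form b (c *\<^sub>R u) = c * tensor_form b u"
  by transfer (simp add: tensor_sum_scale)

lemma bilinear_product_form:
  fixes \<phi> :: "'a::real_normed_vector \<Rightarrow>\<^sub>L real" and \<psi> :: "'b::real_normed_vector \<Rightarrow>\<^sub>L real"
  shows "bilinear (\<lambda>x y. blinfun_apply \<phi> x * blinfun_apply \<psi> y)"
  by (simp add: bilinear_def linear_iff blinfun.add_right blinfun.scaleR_right algebra_simps)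

lemma sum_list_linear: "linear f \<Longrightarrow> f (\<Sum>x\<leftarrow>xs. g x) = (\<Sum>x\<leftarrow>xs. f (g x))"
  by (induction xs) (simp_all add: linear_0 linear_add)

lemma tensor_eq_0I:
  fixes u :: "('a::real_normed_vector, 'b::real_normed_vector) tensor"
  assumes "\<And>(\<phi> :: 'a \<Rightarrow>\<^sub>L real) (\<psi> :: 'b \<Rightarrow>\<^sub>L real). norm \<phi> \<le> 1 \<Longrightarrow> norm \<psi> \<le> 1 \<Longrightarrow>
    tensor_form (\<lambda>x y. blinfun_apply \<phi> x * blinfun_apply \<psi> y) u = 0"
  shows "u = 0"
proof -
  obtain xs where u: "u = abs_tensor xs" using abs_tensor_surj by metis
  have z: "(\<Sum>p\<leftarrow>xs. blinfun_apply \<phi> (fst p) * blinfun_apply \<psi> (snd p)) = 0"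
    if "norm \<phi> \<le> 1" "norm \<psi> \<le> 1" for \<phi> :: "'a \<Rightarrow>\<^sub>L real" and \<psi> :: "'b \<Rightarrow>\<^sub>L real"
    using assms[OF that] unfolding u tensor_form_abs[OF bilinear_product_form] tensor_sum_def case_prod_beta .
  have sep: "v = 0" if "\<And>\<phi> :: 'c \<Rightarrow>\<^sub>L real. norm \<phi> \<le> 1 \<Longrightarrow> blinfun_apply \<phi> v = 0" for v :: "'c::real_normed_vector"
    using norming_functional[of v] that by fastforce
  have lin0: "(\<Sum>p\<leftarrow>xs. l (fst p) *\<^sub>R snd p) = 0" if l: "linear l" for l :: "'a \<Rightarrow> real"
  proof (rule sep)
    fix \<psi> :: "'b \<Rightarrow>\<^sub>L real" assume \<psi>: "norm \<psi> \<le> 1"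
    have "(\<Sum>p\<leftarrow>xs. blinfun_apply \<psi> (snd p) *\<^sub>R fst p) = 0"
    proof (rule sep)
      fix \<phi> :: "'a \<Rightarrow>\<^sub>L real" assume \<phi>: "norm \<phi> \<le> 1"
      have "linear (blinfun_apply \<phi>)" by (simp add: linear_iff blinfun.add_right blinfun.scaleR_right)
      then show "blinfun_apply \<phi> (\<Sum>p\<leftarrow>xs. blinfun_apply \<psi> (snd p) *\<^sub>R fst p) = 0"
        using z[OF \<phi> \<psi>] by (simp add: sum_list_linear blinfun.scaleR_right mult.commute)
    qed
    then have "l (\<Sum>p\<leftarrow>xs. blinfun_apply \<psi> (snd p) *\<^sub>R fst p) = 0" using l by (simp add: linear_0)
    then have "(\<Sum>p\<leftarrow>xs. l (fst p) * blinfun_apply \<psi> (snd p)) = 0"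
      using l by (simp add: sum_list_linear linear_cmul mult.commute)
    moreover have "linear (blinfun_apply \<psi>)" by (simp add: linear_iff blinfun.add_right blinfun.scaleR_right)
    ultimately show "blinfun_apply \<psi> (\<Sum>p\<leftarrow>xs. l (fst p) *\<^sub>R snd p) = 0"
      by (simp add: sum_list_linear blinfun.scaleR_right)
  qed
  have "tensor_sum b xs = 0" if b: "bilinear b" for b
  proof -
    obtain B where B: "B \<subseteq> fst ` set xs" "independent B" "fst ` set xs \<subseteq> span B"
      using maximal_independent_subset by blast
    have finB: "finite B" using B(1) finite_subset by blast
    have "\<forall>e. \<exists>l :: 'a \<Rightarrow> real. linear l \<and> (\<forall>x\<in>B. l x = (if x = e then 1 else 0))"
      by (intro allI linear_independent_extend B(2))
    then obtain l :: "'a \<Rightarrow> 'a \<Rightarrow> real" where l: "\<And>e. linear (l e)"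
      "\<And>e x. x \<in> B \<Longrightarrow> l e x = (if x = e then 1 else 0)" by metis
    have expand: "x = (\<Sum>e\<in>B. l e x *\<^sub>R e)" if "x \<in> span B" for x
    proof (rule linear_eq_on[OF _ _ that])
      show "linear (\<lambda>x. x :: 'a)" by (rule linear_ident)
      show "linear (\<lambda>x. \<Sum>e\<in>B. l e x *\<^sub>R e)"
        unfolding linear_iff
        by (simp add: linear_add[OF l(1)] linear_cmul[OF l(1)] scaleR_left_distrib sum.distrib scaleR_sum_right)
      show "x = (\<Sum>e\<in>B. l e x *\<^sub>R e)" if "x \<in> B" for x
      proof -
        have "(\<Sum>e\<in>B. l e x *\<^sub>R e) = (\<Sum>e\<in>B. if e = x then x else 0)"
          by (rule sum.cong) (use l(2)[OF that] in auto)
        then show ?thesis using that finB by simp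
      qed
    qed
    have bl: "linear (\<lambda>x. b x y)" "linear (b x)" for x y using b by (auto simp: bilinear_def)
    have "b (fst p) (snd p) = (\<Sum>e\<in>B. b e (l e (fst p) *\<^sub>R snd p))" if "p \<in> set xs" for p
    proof -
      have "fst p = (\<Sum>e\<in>B. l e (fst p) *\<^sub>R e)" using that B(3) by (intro expand) auto
      then have "b (fst p) (snd p) = b (\<Sum>e\<in>B. l e (fst p) *\<^sub>R e) (snd p)" by simp
      also have "\<dots> = (\<Sum>e\<in>B. b (l e (fst p) *\<^sub>R e) (snd p))" by (rule linear_sum[OF bl(1)])
      finally show ?thesis using b by (simp add: bilinear_lmul bilinear_rmul)
    qed
    then have "tensor_sum b xs = (\<Sum>p\<leftarrow>xs. \<Sum>e\<in>B. b e (l e (fst p) *\<^sub>R snd p))"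
      unfolding tensor_sum_def case_prod_beta by (metis (mono_tags, lifting) map_cong)
    also have "\<dots> = (\<Sum>e\<in>B. \<Sum>p\<leftarrow>xs. b e (l e (fst p) *\<^sub>R snd p))"
      by (induction xs) (simp_all add: sum.distrib)
    also have "\<dots> = (\<Sum>e\<in>B. b e (\<Sum>p\<leftarrow>xs. l e (fst p) *\<^sub>R snd p))"
      by (simp add: sum_list_linear[OF bl(2)])
    also have "\<dots> = 0" by (simp add: lin0[OF l(1)] linear_0[OF bl(2)])
    finally show ?thesis .
  qed
  then show ?thesis unfolding u zero_tensor_def by (simp add: tensor.abs_eq_iff)
qed


section \<open>Projective and injective tensor norms\<close>

definition proj_norm :: "('a::real_normed_vector, 'b::real_normed_vector) tensor \<Rightarrow> real" where
  "proj_norm u = (INF xs\<in>{xs. (\<Sum>(x, y)\<leftarrow>xs. tensor_pair x y) = u}. \<Sum>(x, y)\<leftarrow>xs. norm x * norm y)"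

definition inj_norm :: "('a::real_normed_vector, 'b::real_normed_vector) tensor \<Rightarrow> real" where
  "inj_norm u = (SUP (\<phi>, \<psi>)\<in>{(\<phi> :: 'a \<Rightarrow>\<^sub>L real, \<psi> :: 'b \<Rightarrow>\<^sub>L real). norm \<phi> \<le> 1 \<and> norm \<psi> \<le> 1}.
     \<bar>tensor_form (\<lambda>x y. blinfun_apply \<phi> x * blinfun_apply \<psi> y) u\<bar>)"

abbreviation tensor_cost :: "('a::real_normed_vector \<times> 'b::real_normed_vector) list \<Rightarrow> real" where
  "tensor_cost xs \<equiv> \<Sum>(x, y)\<leftarrow>xs. norm x * norm y"

lemma tensor_cost_nonneg: "0 \<le> tensor_cost xs"
  by (induction xs) auto

lemma proj_norm_le: "proj_norm (abs_tensor xs) \<le> tensor_cost xs"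
  unfolding proj_norm_def abs_tensor_eq_sum[symmetric]
  by (rule cINF_lower) (auto intro!: bdd_belowI[of _ 0] tensor_cost_nonneg)

lemma proj_norm_ge:
  assumes "\<And>xs. abs_tensor xs = u \<Longrightarrow> c \<le> tensor_cost xs"
  shows "c \<le> proj_norm u"
proof -
  obtain xs where "abs_tensor xs = u" using abs_tensor_surj by blast
  then show ?thesis unfolding proj_norm_def abs_tensor_eq_sum[symmetric]
    using assms by (intro cINF_greatest) auto
qed

lemma proj_norm_nonneg: "0 \<le> proj_norm u"
  by (rule proj_norm_ge) (rule tensor_cost_nonneg)

lemma proj_norm_triangle: "proj_norm (u + v) \<le> proj_norm u + proj_norm v"
proof -
  have "proj_norm (u + v) - proj_norm u \<le> proj_norm v"
  proof (rule proj_norm_ge)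
    fix ys assume v: "abs_tensor ys = v"
    have "proj_norm (u + v) - tensor_cost ys \<le> proj_norm u"
    proof (rule proj_norm_ge)
      fix xs assume u: "abs_tensor xs = u"
      show "proj_norm (u + v) - tensor_cost ys \<le> tensor_cost xs"
        using proj_norm_le[of "xs @ ys"] by (simp add: u v flip: plus_tensor.abs_eq)
    qed
    then show "proj_norm (u + v) - proj_norm u \<le> tensor_cost ys" by simp
  qed
  then show ?thesis by simp
qed

lemma proj_norm_scaleR: "proj_norm (c *\<^sub>R u) = \<bar>c\<bar> * proj_norm u"
proof -
  have le: "proj_norm (c *\<^sub>R u) \<le> \<bar>c\<bar> * proj_norm u" if "c \<noteq> 0" for c and u :: "('a, 'b) tensor"
  proof -
    have "proj_norm (c *\<^sub>R u) / \<bar>c\<bar> \<le> proj_norm u"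
    proof (rule proj_norm_ge)
      fix xs assume u: "abs_tensor xs = u"
      have "tensor_cost (map (\<lambda>(x, y). (c *\<^sub>R x, y)) xs) = \<bar>c\<bar> * tensor_cost xs"
        by (induction xs) (auto simp: distrib_left)
      then show "proj_norm (c *\<^sub>R u) / \<bar>c\<bar> \<le> tensor_cost xs"
        using proj_norm_le[of "map (\<lambda>(x, y). (c *\<^sub>R x, y)) xs"] that
        by (simp add: u field_simps flip: scaleR_tensor.abs_eq)
    qed
    then show ?thesis using that by (simp add: field_simps)
  qed
  show ?thesis
  proof (cases "c = 0")
    case True
    have "proj_norm (0 :: ('a, 'b) tensor) \<le> 0"
      using proj_norm_le[of "[] :: ('a \<times> 'b) list"] by (simp flip: zero_tensor.abs_eq)
    then show ?thesis using True proj_norm_nonneg[of "0 :: ('a, 'b) tensor"] by simp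
  next
    case False
    have "proj_norm u \<le> \<bar>inverse c\<bar> * proj_norm (c *\<^sub>R u)"
      using le[of "inverse c" "c *\<^sub>R u"] False by simp
    then show ?thesis using le[OF False, of u] False by (simp add: field_simps)
  qed
qed

lemma product_form_le_proj_norm:
  fixes \<phi> :: "'a::real_normed_vector \<Rightarrow>\<^sub>L real" and \<psi> :: "'b::real_normed_vector \<Rightarrow>\<^sub>L real"
  assumes "norm \<phi> \<le> 1" "norm \<psi> \<le> 1"
  shows "\<bar>tensor_form (\<lambda>x y. blinfun_apply \<phi> x * blinfun_apply \<psi> y) u\<bar> \<le> proj_norm u"
proof (rule proj_norm_ge)
  fix xs assume u: "abs_tensor xs = u"
  have bnd: "\<bar>blinfun_apply \<phi> x * blinfun_apply \<psi> y\<bar> \<le> norm x * norm y" for x y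
  proof -
    have "\<bar>blinfun_apply \<phi> x\<bar> \<le> 1 * norm x" "\<bar>blinfun_apply \<psi> y\<bar> \<le> 1 * norm y"
      using norm_blinfun[of \<phi> x] norm_blinfun[of \<psi> y] mult_right_mono[OF assms(1), of "norm x"]
        mult_right_mono[OF assms(2), of "norm y"] by simp_all
    then show ?thesis by (simp add: abs_mult mult_mono)
  qed
  have "\<bar>tensor_sum (\<lambda>x y. blinfun_apply \<phi> x * blinfun_apply \<psi> y) xs\<bar> \<le> tensor_cost xs"
  proof (induction xs)
    case (Cons p xs)
    then show ?case using bnd[of "fst p" "snd p"] by (cases p) simp
  qed simp
  then show "\<bar>tensor_form (\<lambda>x y. blinfun_apply \<phi> x * blinfun_apply \<psi> y) u\<bar> \<le> tensor_cost xs"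
    by (simp add: tensor_form_abs[OF bilinear_product_form] flip: u)
qed

lemma proj_norm_eq_0: "proj_norm u = 0 \<longleftrightarrow> u = 0"
proof
  assume "proj_norm u = 0"
  then show "u = 0"
    using product_form_le_proj_norm[of _ _ u] by (intro tensor_eq_0I) fastforce
qed (use proj_norm_scaleR[of 0 u] in simp)

lemma product_form_le_inj_norm:
  fixes u :: "('a::real_normed_vector, 'b::real_normed_vector) tensor"
  assumes "norm \<phi> \<le> 1" "norm \<psi> \<le> 1"
  shows "\<bar>tensor_form (\<lambda>x y. blinfun_apply \<phi> x * blinfun_apply \<psi> y) u\<bar> \<le> inj_norm u"
proof -
  define f :: "('a \<Rightarrow>\<^sub>L real) \<times> ('b \<Rightarrow>\<^sub>L real) \<Rightarrow> real"
    where "f = (\<lambda>(\<phi>, \<psi>). \<bar>tensor_form (\<lambda>x y. blinfun_apply \<phi> x * blinfun_apply \<psi> y) u\<bar>)"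
  define S :: "(('a \<Rightarrow>\<^sub>L real) \<times> ('b \<Rightarrow>\<^sub>L real)) set" where "S = {(\<phi>, \<psi>). norm \<phi> \<le> 1 \<and> norm \<psi> \<le> 1}"
  have "f z \<le> proj_norm u" if "z \<in> S" for z
    using that by (cases z) (simp add: f_def S_def product_form_le_proj_norm)
  then have "bdd_above (f ` S)" by (rule bdd_aboveI2)
  moreover have "(\<phi>, \<psi>) \<in> S" using assms by (simp add: S_def)
  ultimately have "f (\<phi>, \<psi>) \<le> (SUP z\<in>S. f z)" by (rule cSUP_upper[rotated])
  then show ?thesis by (simp add: inj_norm_def f_def S_def)
qed

lemma inj_norm_le:
  fixes u :: "('a::real_normed_vector, 'b::real_normed_vector) tensor"
  assumes "\<And>(\<phi> :: 'a \<Rightarrow>\<^sub>L real) (\<psi> :: 'b \<Rightarrow>\<^sub>L real). norm \<phi> \<le> 1 \<Longrightarrow> norm \<psi> \<le> 1 \<Longrightarrow>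
    \<bar>tensor_form (\<lambda>x y. blinfun_apply \<phi> x * blinfun_apply \<psi> y) u\<bar> \<le> c"
  shows "inj_norm u \<le> c"
proof -
  have "{(\<phi> :: 'a \<Rightarrow>\<^sub>L real, \<psi> :: 'b \<Rightarrow>\<^sub>L real). norm \<phi> \<le> 1 \<and> norm \<psi> \<le> 1} \<noteq> {}"
    by (auto intro!: exI[of _ 0])
  then show ?thesis unfolding inj_norm_def by (rule cSUP_least) (use assms in auto)
qed

lemma inj_norm_triangle: "inj_norm (u + v) \<le> inj_norm u + inj_norm v"
  by (rule inj_norm_le, unfold tensor_form_add, rule order_trans[OF abs_triangle_ineq])
    (intro add_mono product_form_le_inj_norm)

lemma inj_norm_scaleR: "inj_norm (c *\<^sub>R u) = \<bar>c\<bar> * inj_norm u"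
proof -
  have le: "inj_norm (c *\<^sub>R u) \<le> \<bar>c\<bar> * inj_norm u" for c and u :: "('a, 'b) tensor"
    by (rule inj_norm_le) (auto simp: tensor_form_scaleR abs_mult intro!: mult_left_mono product_form_le_inj_norm)
  show ?thesis
  proof (cases "c = 0")
    case True
    have "0 \<le> inj_norm (0 :: ('a, 'b) tensor)"
      by (rule order_trans[OF abs_ge_zero product_form_le_inj_norm[of 0 0]]) simp_all
    then show ?thesis using True le[of 0 u] by simp
  next
    case False
    have "inj_norm u \<le> \<bar>inverse c\<bar> * inj_norm (c *\<^sub>R u)"
      using le[of "inverse c" "c *\<^sub>R u"] False by simp
    then show ?thesis using le[of c u] False by (simp add: field_simps)
  qed
qed

lemma inj_norm_eq_0: "inj_norm u = 0 \<longleftrightarrow> u = 0"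
proof
  assume "inj_norm u = 0"
  then show "u = 0"
    using product_form_le_inj_norm[of _ _ u] by (intro tensor_eq_0I) fastforce
qed (use inj_norm_scaleR[of 0 u] in simp)

text \<open>Copies of the algebraic tensor product carrying the two norms.\<close>

typedef (overloaded) ('a, 'b) ptensor = "UNIV :: ('a::real_normed_vector, 'b::real_normed_vector) tensor set"
  morphisms un_ptensor Ptensor ..

setup_lifting type_definition_ptensor

instantiation ptensor :: (real_normed_vector, real_normed_vector) real_normed_vector
begin

lift_definition zero_ptensor :: "('a, 'b) ptensor" is 0 .
lift_definition plus_ptensor :: "('a, 'b) ptensor \<Rightarrow> ('a, 'b) ptensor \<Rightarrow> ('a, 'b) ptensor" is "(+)" .
lift_definition minus_ptensor :: "('a, 'b) ptensor \<Rightarrow> ('a, 'b) ptensor \<Rightarrow> ('a, 'b) ptensor" is "(-)" .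
lift_definition uminus_ptensor :: "('a, 'b) ptensor \<Rightarrow> ('a, 'b) ptensor" is uminus .
lift_definition scaleR_ptensor :: "real \<Rightarrow> ('a, 'b) ptensor \<Rightarrow> ('a, 'b) ptensor" is scaleR .
lift_definition norm_ptensor :: "('a, 'b) ptensor \<Rightarrow> real" is proj_norm .
definition dist_ptensor :: "('a, 'b) ptensor \<Rightarrow> ('a, 'b) ptensor \<Rightarrow> real"
  where "dist_ptensor x y = norm (x - y)"
definition sgn_ptensor :: "('a, 'b) ptensor \<Rightarrow> ('a, 'b) ptensor"
  where "sgn_ptensor x = scaleR (inverse (norm x)) x"
definition uniformity_ptensor :: "(('a, 'b) ptensor \<times> ('a, 'b) ptensor) filter"
  where "uniformity_ptensor = (INF e\<in>{0 <..}. principal {(x, y). dist x y < e})"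
definition open_ptensor :: "('a, 'b) ptensor set \<Rightarrow> bool"
  where "open_ptensor S = (\<forall>x\<in>S. \<forall>\<^sub>F (x', y) in uniformity. x' = x \<longrightarrow> y \<in> S)"

instance
proof
  fix x y z :: "('a, 'b) ptensor" and a b :: real
  show "x + y + z = x + (y + z)" by transfer simp
  show "x + y = y + x" by transfer simp
  show "0 + x = x" by transfer simp
  show "- x + x = 0" by transfer simp
  show "x - y = x + - y" by transfer simp
  show "a *\<^sub>R (x + y) = a *\<^sub>R x + a *\<^sub>R y" by transfer (simp add: scaleR_add_right)
  show "(a + b) *\<^sub>R x = a *\<^sub>R x + b *\<^sub>R x" by transfer (simp add: scaleR_add_left)
  show "a *\<^sub>R b *\<^sub>R x = (a * b) *\<^sub>R x" by transfer simp
  show "1 *\<^sub>R x = x" by transfer simp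
  show "(norm x = 0) = (x = 0)" by transfer (rule proj_norm_eq_0)
  show "norm (x + y) \<le> norm x + norm y" by transfer (rule proj_norm_triangle)
  show "norm (a *\<^sub>R x) = \<bar>a\<bar> * norm x" by transfer (rule proj_norm_scaleR)
qed (simp_all add: dist_ptensor_def sgn_ptensor_def uniformity_ptensor_def open_ptensor_def)

end

typedef (overloaded) ('a, 'b) itensor = "UNIV :: ('a::real_normed_vector, 'b::real_normed_vector) tensor set"
  morphisms un_itensor Itensor ..

setup_lifting type_definition_itensor

instantiation itensor :: (real_normed_vector, real_normed_vector) real_normed_vector
begin

lift_definition zero_itensor :: "('a, 'b) itensor" is 0 .
lift_definition plus_itensor :: "('a, 'b) itensor \<Rightarrow> ('a, 'b) itensor \<Rightarrow> ('a, 'b) itensor" is "(+)" .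
lift_definition minus_itensor :: "('a, 'b) itensor \<Rightarrow> ('a, 'b) itensor \<Rightarrow> ('a, 'b) itensor" is "(-)" .
lift_definition uminus_itensor :: "('a, 'b) itensor \<Rightarrow> ('a, 'b) itensor" is uminus .
lift_definition scaleR_itensor :: "real \<Rightarrow> ('a, 'b) itensor \<Rightarrow> ('a, 'b) itensor" is scaleR .
lift_definition norm_itensor :: "('a, 'b) itensor \<Rightarrow> real" is inj_norm .
definition dist_itensor :: "('a, 'b) itensor \<Rightarrow> ('a, 'b) itensor \<Rightarrow> real"
  where "dist_itensor x y = norm (x - y)"
definition sgn_itensor :: "('a, 'b) itensor \<Rightarrow> ('a, 'b) itensor"
  where "sgn_itensor x = scaleR (inverse (norm x)) x"
definition uniformity_itensor :: "(('a, 'b) itensor \<times> ('a, 'b) itensor) filter"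
  where "uniformity_itensor = (INF e\<in>{0 <..}. principal {(x, y). dist x y < e})"
definition open_itensor :: "('a, 'b) itensor set \<Rightarrow> bool"
  where "open_itensor S = (\<forall>x\<in>S. \<forall>\<^sub>F (x', y) in uniformity. x' = x \<longrightarrow> y \<in> S)"

instance
proof
  fix x y z :: "('a, 'b) itensor" and a b :: real
  show "x + y + z = x + (y + z)" by transfer simp
  show "x + y = y + x" by transfer simp
  show "0 + x = x" by transfer simp
  show "- x + x = 0" by transfer simp
  show "x - y = x + - y" by transfer simp
  show "a *\<^sub>R (x + y) = a *\<^sub>R x + a *\<^sub>R y" by transfer (simp add: scaleR_add_right)
  show "(a + b) *\<^sub>R x = a *\<^sub>R x + b *\<^sub>R x" by transfer (simp add: scaleR_add_left)
  show "a *\<^sub>R b *\<^sub>R x = (a * b) *\<^sub>R x" by transfer simp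
  show "1 *\<^sub>R x = x" by transfer simp
  show "(norm x = 0) = (x = 0)" by transfer (rule inj_norm_eq_0)
  show "norm (x + y) \<le> norm x + norm y" by transfer (rule inj_norm_triangle)
  show "norm (a *\<^sub>R x) = \<bar>a\<bar> * norm x" by transfer (rule inj_norm_scaleR)
qed (simp_all add: dist_itensor_def sgn_itensor_def uniformity_itensor_def open_itensor_def)

end

type_synonym 'a proj_tensor_square = "('a, 'a) ptensor completion"
type_synonym 'a inj_tensor_square = "('a, 'a) itensor completion"

definition proj_square :: "'a::real_normed_vector \<Rightarrow> 'a proj_tensor_square" where
  "proj_square x = to_completion (Ptensor (tensor_pair x x))"

definition inj_square :: "'a::real_normed_vector \<Rightarrow> 'a inj_tensor_square" where
  "inj_square x = to_completion (Itensor (tensor_pair x x))"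


section \<open>Dunford and Pettis integrals\<close>

definition dunford_integrable :: "'w measure \<Rightarrow> ('w \<Rightarrow> 'e::banach) \<Rightarrow> bool" where
  "dunford_integrable M F \<longleftrightarrow> (\<forall>\<xi> :: 'e \<Rightarrow>\<^sub>L real. integrable M (\<lambda>\<omega>. blinfun_apply \<xi> (F \<omega>)))"

definition has_dunford_integral ::
    "'w measure \<Rightarrow> 'w set \<Rightarrow> ('w \<Rightarrow> 'e::banach) \<Rightarrow> (('e \<Rightarrow>\<^sub>L real) \<Rightarrow>\<^sub>L real) \<Rightarrow> bool" where
  "has_dunford_integral M A F \<Phi> \<longleftrightarrow>
     (\<forall>\<xi> :: 'e \<Rightarrow>\<^sub>L real. blinfun_apply \<Phi> \<xi> = (LINT \<omega>:A|M. blinfun_apply \<xi> (F \<omega>)))"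

lemma has_dunford_integral_unique:
  "has_dunford_integral M A F \<Phi> \<Longrightarrow> has_dunford_integral M A F \<Psi> \<Longrightarrow> \<Phi> = \<Psi>"
  by (auto simp: has_dunford_integral_def intro: blinfun_eqI)

definition pettis_integrable :: "'w measure \<Rightarrow> ('w \<Rightarrow> 'e::banach) \<Rightarrow> bool" where
  "pettis_integrable M F \<longleftrightarrow> dunford_integrable M F \<and>
     (\<forall>A\<in>sets M. \<exists>\<Phi>\<in>range bidual_embed. has_dunford_integral M A F \<Phi>)"


section \<open>Uniform integrability\<close>

definition uniformly_integrable :: "'w measure \<Rightarrow> 'i set \<Rightarrow> ('i \<Rightarrow> 'w \<Rightarrow> real) \<Rightarrow> bool" where
  "uniformly_integrable M I f \<longleftrightarrow>
     (\<forall>i\<in>I. f i \<in> borel_measurable M) \<and>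
     ((\<lambda>K. SUP i\<in>I. \<integral>\<^sup>+\<omega>. ennreal \<bar>f i \<omega>\<bar> * indicator {\<omega>. \<bar>f i \<omega>\<bar> > K} \<omega> \<partial>M) \<longlongrightarrow> 0) at_top"


section \<open>The space \<open>D([0,1]\<^sup>m)\<close>\<close>

definition unit_cube :: "(real ^ 'm) set" where
  "unit_cube = {t. \<forall>i. 0 \<le> t $ i \<and> t $ i \<le> 1}"

text \<open>
  The product of the intervals \<open>[0, t\<^sub>i)\<close> for \<open>i \<in> S\<close> and \<open>[t\<^sub>i, 1]\<close> for \<open>i \<notin> S\<close>.
\<close>

definition quadrant :: "real ^ 'm \<Rightarrow> 'm set \<Rightarrow> (real ^ 'm) set" where
  "quadrant t S = {s. \<forall>i. if i \<in> S then 0 \<le> s $ i \<and> s $ i < t $ i else t $ i \<le> s $ i \<and> s $ i \<le> 1}"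

text \<open>
  The filter is not \<open>at t within quadrant t S\<close>: the point \<open>t\<close> itself takes part in the limit
  when it belongs to the quadrant, i.e. when \<open>S = {}\<close>, so that \<open>f\<close> is right-continuous.
\<close>

definition has_quadrant_limits :: "(real ^ 'm::finite \<Rightarrow> real) \<Rightarrow> bool" where
  "has_quadrant_limits f \<longleftrightarrow>
     (\<forall>t\<in>unit_cube. \<forall>S. (\<forall>i\<in>S. 0 < t $ i) \<longrightarrow>
        (\<exists>l. (f \<longlongrightarrow> l) (inf (nhds t) (principal (quadrant t S)))))"

text \<open>A function on the cube is represented by its extension by \<open>0\<close>.\<close>

typedef 'm D_space = "{f :: real ^ 'm::finite \<Rightarrow> real. has_quadrant_limits f \<and> (\<forall>t. t \<notin> unit_cube \<longrightarrow> f t = 0)}"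
  morphisms D_eval Abs_D
  by (rule exI[of _ "\<lambda>_. 0"]) (auto simp: has_quadrant_limits_def)

setup_lifting type_definition_D_space

lemma unit_cube_cbox: "unit_cube = cbox 0 (1 :: real ^ 'm::finite)"
  by (auto simp: unit_cube_def mem_box_cart)

lemma compact_unit_cube: "compact (unit_cube :: (real ^ 'm::finite) set)"
  by (simp add: unit_cube_cbox)

lemma unit_cube_nonempty: "(unit_cube :: (real ^ 'm) set) \<noteq> {}"
  by (auto simp: unit_cube_def intro!: exI[of _ "0 :: real ^ 'm"])

lemma quadrant_limits_locally_bounded:
  fixes f :: "real ^ 'm::finite \<Rightarrow> real"
  assumes "has_quadrant_limits f" "t \<in> unit_cube"
  shows "\<exists>C. \<forall>\<^sub>F s in nhds t. s \<in> unit_cube \<longrightarrow> \<bar>f s\<bar> \<le> C"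
proof -
  have "\<exists>C. \<forall>\<^sub>F s in nhds t. s \<in> unit_cube \<and> s \<in> quadrant t S \<longrightarrow> \<bar>f s\<bar> \<le> C" for S
  proof (cases "\<forall>i\<in>S. 0 < t $ i")
    case True
    then obtain l where "(f \<longlongrightarrow> l) (inf (nhds t) (principal (quadrant t S)))"
      using assms unfolding has_quadrant_limits_def by blast
    then have "\<forall>\<^sub>F s in inf (nhds t) (principal (quadrant t S)). dist (f s) l < 1"
      by (rule tendstoD) simp
    then have "\<forall>\<^sub>F s in nhds t. s \<in> quadrant t S \<longrightarrow> dist (f s) l < 1"
      by (simp add: eventually_inf_principal)
    then have "\<forall>\<^sub>F s in nhds t. s \<in> unit_cube \<and> s \<in> quadrant t S \<longrightarrow> \<bar>f s\<bar> \<le> \<bar>l\<bar> + 1"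
      by eventually_elim (auto simp: dist_real_def)
    then show ?thesis by blast
  next
    case False
    then obtain i where "i \<in> S" "t $ i \<le> 0" by force
    then have "s \<notin> quadrant t S" for s
      unfolding quadrant_def by (auto intro!: exI[of _ i])
    then show ?thesis by simp
  qed
  then have "\<exists>C. \<forall>S. \<forall>\<^sub>F s in nhds t. s \<in> unit_cube \<and> s \<in> quadrant t S \<longrightarrow> \<bar>f s\<bar> \<le> C S"
    by (intro choice allI)
  then obtain C where C: "\<And>S. \<forall>\<^sub>F s in nhds t. s \<in> unit_cube \<and> s \<in> quadrant t S \<longrightarrow> \<bar>f s\<bar> \<le> C S"
    by blast
  have "\<forall>\<^sub>F s in nhds t. \<forall>S. s \<in> unit_cube \<and> s \<in> quadrant t S \<longrightarrow> \<bar>f s\<bar> \<le> C S"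
    by (rule eventually_all_finite) (rule C)
  then have "\<forall>\<^sub>F s in nhds t. s \<in> unit_cube \<longrightarrow> \<bar>f s\<bar> \<le> Max (range C)"
  proof eventually_elim
    case (elim s)
    show ?case
    proof
      assume s: "s \<in> unit_cube"
      have "s \<in> quadrant t {i. s $ i < t $ i}" using s by (auto simp: quadrant_def unit_cube_def)
      with elim s have "\<bar>f s\<bar> \<le> C {i. s $ i < t $ i}" by blast
      also have "\<dots> \<le> Max (range C)" by (intro Max_ge) auto
      finally show "\<bar>f s\<bar> \<le> Max (range C)" .
    qed
  qed
  then show ?thesis by blast
qed

lemma quadrant_limits_bounded:
  fixes f :: "real ^ 'm::finite \<Rightarrow> real"
  assumes "has_quadrant_limits f"
  shows "bounded (f ` unit_cube)"
proof -
  have "\<forall>t\<in>unit_cube. \<exists>C U. open U \<and> t \<in> U \<and> (\<forall>s\<in>U. s \<in> unit_cube \<longrightarrow> \<bar>f s\<bar> \<le> C)"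
    using quadrant_limits_locally_bounded[OF assms] unfolding eventually_nhds by blast
  then obtain C U where CU: "\<And>t. t \<in> unit_cube \<Longrightarrow>
      open (U t) \<and> t \<in> U t \<and> (\<forall>s\<in>U t. s \<in> unit_cube \<longrightarrow> \<bar>f s\<bar> \<le> C t)"
    by metis
  obtain T where T: "T \<subseteq> unit_cube" "finite T" "unit_cube \<subseteq> (\<Union>t\<in>T. U t)"
    by (rule compactE_image[OF compact_unit_cube, of unit_cube U]) (use CU in auto)
  have "\<bar>f s\<bar> \<le> (\<Sum>t\<in>T. \<bar>C t\<bar>)" if s: "s \<in> unit_cube" for s
  proof -
    obtain t where t: "t \<in> T" "s \<in> U t" using subsetD[OF T(3) s] by auto
    then have "\<bar>f s\<bar> \<le> C t" using CU[of t] T(1) s by auto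
    also have "\<dots> \<le> \<bar>C t\<bar>" by simp
    also have "\<dots> \<le> (\<Sum>t\<in>T. \<bar>C t\<bar>)" using t T by (intro member_le_sum) auto
    finally show ?thesis .
  qed
  then show ?thesis by (auto simp: bounded_iff)
qed

lemma has_quadrant_limits_add:
  "has_quadrant_limits f \<Longrightarrow> has_quadrant_limits g \<Longrightarrow> has_quadrant_limits (\<lambda>t. f t + g t)"
  unfolding has_quadrant_limits_def by (fast intro: tendsto_add)

lemma has_quadrant_limits_cmul: "has_quadrant_limits f \<Longrightarrow> has_quadrant_limits (\<lambda>t. c * f t)"
  unfolding has_quadrant_limits_def by (fast intro: tendsto_mult_left)

lemma D_eval_outside: "t \<notin> unit_cube \<Longrightarrow> D_eval f t = 0"
  using D_eval[of f] by blast

lemma D_eval_limits: "has_quadrant_limits (D_eval f)"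
  using D_eval[of f] by blast

instantiation D_space :: (finite) real_normed_vector
begin

lift_definition zero_D_space :: "'a D_space" is "\<lambda>_. 0"
  by (auto simp: has_quadrant_limits_def)
lift_definition plus_D_space :: "'a D_space \<Rightarrow> 'a D_space \<Rightarrow> 'a D_space" is "\<lambda>f g t. f t + g t"
  by (simp add: has_quadrant_limits_add)
lift_definition scaleR_D_space :: "real \<Rightarrow> 'a D_space \<Rightarrow> 'a D_space" is "\<lambda>c f t. c * f t"
  by (simp add: has_quadrant_limits_cmul)
lift_definition uminus_D_space :: "'a D_space \<Rightarrow> 'a D_space" is "\<lambda>f t. - f t"
  using has_quadrant_limits_cmul[of _ "-1"] by auto
lift_definition minus_D_space :: "'a D_space \<Rightarrow> 'a D_space \<Rightarrow> 'a D_space" is "\<lambda>f g t. f t - g t"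
  using has_quadrant_limits_add has_quadrant_limits_cmul[of _ "-1"] by fastforce
definition norm_D_space :: "'a D_space \<Rightarrow> real"
  where "norm_D_space f = (SUP t\<in>unit_cube. \<bar>D_eval f t\<bar>)"
definition dist_D_space :: "'a D_space \<Rightarrow> 'a D_space \<Rightarrow> real"
  where "dist_D_space f g = norm (f - g)"
definition sgn_D_space :: "'a D_space \<Rightarrow> 'a D_space"
  where "sgn_D_space f = scaleR (inverse (norm f)) f"
definition uniformity_D_space :: "('a D_space \<times> 'a D_space) filter"
  where "uniformity_D_space = (INF e\<in>{0 <..}. principal {(x, y). dist x y < e})"
definition open_D_space :: "'a D_space set \<Rightarrow> bool"
  where "open_D_space S = (\<forall>x\<in>S. \<forall>\<^sub>F (x', y) in uniformity. x' = x \<longrightarrow> y \<in> S)"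

lemma D_eval_le_norm: "\<bar>D_eval f t\<bar> \<le> norm f"
proof -
  have le: "\<bar>D_eval f s\<bar> \<le> norm f" if "s \<in> unit_cube" for s
  proof -
    obtain a where "\<And>x. x \<in> unit_cube \<Longrightarrow> \<bar>D_eval f x\<bar> \<le> a"
      using quadrant_limits_bounded[OF D_eval_limits[of f]] by (auto simp: bounded_iff)
    then show ?thesis
      unfolding norm_D_space_def using that by (intro cSUP_upper bdd_aboveI2[of _ _ a])
  qed
  obtain s :: "real ^ 'a" where "s \<in> unit_cube" using unit_cube_nonempty by blast
  with le have "0 \<le> norm f" by force
  with le show ?thesis by (cases "t \<in> unit_cube") (simp_all add: D_eval_outside)
qed

lemma D_norm_leI: "(\<And>t. t \<in> unit_cube \<Longrightarrow> \<bar>D_eval f t\<bar> \<le> c) \<Longrightarrow> norm f \<le> c"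
  unfolding norm_D_space_def by (intro cSUP_least unit_cube_nonempty)

lemma D_eqI: "(\<And>t. D_eval f t = D_eval g t) \<Longrightarrow> f = g"
  by (metis D_eval_inject ext)

instance
proof
  fix x y z :: "'a D_space" and a b :: real
  show "x + y + z = x + (y + z)" by transfer (simp add: add.assoc)
  show "x + y = y + x" by transfer (simp add: add.commute)
  show "0 + x = x" by transfer simp
  show "- x + x = 0" by transfer simp
  show "x - y = x + - y" by transfer simp
  show "a *\<^sub>R (x + y) = a *\<^sub>R x + a *\<^sub>R y" by transfer (simp add: distrib_left)
  show "(a + b) *\<^sub>R x = a *\<^sub>R x + b *\<^sub>R x" by transfer (simp add: distrib_right)
  show "a *\<^sub>R b *\<^sub>R x = (a * b) *\<^sub>R x" by transfer (simp add: mult.assoc)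
  show "1 *\<^sub>R x = x" by transfer simp
  show "(norm x = 0) = (x = 0)"
  proof
    assume "norm x = 0"
    then show "x = 0" using D_eval_le_norm[of x] by (intro D_eqI) (simp add: zero_D_space.rep_eq)
  next
    assume "x = 0"
    then show "norm x = 0"
      by (simp add: norm_D_space_def zero_D_space.rep_eq cSUP_const[OF unit_cube_nonempty])
  qed
  show "norm (x + y) \<le> norm x + norm y"
    by (rule D_norm_leI, unfold plus_D_space.rep_eq) (meson D_eval_le_norm abs_triangle_ineq add_mono order_trans)
  have le: "norm (a *\<^sub>R x) \<le> \<bar>a\<bar> * norm x" for a and x :: "'a D_space"
    by (rule D_norm_leI) (simp add: scaleR_D_space.rep_eq abs_mult mult_left_mono D_eval_le_norm)
  show "norm (a *\<^sub>R x) = \<bar>a\<bar> * norm x"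
  proof (cases "a = 0")
    case True
    have "0 \<le> norm (a *\<^sub>R x)" using D_eval_le_norm[of "a *\<^sub>R x" 0] by simp
    then show ?thesis using True le[of a x] by simp
  next
    case False
    have "inverse a *\<^sub>R (a *\<^sub>R x) = x" using False by (intro D_eqI) (simp add: scaleR_D_space.rep_eq)
    then have "norm x \<le> \<bar>inverse a\<bar> * norm (a *\<^sub>R x)" using le[of "inverse a" "a *\<^sub>R x"] by simp
    then show ?thesis using False le[of a x] by (simp add: field_simps)
  qed
qed (simp_all add: dist_D_space_def sgn_D_space_def uniformity_D_space_def open_D_space_def)

end

instance D_space :: (finite) banach
proof
  fix X :: "nat \<Rightarrow> 'a D_space"
  assume X: "Cauchy X"
  have dle: "\<bar>D_eval (X n) t - D_eval (X m) t\<bar> \<le> dist (X n) (X m)" for n m t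
    using D_eval_le_norm[of "X n - X m" t] by (simp add: dist_norm minus_D_space.rep_eq)
  have "Cauchy (\<lambda>n. D_eval (X n) t)" for t
    using X dle unfolding Cauchy_def dist_real_def by (meson le_less_trans)
  then have "\<forall>t. \<exists>l. (\<lambda>n. D_eval (X n) t) \<longlonglongrightarrow> l"
    using Cauchy_convergent convergent_def by blast
  then obtain g where g: "\<And>t. (\<lambda>n. D_eval (X n) t) \<longlonglongrightarrow> g t" by metis
  have unif: "\<exists>N. \<forall>n\<ge>N. \<forall>t. \<bar>D_eval (X n) t - g t\<bar> \<le> e" if e: "e > 0" for e
  proof -
    obtain N where N: "\<And>n m. n \<ge> N \<Longrightarrow> m \<ge> N \<Longrightarrow> dist (X n) (X m) < e"
      using X e unfolding Cauchy_def by blast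
    have "\<bar>D_eval (X n) t - g t\<bar> \<le> e" if n: "n \<ge> N" for n t
    proof (rule tendsto_upperbound)
      show "(\<lambda>m. \<bar>D_eval (X n) t - D_eval (X m) t\<bar>) \<longlonglongrightarrow> \<bar>D_eval (X n) t - g t\<bar>"
        by (intro tendsto_intros g)
      show "\<forall>\<^sub>F m in sequentially. \<bar>D_eval (X n) t - D_eval (X m) t\<bar> \<le> e"
        using eventually_ge_at_top[of N]
      proof eventually_elim
        case (elim m)
        then show ?case using dle[of n t m] N[OF n, of m] by simp
      qed
    qed simp
    then show ?thesis by blast
  qed
  have "has_quadrant_limits g"
    unfolding has_quadrant_limits_def
  proof (intro ballI allI impI)
    fix t :: "real ^ 'a" and S
    assume t: "t \<in> unit_cube" "\<forall>i\<in>S. 0 < t $ i"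
    define F where "F = inf (nhds t) (principal (quadrant t S))"
    have "\<forall>n. \<exists>l. (D_eval (X n) \<longlongrightarrow> l) F"
      using D_eval_limits t unfolding has_quadrant_limits_def F_def by blast
    then obtain l where l: "\<And>n. (D_eval (X n) \<longlongrightarrow> l n) F" by metis
    show "\<exists>L. (g \<longlongrightarrow> L) F"
    proof (cases "F = bot")
      case True
      then show ?thesis by simp
    next
      case False
      have "\<bar>l n - l m\<bar> \<le> dist (X n) (X m)" for n m
        by (rule tendsto_upperbound[OF _ _ False, of "\<lambda>s. \<bar>D_eval (X n) s - D_eval (X m) s\<bar>"])
          (intro tendsto_intros l, simp add: dle)
      then have "Cauchy l" using X unfolding Cauchy_def dist_real_def by (meson le_less_trans)
      then obtain L where L: "l \<longlonglongrightarrow> L" using Cauchy_convergent convergent_def by blast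
      have "(g \<longlongrightarrow> L) F"
      proof (rule tendstoI)
        fix e :: real assume e: "e > 0"
        obtain N where N: "\<And>n s. n \<ge> N \<Longrightarrow> \<bar>D_eval (X n) s - g s\<bar> \<le> e / 3"
          using unif[of "e / 3"] e by auto
        have "\<forall>\<^sub>F n in sequentially. dist (l n) L < e / 3" using tendstoD[OF L, of "e / 3"] e by simp
        then obtain n where n: "n \<ge> N" "dist (l n) L < e / 3"
          unfolding eventually_sequentially by (metis nle_le order_refl)
        have "\<forall>\<^sub>F s in F. dist (D_eval (X n) s) (l n) < e / 3" using tendstoD[OF l, of "e / 3"] e by simp
        then show "\<forall>\<^sub>F s in F. dist (g s) L < e"
        proof eventually_elim
          case (elim s)
          then show ?case using N[OF n(1), of s] n(2) unfolding dist_real_def by linarith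
        qed
      qed
      then show ?thesis by blast
    qed
  qed
  moreover have "g t = 0" if "t \<notin> unit_cube" for t
    using g[of t] that by (simp add: D_eval_outside LIMSEQ_const_iff)
  ultimately have G: "D_eval (Abs_D g) = g" by (simp add: Abs_D_inverse)
  have "X \<longlonglongrightarrow> Abs_D g"
  proof (rule metric_LIMSEQ_I)
    fix e :: real assume e: "e > 0"
    obtain N where N: "\<And>n s. n \<ge> N \<Longrightarrow> \<bar>D_eval (X n) s - g s\<bar> \<le> e / 2"
      using unif[of "e / 2"] e by auto
    have "dist (X n) (Abs_D g) < e" if "n \<ge> N" for n
    proof -
      have "dist (X n) (Abs_D g) \<le> e / 2"
        unfolding dist_norm using N[OF that] by (intro D_norm_leI) (simp add: minus_D_space.rep_eq G)
      then show ?thesis using e by simp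
    qed
    then show "\<exists>N. \<forall>n\<ge>N. dist (X n) (Abs_D g) < e" by blast
  qed
  then show "convergent X" by (rule convergentI)
qed

definition D_field :: "'m::finite D_space measure" where
  "D_field = sigma UNIV {(\<lambda>f. D_eval f t) -` A | t A. t \<in> unit_cube \<and> A \<in> sets borel}"

lemma measurable_D_field_iff:
  fixes X :: "'w \<Rightarrow> 'm::finite D_space"
  shows "X \<in> measurable M D_field \<longleftrightarrow>
    (\<forall>t\<in>unit_cube. (\<lambda>\<omega>. D_eval (X \<omega>) t) \<in> borel_measurable M)"
proof
  assume X: "X \<in> measurable M D_field"
  show "\<forall>t\<in>unit_cube. (\<lambda>\<omega>. D_eval (X \<omega>) t) \<in> borel_measurable M"
  proof
    fix t :: "real ^ 'm" assume t: "t \<in> unit_cube"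
    have "(\<lambda>f. D_eval f t) \<in> borel_measurable D_field"
      by (rule measurableI) (use t in \<open>auto simp: D_field_def\<close>)
    then show "(\<lambda>\<omega>. D_eval (X \<omega>) t) \<in> borel_measurable M"
      using measurable_compose[OF X] by blast
  qed
next
  assume X: "\<forall>t\<in>unit_cube. (\<lambda>\<omega>. D_eval (X \<omega>) t) \<in> borel_measurable M"
  show "X \<in> measurable M D_field"
    unfolding D_field_def
  proof (rule measurable_measure_of)
    fix B :: "'m D_space set"
    assume "B \<in> {(\<lambda>f. D_eval f t) -` A | t A. t \<in> unit_cube \<and> A \<in> sets borel}"
    then obtain t A where tA: "B = (\<lambda>f. D_eval f t) -` A" "t \<in> unit_cube" "A \<in> sets borel" by blast
    then have "(\<lambda>\<omega>. D_eval (X \<omega>) t) -` A \<inter> space M \<in> sets M" using X measurable_sets by blast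
    then show "X -` B \<inter> space M \<in> sets M" by (simp add: tA(1) vimage_def)
  qed auto
qed

end

theory Submission
  imports Defs
begin

text \<open>
  Every bounded bilinear form \<open>\<alpha>\<close> on \<open>D([0,1]\<^sup>m)\<close> satisfies
  \<open>\<bar>\<alpha> f f\<bar> \<le> K \<mu> (f\<^sup>2)\<close> for some state \<open>\<mu>\<close>, by Grothendieck's inequality and a
  Hahn--Banach argument. As \<open>\<mu>\<close> charges only countably many of the hyperplanes \<open>t\<^sub>i = c\<close>, sampling
  along suitable finite grids converges in \<open>\<mu>\<close>-mean square for all \<open>f\<close> at once. This makes
  \<open>\<alpha> (X, X)\<close> measurable and, with Fatou's lemma, bounds its expectation by
  \<open>K sup\<^sub>t E \<bar>X(t)\<bar>\<^sup>2\<close>. If \<open>\<bar>X(t)\<bar>\<^sup>2\<close> is uniformly integrable, \<open>t \<mapsto> X(t)\<close> has quadrant limits in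
  \<open>L\<^sup>2\<close>, so the grids can be chosen uniformly in \<open>t\<close>; the moments of the sampled elements are then
  Cauchy in the projective norm, and their limit is the Pettis integral.

  Conversely, if the second moments are unbounded, a weighted sum of the functionals
  \<open>f \<otimes> g \<mapsto> f(t\<^sub>n) g(t\<^sub>n)\<close> is not integrable. If the integral over the whole space lies in the
  tensor square, then along a subsequence for which the evaluations at \<open>t\<^sub>n\<close> converge pointwise
  the second moments converge to that of the limit, and Scheffe's lemma yields convergence
  of \<open>\<bar>X(t\<^sub>n)\<bar>\<^sup>2\<close> in \<open>L\<^sup>1\<close>, hence uniform integrability.
\<close>

text \<open>The sup norm makes D([0,1]^m) non-separable: no sequence of grids makes sampling
  converge in norm for every f, and continuity of a bilinear form \<alpha> does not make \<alpha>(X,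
  X) a random variable. Functionals on the projective square are arbitrary bounded bilinear forms,
  so every estimate has to hold for these. Grothendieck's inequality replaces the sup norm by a mean
  square, and for a mean square countably many grid values are enough. States stand in for
  probability measures on a compactification of the cube, which is never constructed. The state
  dominates \<alpha> on the diagonal only, so differences \<alpha>(f, f) - \<alpha>(g, g) are
  estimated by a polarisation with a free weight k. The constant 8 B arises from clipping: the
  clipped parts cost 4 B, the two residual parts a quarter each of the best constant K, and K \<le>
  4 B + K / 2. It depends on \<alpha> through its norm alone; this uniformity turns estimates for
  single functionals into convergence in the tensor norm. Both squares are treated by one locale,
  and their equivalence comes out only through the moment conditions on X(t).\<close>

lemma has_quadrant_limits_mult:
  "has_quadrant_limits f \<Longrightarrow> has_quadrant_limits g \<Longrightarrow> has_quadrant_limits (\<lambda>t. f t * g t)"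
  unfolding has_quadrant_limits_def by (fast intro: tendsto_mult)

lift_definition D_mult :: "'m::finite D_space \<Rightarrow> 'm D_space \<Rightarrow> 'm D_space" is "\<lambda>f g t. f t * g t"
  by (simp add: has_quadrant_limits_mult)

definition clip :: "real \<Rightarrow> real \<Rightarrow> real" where
  "clip K x = max (- K) (min K x)"

lemma has_quadrant_limits_clip:
  "has_quadrant_limits f \<Longrightarrow> has_quadrant_limits (\<lambda>t. clip K (f t))"
  unfolding has_quadrant_limits_def clip_def by (fast intro: tendsto_max tendsto_min tendsto_const)

lift_definition D_clip :: "'m::finite D_space \<Rightarrow> 'm D_space" is "\<lambda>f t. clip 2 (f t)"
  by (simp add: has_quadrant_limits_clip) (simp add: clip_def)

lemma D_eval_add: "D_eval (f + g) t = D_eval f t + D_eval g t"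
  by (simp add: plus_D_space.rep_eq)
lemma D_eval_diff: "D_eval (f - g) t = D_eval f t - D_eval g t"
  by (simp add: minus_D_space.rep_eq)
lemma D_eval_scaleR: "D_eval (c *\<^sub>R f) t = c * D_eval f t"
  by (simp add: scaleR_D_space.rep_eq)
lemma D_eval_zero: "D_eval 0 t = 0"
  by (simp add: zero_D_space.rep_eq)
lemma D_eval_minus: "D_eval (- f) t = - D_eval f t"
  by (simp add: uminus_D_space.rep_eq)

lemmas D_eval_simps = D_eval_add D_eval_diff D_eval_scaleR D_eval_zero D_eval_minus
  D_mult.rep_eq D_clip.rep_eq

lemma D_eval_sum: "D_eval (\<Sum>a\<in>A. f a) t = (\<Sum>a\<in>A. D_eval (f a) t)"
  by (induction A rule: infinite_finite_induct) (auto simp: D_eval_simps)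

section \<open>Grids and step functions\<close>

definition grid :: "real set \<Rightarrow> bool" where
  "grid C \<longleftrightarrow> finite C \<and> 0 \<in> C \<and> C \<subseteq> {0..1}"

text \<open>A grid contains \<open>0\<close>, so for \<open>x \<ge> 0\<close> this is a maximum over a nonempty set.\<close>

definition grid_floor :: "real set \<Rightarrow> real \<Rightarrow> real" where
  "grid_floor C x = Max {c \<in> C. c \<le> x}"

definition grid_point :: "real set \<Rightarrow> real ^ 'm \<Rightarrow> real ^ 'm" where
  "grid_point C t = (\<chi> i. grid_floor C (t $ i))"

definition grid_points :: "real set \<Rightarrow> (real ^ 'm) set" where
  "grid_points C = {t. \<forall>i. t $ i \<in> C}"

lemma grid_union: "grid C \<Longrightarrow> grid C' \<Longrightarrow> grid (C \<union> C')"
  by (auto simp: grid_def)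

lemma grid_floor:
  assumes "grid C" "0 \<le> x"
  shows "grid_floor C x \<in> C" "grid_floor C x \<le> x" "0 \<le> grid_floor C x" "grid_floor C x \<le> 1"
proof -
  have "finite {c \<in> C. c \<le> x}" "{c \<in> C. c \<le> x} \<noteq> {}"
    using assms by (auto simp: grid_def)
  then have "grid_floor C x \<in> {c \<in> C. c \<le> x}"
    unfolding grid_floor_def by (rule Max_in)
  then show "grid_floor C x \<in> C" "grid_floor C x \<le> x" "0 \<le> grid_floor C x" "grid_floor C x \<le> 1"
    using assms by (auto simp: grid_def)
qed

lemma grid_floor_ge: "grid C \<Longrightarrow> c \<in> C \<Longrightarrow> c \<le> x \<Longrightarrow> c \<le> grid_floor C x"
  unfolding grid_floor_def by (intro Max_ge) (auto simp: grid_def)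

lemma grid_floor_eqI:
  assumes "grid C" "0 \<le> x" "y \<in> C" "y \<le> x" "\<And>c. c \<in> C \<Longrightarrow> c \<le> x \<Longrightarrow> c \<le> y"
  shows "grid_floor C x = y"
  using assms grid_floor[of C x] grid_floor_ge[of C y x] by (metis order_antisym)

lemma grid_floor_self: "grid C \<Longrightarrow> c \<in> C \<Longrightarrow> grid_floor C c = c"
  by (rule grid_floor_eqI) (auto simp: grid_def)

lemma finite_grid_points:
  assumes "grid C"
  shows "finite (grid_points C :: (real ^ 'm::finite) set)"
proof -
  have "(grid_points C :: (real ^ 'm) set) \<subseteq> vec_lambda ` (PiE UNIV (\<lambda>_. C))"
  proof
    fix t :: "real ^ 'm" assume "t \<in> grid_points C"
    then have "vec_nth t \<in> PiE UNIV (\<lambda>_. C)" by (auto simp: grid_points_def)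
    then show "t \<in> vec_lambda ` (PiE UNIV (\<lambda>_. C))" by (metis image_eqI vec_nth_inverse)
  qed
  moreover have "finite (PiE (UNIV :: 'm set) (\<lambda>_. C))"
    using assms by (intro finite_PiE) (auto simp: grid_def)
  ultimately show ?thesis by (meson finite_imageI finite_subset)
qed

lemma grid_points_subset: "grid C \<Longrightarrow> grid_points C \<subseteq> unit_cube"
  by (fastforce simp: grid_def grid_points_def unit_cube_def)

lemma grid_point_in: "grid C \<Longrightarrow> t \<in> unit_cube \<Longrightarrow> grid_point C t \<in> grid_points C"
  by (auto simp: grid_points_def grid_point_def unit_cube_def grid_floor)

lemma grid_point_cube: "grid C \<Longrightarrow> t \<in> unit_cube \<Longrightarrow> grid_point C t \<in> unit_cube"
  using grid_point_in grid_points_subset by blast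

lemma grid_point_self: "grid C \<Longrightarrow> t \<in> grid_points C \<Longrightarrow> grid_point C t = t"
  by (simp add: vec_eq_iff grid_points_def grid_point_def grid_floor_self)

text \<open>Inside a quadrant each coordinate approaches its limit from one fixed side, so near
  \<open>t\<close> the set of grid values below \<open>s $ i\<close> no longer changes. The floor is
  then the last grid value below \<open>t $ i\<close>, strictly below for \<open>i \<in> S\<close>.
  This is why step functions have quadrant limits.\<close>

lemma eventually_grid_floor_const:
  assumes "grid C" "t \<in> unit_cube"
  shows "\<exists>p. \<forall>\<^sub>F s in inf (nhds t) (principal (quadrant t S)). s \<in> unit_cube \<longrightarrow> grid_point C s = (p :: real ^ 'm::finite)"
proof -
  have fin: "finite C" using assms by (simp add: grid_def)
  have t: "0 \<le> t $ i" for i using assms by (auto simp: unit_cube_def)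
  have "\<forall>\<^sub>F s in nhds t. \<forall>i. \<forall>c\<in>C. (c < t $ i \<longrightarrow> c < s $ i) \<and> (t $ i < c \<longrightarrow> s $ i < c)"
  proof (intro eventually_all_finite eventually_ball_finite fin ballI)
    fix i c assume "c \<in> C"
    have lim: "((\<lambda>s. s $ i) \<longlongrightarrow> t $ i) (nhds t)"
      by (intro tendsto_vec_nth filterlim_ident)
    have "\<forall>\<^sub>F s in nhds t. c < t $ i \<longrightarrow> c < s $ i"
      using order_tendstoD(1)[OF lim, of c] by (cases "c < t $ i") auto
    moreover have "\<forall>\<^sub>F s in nhds t. t $ i < c \<longrightarrow> s $ i < c"
      using order_tendstoD(2)[OF lim, of c] by (cases "t $ i < c") auto
    ultimately show "\<forall>\<^sub>F s in nhds t. (c < t $ i \<longrightarrow> c < s $ i) \<and> (t $ i < c \<longrightarrow> s $ i < c)"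
      by (rule eventually_conj)
  qed
  then have "\<forall>\<^sub>F s in nhds t. s \<in> quadrant t S \<longrightarrow> s \<in> unit_cube \<longrightarrow> grid_point C s
      = (\<chi> i. if i \<in> S then Max {c\<in>C. c < t $ i} else Max {c \<in> C. c \<le> t $ i})"
  proof eventually_elim
    case (elim s)
    show ?case
    proof (intro impI)
      assume s: "s \<in> quadrant t S" "s \<in> unit_cube"
      have "{c \<in> C. c \<le> s $ i} = (if i \<in> S then {c\<in>C. c < t $ i} else {c\<in>C. c \<le> t $ i})" for i
        using s elim[rule_format, of _ i] unfolding quadrant_def
        by (auto split: if_splits) (smt (verit))+
      then show "grid_point C s = (\<chi> i. if i \<in> S then Max {c\<in>C. c < t $ i} else Max {c \<in> C. c \<le> t $ i})"
        by (simp add: vec_eq_iff grid_point_def grid_floor_def)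
    qed
  qed
  then show ?thesis by (intro exI) (simp add: eventually_inf_principal)
qed

lemma has_quadrant_limits_step:
  assumes "grid C"
  shows "has_quadrant_limits (\<lambda>t. if t \<in> unit_cube then g (grid_point C t) else 0)"
  unfolding has_quadrant_limits_def
proof (intro ballI allI impI)
  fix t :: "real ^ 'a" and S assume t: "t \<in> unit_cube" "\<forall>i\<in>S. 0 < t $ i"
  obtain p where p: "\<forall>\<^sub>F s in inf (nhds t) (principal (quadrant t S)). s \<in> unit_cube \<longrightarrow> grid_point C s = p"
    using eventually_grid_floor_const[OF assms t(1)] by blast
  have "s \<in> unit_cube" if "s \<in> quadrant t S" for s
    using that t unfolding quadrant_def unit_cube_def by (smt (verit) mem_Collect_eq)
  then have "\<forall>\<^sub>F s in inf (nhds t) (principal (quadrant t S)). s \<in> unit_cube"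
    by (simp add: eventually_inf_principal)
  with p have "\<forall>\<^sub>F s in inf (nhds t) (principal (quadrant t S)).
      (if s \<in> unit_cube then g (grid_point C s) else 0) = g p"
    by eventually_elim simp
  then have "((\<lambda>t. if t \<in> unit_cube then g (grid_point C t) else 0) \<longlongrightarrow> g p)
      (inf (nhds t) (principal (quadrant t S)))"
    by (rule tendsto_eventually)
  then show "\<exists>l. ((\<lambda>t. if t \<in> unit_cube then g (grid_point C t) else 0) \<longlongrightarrow> l)
      (inf (nhds t) (principal (quadrant t S)))" ..
qed

definition step :: "real set \<Rightarrow> (real ^ 'm \<Rightarrow> real) \<Rightarrow> 'm::finite D_space" where
  "step C g = Abs_D (\<lambda>t. if t \<in> unit_cube then g (grid_point C t) else 0)"

lemma D_eval_step:
  "grid C \<Longrightarrow> D_eval (step C g) t = (if t \<in> unit_cube then g (grid_point C t) else 0)"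
  unfolding step_def by (subst Abs_D_inverse) (auto intro: has_quadrant_limits_step)

text \<open>For \<open>c\<close> in \<open>grid_points C\<close> this is the indicator of the points
  of the cube with grid point \<open>c\<close>. These sets partition the cube, so the cells span the
  sampled functions.\<close>

definition cell :: "real set \<Rightarrow> real ^ 'm \<Rightarrow> 'm::finite D_space" where
  "cell C c = step C (\<lambda>s. of_bool (s = c))"

lemma step_eq_sum:
  assumes "grid C"
  shows "step C g = (\<Sum>c\<in>grid_points C. g c *\<^sub>R cell C c)"
proof (rule D_eqI)
  fix t :: "real ^ 'a"
  show "D_eval (step C g) t = D_eval (\<Sum>c\<in>grid_points C. g c *\<^sub>R cell C c) t"
  proof (cases "t \<in> unit_cube")
    case True
    then have "D_eval (\<Sum>c\<in>grid_points C. g c *\<^sub>R cell C c) t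
        = (\<Sum>c\<in>grid_points C. if grid_point C t = c then g c else 0)"
      by (auto simp: D_eval_sum D_eval_simps cell_def D_eval_step[OF assms] intro!: sum.cong)
    also have "\<dots> = g (grid_point C t)"
      using grid_point_in[OF assms True] by (simp add: finite_grid_points[OF assms])
    finally show ?thesis using True by (simp add: D_eval_step[OF assms])
  qed (simp add: D_eval_outside)
qed

abbreviation sample :: "real set \<Rightarrow> 'm::finite D_space \<Rightarrow> 'm D_space" where
  "sample C f \<equiv> step C (D_eval f)"

lemma norm_cell_le: "grid C \<Longrightarrow> norm (cell C c) \<le> 1"
  by (rule D_norm_leI) (simp add: cell_def D_eval_step)

text \<open>By compactness of the cube, a fine grid places \<open>t\<close> and its grid point in a
  common quadrant near one of finitely many centres. \<open>R\<close> is abstract because it is used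
  twice, for values of a single function and for distances of \<open>X(t)\<close> in mean square.
  Stability under refinement allows grids to be merged.\<close>

lemma exists_fine_grid:
  fixes R :: "real ^ 'm::finite \<Rightarrow> real ^ 'm \<Rightarrow> bool"
  assumes "\<And>t S. t \<in> unit_cube \<Longrightarrow> (\<forall>i\<in>S. 0 < t $ i) \<Longrightarrow>
    \<exists>d>0. \<forall>s\<in>quadrant t S. \<forall>s'\<in>quadrant t S. dist s t < d \<longrightarrow> dist s' t < d \<longrightarrow> R s s'"
  shows "\<exists>C. grid C \<and> (\<forall>C'. grid C' \<longrightarrow> C \<subseteq> C' \<longrightarrow> (\<forall>t\<in>unit_cube. R t (grid_point C' t)))"
proof -
  have "\<exists>d>0. \<forall>S. (\<forall>i\<in>S. 0 < t $ i) \<longrightarrow>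
    (\<forall>s\<in>quadrant t S. \<forall>s'\<in>quadrant t S. dist s t < d \<longrightarrow> dist s' t < d \<longrightarrow> R s s')" if t: "t \<in> unit_cube" for t
  proof -
    have "\<forall>S. \<exists>d>0. (\<forall>i\<in>S. 0 < t $ i) \<longrightarrow>
      (\<forall>s\<in>quadrant t S. \<forall>s'\<in>quadrant t S. dist s t < d \<longrightarrow> dist s' t < d \<longrightarrow> R s s')"
      using assms[OF t] by (metis zero_less_one)
    then obtain d where d: "\<And>S. d S > 0" "\<And>S. (\<forall>i\<in>S. 0 < t $ i) \<Longrightarrow>
      (\<forall>s\<in>quadrant t S. \<forall>s'\<in>quadrant t S. dist s t < d S \<longrightarrow> dist s' t < d S \<longrightarrow> R s s')"
      by metis
    have "Min (range d) > 0" using d(1) by (subst Min_gr_iff) auto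
    moreover have "Min (range d) \<le> d S" for S by (rule Min_le) auto
    ultimately show ?thesis
      using d(2) by (intro exI[of _ "Min (range d)"]) (meson less_le_trans)
  qed
  then obtain d where d: "\<And>t. t \<in> unit_cube \<Longrightarrow> d t > 0"
    "\<And>t S s s'. t \<in> unit_cube \<Longrightarrow> \<forall>i\<in>S. 0 < t $ i \<Longrightarrow> s \<in> quadrant t S \<Longrightarrow> s' \<in> quadrant t S \<Longrightarrow>
      dist s t < d t \<Longrightarrow> dist s' t < d t \<Longrightarrow> R s s'"
    by metis
  \<comment> \<open>A deviation of at most \<open>r t\<close> in every coordinate has l1 norm, hence
    Euclidean norm, at most \<open>d t / 2\<close>.\<close>
  define r where "r t = d t / (2 * real CARD('m))" for t
  have r: "r t > 0" if "t \<in> unit_cube" for t using d(1)[OF that] by (simp add: r_def)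
  define U where "U t = ball t (r t)" for t :: "real ^ 'm"
  obtain T where T: "T \<subseteq> unit_cube" "finite T" "unit_cube \<subseteq> (\<Union>t\<in>T. U t)"
    by (rule compactE_image[OF compact_unit_cube, of unit_cube U]) (use r in \<open>auto simp: U_def\<close>)
  \<comment> \<open>The value \<open>t $ i\<close> stops the grid point from slipping below
    \<open>t $ i\<close> when \<open>s $ i\<close> is not below it; \<open>t $ i - r t\<close>, or
    \<open>0\<close> if that is negative, stops it from dropping by more than
    \<open>r t\<close>.\<close>
  define C where "C = insert 0 ({0..1} \<inter> (\<Union>t\<in>T. \<Union>i. {t $ i, t $ i - r t}))"
  have C: "grid C" using T(2) by (auto simp: grid_def C_def)
  moreover have "R s (grid_point C' s)" if C': "grid C'" "C \<subseteq> C'" and s: "s \<in> unit_cube" for C' s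
  proof -
    obtain t where t: "t \<in> T" "s \<in> U t" using T(3) s by blast
    with T have tc: "t \<in> unit_cube" by blast
    let ?p = "grid_point C' s"
    define S where "S = {i. s $ i < t $ i}"
    have s0: "0 \<le> s $ i" "s $ i \<le> 1" "0 \<le> t $ i" "t $ i \<le> 1" for i using s tc by (auto simp: unit_cube_def)
    have near: "\<bar>s $ i - t $ i\<bar> < r t" for i
      using t(2) component_le_norm_cart[of "s - t" i]
      by (auto simp: U_def dist_norm norm_minus_commute)
    have p: "?p $ i \<le> s $ i" "0 \<le> ?p $ i" "\<bar>?p $ i - t $ i\<bar> \<le> r t" "i \<notin> S \<Longrightarrow> t $ i \<le> ?p $ i" for i
    proof -
      show le: "?p $ i \<le> s $ i" and ge: "0 \<le> ?p $ i"
        using grid_floor[OF C'(1) s0(1)[of i]] by (auto simp: grid_point_def)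
      show *: "t $ i \<le> ?p $ i" if "i \<notin> S"
      proof -
        have "t $ i \<in> C" using t(1) s0 by (auto simp: C_def)
        then show ?thesis using that C' by (auto simp: S_def grid_point_def intro!: grid_floor_ge)
      qed
      have "t $ i - r t \<le> ?p $ i"
      proof (cases "t $ i - r t \<ge> 0")
        case True
        then have "t $ i - r t \<in> C" using t(1) s0(4)[of i] r[OF tc] by (auto simp: C_def)
        then show ?thesis using near[of i] C' by (auto simp: grid_point_def intro!: grid_floor_ge)
      qed (use ge in simp)
      then show "\<bar>?p $ i - t $ i\<bar> \<le> r t" using le near[of i] by simp
    qed
    have "\<forall>i\<in>S. 0 < t $ i" using s0 by (auto simp: S_def intro: le_less_trans)
    moreover have "s \<in> quadrant t S" using s0 by (auto simp: quadrant_def S_def not_less)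
    moreover have "?p \<in> quadrant t S"
      using p s0 unfolding quadrant_def S_def
      by (auto simp: not_less intro: le_less_trans intro: order_trans[OF p(1)])
    moreover have lt: "dist u t < d t" if "\<And>i. \<bar>u $ i - t $ i\<bar> \<le> r t" for u :: "real ^ 'm"
    proof -
      have "dist u t \<le> (\<Sum>i\<in>UNIV. \<bar>(u - t) $ i\<bar>)" unfolding dist_norm by (rule norm_le_l1_cart)
      also have "\<dots> \<le> of_nat CARD('m) * r t" using that by (intro sum_bounded_above) auto
      also have "\<dots> = d t / 2" by (simp add: r_def)
      finally show ?thesis using d(1)[OF tc] by simp
    qed
    ultimately show ?thesis
      using near p(3) by (intro d(2)[OF tc, of S]) (auto intro: less_imp_le)
  qed
  ultimately show ?thesis by blast
qed

text \<open>Near a point, all values in one quadrant are within \<open>e / 2\<close> of the quadrant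
  limit, hence within \<open>e\<close> of each other. Validity for all refinements lets finitely
  many functions share a grid.\<close>

lemma exists_grid_sample_close:
  fixes f :: "'m::finite D_space"
  assumes e: "e > 0"
  shows "\<exists>C. grid C \<and> (\<forall>C'. grid C' \<longrightarrow> C \<subseteq> C' \<longrightarrow> norm (f - sample C' f) \<le> e)"
proof -
  have "\<exists>C. grid C \<and> (\<forall>C'. grid C' \<longrightarrow> C \<subseteq> C' \<longrightarrow>
      (\<forall>t\<in>unit_cube. \<bar>D_eval f t - D_eval f (grid_point C' t)\<bar> \<le> e))"
  proof (rule exists_fine_grid)
    fix t :: "real ^ 'm" and S assume t: "t \<in> unit_cube" "\<forall>i\<in>S. 0 < t $ i"
    then obtain l where "(D_eval f \<longlongrightarrow> l) (inf (nhds t) (principal (quadrant t S)))"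
      using D_eval_limits[of f] unfolding has_quadrant_limits_def by blast
    then have "\<forall>\<^sub>F s in inf (nhds t) (principal (quadrant t S)). dist (D_eval f s) l < e / 2"
      by (rule tendstoD) (use e in simp)
    then obtain d where "d > 0" and d: "\<And>s. dist s t < d \<Longrightarrow> s \<in> quadrant t S \<Longrightarrow> dist (D_eval f s) l < e / 2"
      unfolding eventually_inf_principal eventually_nhds_metric by blast
    have "\<bar>D_eval f s - D_eval f s'\<bar> \<le> e" if "s \<in> quadrant t S" "s' \<in> quadrant t S" "dist s t < d" "dist s' t < d" for s s'
      using d[OF that(3,1)] d[OF that(4,2)] unfolding dist_real_def by linarith
    then show "\<exists>d>0. \<forall>s\<in>quadrant t S. \<forall>s'\<in>quadrant t S. dist s t < d \<longrightarrow> dist s' t < d \<longrightarrow>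
        \<bar>D_eval f s - D_eval f s'\<bar> \<le> e"
      using \<open>d > 0\<close> by blast
  qed
  then obtain C where C: "grid C" "\<And>C'. grid C' \<Longrightarrow> C \<subseteq> C' \<Longrightarrow>
      (\<forall>t\<in>unit_cube. \<bar>D_eval f t - D_eval f (grid_point C' t)\<bar> \<le> e)" by blast
  have "norm (f - sample C' f) \<le> e" if "grid C'" "C \<subseteq> C'" for C'
    using C(2)[OF that] by (intro D_norm_leI) (simp add: D_eval_simps D_eval_step[OF that(1)])
  with C(1) show ?thesis by blast
qed

section \<open>Grothendieck's inequality\<close>

text \<open>
  The argument is Blei's: replace the vectors by Rademacher sums and clip these at height 2. The
  clipped parts are bounded, and the fourth moment bound makes the residuals so small in mean square
  that they contribute at most half of the best constant.
\<close>

text \<open>All sums \<open>\<plusminus>p\<^sub>1 \<plusminus> \<dots> \<plusminus> p\<^sub>n\<close>, so that averages over this list are Rademacher expectations.\<close>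

fun signed_sums :: "'v::ab_group_add list \<Rightarrow> 'v list" where
  "signed_sums [] = [0]"
| "signed_sums (p # ps) = map (\<lambda>q. q + p) (signed_sums ps) @ map (\<lambda>q. q - p) (signed_sums ps)"

lemma length_signed_sums: "length (signed_sums ps) = 2 ^ length ps"
  by (induction ps) auto

lemma sum_list_signed_sums:
  fixes ps :: "'v::ab_group_add list"
  shows "(\<Sum>q\<leftarrow>signed_sums (p # ps). h q) = (\<Sum>q\<leftarrow>signed_sums ps. h (q + p) + h (q - p) :: real)"
  by (simp add: o_def sum_list_addf)

text \<open>Averaging over one sign cancels the cross terms, which is the parallelogram law.
  \<open>Q\<close> is general because the lemma serves both for squares of evaluations and for
  \<open>\<alpha> (fst q) (snd q)\<close> on pairs.\<close>

lemma signed_sums_quadratic: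
  fixes Q :: "'v::ab_group_add \<Rightarrow> real"
  assumes par: "\<And>p q. Q (q + p) + Q (q - p) = 2 * Q q + 2 * Q p" and Q0: "Q 0 = 0"
  shows "(\<Sum>q\<leftarrow>signed_sums ps. Q q) = 2 ^ length ps * (\<Sum>p\<leftarrow>ps. Q p)"
proof (induction ps)
  case Nil
  then show ?case by (simp add: Q0)
next
  case (Cons p ps)
  have "(\<Sum>q\<leftarrow>signed_sums (p # ps). Q q) = (\<Sum>q\<leftarrow>signed_sums ps. 2 * Q q + 2 * Q p)"
    by (simp only: sum_list_signed_sums par)
  also have "\<dots> = 2 * (\<Sum>q\<leftarrow>signed_sums ps. Q q) + 2 ^ length ps * (2 * Q p)"
    by (simp add: sum_list_addf sum_list_const_mult sum_list_triv length_signed_sums)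
  finally show ?case using Cons by (simp add: algebra_simps)
qed

text \<open>Khinchin's inequality for exponent 4: in (a + b)^4 + (a - b)^4 only the even powers
  survive.\<close>

lemma signed_sums_fourth_moment:
  fixes l :: "'v::real_vector \<Rightarrow> real"
  assumes l: "linear l"
  shows "(\<Sum>q\<leftarrow>signed_sums ps. l q ^ 4) \<le> 3 * 2 ^ length ps * (\<Sum>p\<leftarrow>ps. (l p)\<^sup>2)\<^sup>2"
proof (induction ps)
  case Nil
  then show ?case by (simp add: linear_0[OF l])
next
  case (Cons p ps)
  let ?A = "\<Sum>p\<leftarrow>ps. (l p)\<^sup>2" and ?N = "2 ^ length ps :: real"
  have sq: "(\<Sum>q\<leftarrow>signed_sums ps. (l q)\<^sup>2) = ?N * ?A"
    by (rule signed_sums_quadratic)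
      (simp_all add: linear_add[OF l] linear_diff[OF l] linear_0[OF l] power2_eq_square algebra_simps)
  have "(\<Sum>q\<leftarrow>signed_sums (p # ps). l q ^ 4)
      = (\<Sum>q\<leftarrow>signed_sums ps. 2 * l q ^ 4 + (12 * (l p)\<^sup>2 * (l q)\<^sup>2 + 2 * l p ^ 4))"
    by (simp only: sum_list_signed_sums linear_add[OF l] linear_diff[OF l])
      (simp add: power2_eq_square power4_eq_xxxx algebra_simps)
  also have "\<dots> = 2 * (\<Sum>q\<leftarrow>signed_sums ps. l q ^ 4) + (12 * (l p)\<^sup>2 * (?N * ?A) + ?N * (2 * l p ^ 4))"
    by (simp add: sum_list_addf sum_list_const_mult sum_list_triv length_signed_sums sq)
  \<comment> \<open>Raising the coefficient of \<open>l p ^ 4\<close> from 2 to 6 completes the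
    square of \<open>?A\<close> plus the square of \<open>l p\<close>.\<close>
  also have "\<dots> \<le> 2 * (3 * ?N * ?A\<^sup>2) + (12 * (l p)\<^sup>2 * (?N * ?A) + ?N * (6 * l p ^ 4))"
    using Cons by (intro add_mono mult_left_mono) auto
  also have "\<dots> = 3 * 2 ^ length (p # ps) * (\<Sum>p\<leftarrow>p # ps. (l p)\<^sup>2)\<^sup>2"
    by (simp add: power2_eq_square power4_eq_xxxx algebra_simps)
  finally show ?case .
qed

text \<open>The residual bound is the square of \<bar>x\<bar> - 2 \<le> x^2 / 8, which says
  (\<bar>x\<bar> - 4)^2 \<ge> 0. It lets a fourth moment control the part cut off.\<close>

lemma clip_bounds: "\<bar>clip 2 x\<bar> \<le> 2" "(clip 2 x)\<^sup>2 \<le> x\<^sup>2" "(x - clip 2 x)\<^sup>2 \<le> x ^ 4 / 64"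
proof -
  show "\<bar>clip 2 x\<bar> \<le> 2" by (auto simp: clip_def)
  show "(clip 2 x)\<^sup>2 \<le> x\<^sup>2" by (rule abs_le_square_iff[THEN iffD1]) (auto simp: clip_def)
  have "\<bar>x\<bar> - 2 \<le> \<bar>x\<bar>\<^sup>2 / 8"
    using zero_le_power2[of "\<bar>x\<bar> - 4"] by (simp add: power2_eq_square algebra_simps)
  moreover have "\<bar>x - clip 2 x\<bar> = max 0 (\<bar>x\<bar> - 2)" by (auto simp: clip_def)
  ultimately have "\<bar>x - clip 2 x\<bar> \<le> \<bar>x\<^sup>2 / 8\<bar>" by (simp add: max_def)
  then have "(x - clip 2 x)\<^sup>2 \<le> (x\<^sup>2 / 8)\<^sup>2" by (rule abs_le_square_iff[THEN iffD1])
  then show "(x - clip 2 x)\<^sup>2 \<le> x ^ 4 / 64" by (simp add: power2_eq_square power4_eq_xxxx)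
qed

section \<open>Pairings under pointwise square bounds\<close>

definition pairing_sum :: "('a \<Rightarrow> 'a \<Rightarrow> real) \<Rightarrow> ('a \<times> 'a) list \<Rightarrow> real" where
  "pairing_sum \<alpha> ps = (\<Sum>p\<leftarrow>ps. \<alpha> (fst p) (snd p))"

text \<open>For each \<open>t\<close> the values of the first and of the second entries form two
  finite l2 vectors with squared norms at most \<open>a\<close> and \<open>b\<close>. These are the
  Hilbert space vectors of Grothendieck's inequality, written in coordinates.\<close>

definition square_bounded :: "real \<Rightarrow> real \<Rightarrow> ('m::finite D_space \<times> 'm D_space) list \<Rightarrow> bool" where
  "square_bounded a b ps \<longleftrightarrow> (\<forall>t\<in>unit_cube.
    (\<Sum>p\<leftarrow>ps. (D_eval (fst p) t)\<^sup>2) \<le> a \<and> (\<Sum>p\<leftarrow>ps. (D_eval (snd p) t)\<^sup>2) \<le> b)"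

text \<open>\<open>B\<close> is any upper bound of the norm of \<open>\<alpha>\<close>, positive
  because later arguments divide by it.\<close>

locale bounded_bilinear_form =
  fixes \<alpha> :: "'m::finite D_space \<Rightarrow> 'm D_space \<Rightarrow> real" and B :: real
  assumes bilinear: "bilinear \<alpha>" and bound: "\<bar>\<alpha> f g\<bar> \<le> B * norm f * norm g" and B_pos: "B > 0"
begin

lemma add: "\<alpha> (f + f') g = \<alpha> f g + \<alpha> f' g" "\<alpha> f (g + g') = \<alpha> f g + \<alpha> f g'"
  and diff: "\<alpha> (f - f') g = \<alpha> f g - \<alpha> f' g" "\<alpha> f (g - g') = \<alpha> f g - \<alpha> f g'"
  and scale: "\<alpha> (c *\<^sub>R f) g = c * \<alpha> f g" "\<alpha> f (c *\<^sub>R g) = c * \<alpha> f g"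
  and zero: "\<alpha> 0 g = 0" "\<alpha> f 0 = 0"
  by (simp_all add: bilinear_ladd[OF bilinear] bilinear_radd[OF bilinear] bilinear_lsub[OF bilinear]
    bilinear_rsub[OF bilinear] bilinear_lmul[OF bilinear] bilinear_rmul[OF bilinear]
    bilinear_lzero[OF bilinear] bilinear_rzero[OF bilinear])

text \<open>Homogeneity in each entry. The constant \<open>K\<close> is relative to a subspace
  \<open>T\<close> because the self-improvement takes place among functions constant on grid
  cells.\<close>

lemma pairing_sum_rescale:
  assumes K: "\<And>ps. set ps \<subseteq> T \<times> T \<Longrightarrow> square_bounded 1 1 ps \<Longrightarrow> \<bar>pairing_sum \<alpha> ps\<bar> \<le> K"
    and T: "subspace T" and ps: "set ps \<subseteq> T \<times> T" "square_bounded (a\<^sup>2) (b\<^sup>2) ps" and ab: "a > 0" "b > 0"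
  shows "\<bar>pairing_sum \<alpha> ps\<bar> \<le> K * (a * b)"
proof -
  define qs where "qs = map (\<lambda>p. (inverse a *\<^sub>R fst p, inverse b *\<^sub>R snd p)) ps"
  have "set qs \<subseteq> T \<times> T" using ps(1) subspace_scale[OF T] by (auto simp: qs_def)
  moreover have "square_bounded 1 1 qs"
    unfolding square_bounded_def
  proof
    fix t :: "real ^ 'm" assume "t \<in> unit_cube"
    then have "(\<Sum>p\<leftarrow>ps. (D_eval (fst p) t)\<^sup>2) \<le> a\<^sup>2" "(\<Sum>p\<leftarrow>ps. (D_eval (snd p) t)\<^sup>2) \<le> b\<^sup>2"
      using ps(2) by (auto simp: square_bounded_def)
    moreover have "(\<Sum>p\<leftarrow>qs. (D_eval (fst p) t)\<^sup>2) = (\<Sum>p\<leftarrow>ps. (D_eval (fst p) t)\<^sup>2) / a\<^sup>2"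
      "(\<Sum>p\<leftarrow>qs. (D_eval (snd p) t)\<^sup>2) = (\<Sum>p\<leftarrow>ps. (D_eval (snd p) t)\<^sup>2) / b\<^sup>2"
      unfolding qs_def by (induction ps) (simp_all add: D_eval_simps power_mult_distrib power_inverse divide_inverse algebra_simps)
    ultimately show "(\<Sum>p\<leftarrow>qs. (D_eval (fst p) t)\<^sup>2) \<le> 1 \<and> (\<Sum>p\<leftarrow>qs. (D_eval (snd p) t)\<^sup>2) \<le> 1"
      using ab by simp
  qed
  ultimately have "\<bar>pairing_sum \<alpha> qs\<bar> \<le> K" by (rule K)
  moreover have "pairing_sum \<alpha> qs = inverse a * inverse b * pairing_sum \<alpha> ps"
    by (simp add: qs_def pairing_sum_def o_def scale sum_list_const_mult mult.assoc)
  ultimately show ?thesis using ab by (simp add: abs_mult field_simps)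
qed

lemma pairing_sum_le_length:
  fixes c :: real
  assumes "\<And>p. p \<in> set ps \<Longrightarrow> \<bar>\<alpha> (fst p) (snd p)\<bar> \<le> c"
  shows "\<bar>pairing_sum \<alpha> ps\<bar> \<le> length ps * c"
  using assms
proof (induction ps)
  case (Cons p ps)
  then have "\<bar>pairing_sum \<alpha> ps\<bar> \<le> length ps * c" "\<bar>\<alpha> (fst p) (snd p)\<bar> \<le> c" by auto
  then show ?case by (simp add: pairing_sum_def algebra_simps)
qed (simp add: pairing_sum_def)

text \<open>Any admissible constant \<open>K\<close> improves itself. Pairs of Rademacher sums
  \<open>(f, g)\<close> are split into (clip f, clip g), (f - clip f, g) and (clip f, g - clip g),
  whose forms add up exactly. The first part is bounded through the norm by \<open>4 * B\<close>; in
  each of the others one entry has relative size 1/4, so \<open>K\<close> itself bounds it by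
  \<open>K / 4\<close>.\<close>

lemma grothendieck_improve:
  assumes K: "\<And>ps. set ps \<subseteq> T \<times> T \<Longrightarrow> square_bounded 1 1 ps \<Longrightarrow> \<bar>pairing_sum \<alpha> ps\<bar> \<le> K"
    and T: "subspace T" "\<And>f. f \<in> T \<Longrightarrow> D_clip f \<in> T"
    and ps: "set ps \<subseteq> T \<times> T" "square_bounded 1 1 ps"
  shows "\<bar>pairing_sum \<alpha> ps\<bar> \<le> 4 * B + K / 2"
proof -
  define N :: real where "N = 2 ^ length ps"
  have N: "N > 0" by (simp add: N_def)
  define L where "L = signed_sums ps"
  have LT: "set L \<subseteq> T \<times> T"
    using ps(1) unfolding L_def
    by (induction ps) (force simp: subspace_0[OF T(1)] zero_prod_def intro: subspace_add[OF T(1)] subspace_diff[OF T(1)])+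
  have len: "real (length L) = N" by (simp add: L_def N_def length_signed_sums)
  have sq: "(\<Sum>q\<leftarrow>L. (D_eval (fst q) t)\<^sup>2) \<le> N" "(\<Sum>q\<leftarrow>L. (D_eval (snd q) t)\<^sup>2) \<le> N"
    "(\<Sum>q\<leftarrow>L. (D_eval (fst q) t) ^ 4) \<le> 3 * N" "(\<Sum>q\<leftarrow>L. (D_eval (snd q) t) ^ 4) \<le> 3 * N"
    if "t \<in> unit_cube" for t
  proof -
    have lin: "linear (\<lambda>q :: 'm D_space \<times> 'm D_space. D_eval (fst q) t)" "linear (\<lambda>q :: 'm D_space \<times> 'm D_space. D_eval (snd q) t)"
      by (simp_all add: linear_iff D_eval_simps)
    let ?a = "\<Sum>p\<leftarrow>ps. (D_eval (fst p) t)\<^sup>2" and ?b = "\<Sum>p\<leftarrow>ps. (D_eval (snd p) t)\<^sup>2"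
    have le: "?a \<le> 1" "?b \<le> 1" using ps(2) that by (auto simp: square_bounded_def)
    have ge: "0 \<le> ?a" "0 \<le> ?b" by (auto intro!: sum_list_nonneg)
    have "(\<Sum>q\<leftarrow>L. (D_eval (fst q) t)\<^sup>2) = N * ?a" "(\<Sum>q\<leftarrow>L. (D_eval (snd q) t)\<^sup>2) = N * ?b"
      unfolding L_def N_def
      by (rule signed_sums_quadratic; simp add: D_eval_simps power2_eq_square algebra_simps)+
    with le N show "(\<Sum>q\<leftarrow>L. (D_eval (fst q) t)\<^sup>2) \<le> N" "(\<Sum>q\<leftarrow>L. (D_eval (snd q) t)\<^sup>2) \<le> N"
      by auto
    have "?a\<^sup>2 \<le> 1" "?b\<^sup>2 \<le> 1" using le ge by (auto intro: power_le_one)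
    then have "3 * N * ?a\<^sup>2 \<le> 3 * N" "3 * N * ?b\<^sup>2 \<le> 3 * N" using N by auto
    then show "(\<Sum>q\<leftarrow>L. (D_eval (fst q) t) ^ 4) \<le> 3 * N" "(\<Sum>q\<leftarrow>L. (D_eval (snd q) t) ^ 4) \<le> 3 * N"
      using signed_sums_fourth_moment[OF lin(1), of ps] signed_sums_fourth_moment[OF lin(2), of ps]
      unfolding L_def N_def by linarith+
  qed
  \<comment> \<open>Fourth moments give \<open>3 * N / 64\<close>; rounding up to
    \<open>N / 16\<close> makes its root a quarter of \<open>sqrt N\<close>.\<close>
  have resid: "(\<Sum>q\<leftarrow>L. (D_eval (fst q - D_clip (fst q)) t)\<^sup>2) \<le> N / 16"
    "(\<Sum>q\<leftarrow>L. (D_eval (snd q - D_clip (snd q)) t)\<^sup>2) \<le> N / 16"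
    "(\<Sum>q\<leftarrow>L. (D_eval (D_clip (fst q)) t)\<^sup>2) \<le> N" if t: "t \<in> unit_cube" for t
  proof -
    have "(\<Sum>q\<leftarrow>L. (D_eval (fst q - D_clip (fst q)) t)\<^sup>2) \<le> (\<Sum>q\<leftarrow>L. (1/64) * D_eval (fst q) t ^ 4)"
      "(\<Sum>q\<leftarrow>L. (D_eval (snd q - D_clip (snd q)) t)\<^sup>2) \<le> (\<Sum>q\<leftarrow>L. (1/64) * D_eval (snd q) t ^ 4)"
      "(\<Sum>q\<leftarrow>L. (D_eval (D_clip (fst q)) t)\<^sup>2) \<le> (\<Sum>q\<leftarrow>L. (D_eval (fst q) t)\<^sup>2)"
      using clip_bounds(2,3) by (auto intro!: sum_list_mono simp: D_eval_simps)
    with sq[OF t] N show "(\<Sum>q\<leftarrow>L. (D_eval (fst q - D_clip (fst q)) t)\<^sup>2) \<le> N / 16"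
      "(\<Sum>q\<leftarrow>L. (D_eval (snd q - D_clip (snd q)) t)\<^sup>2) \<le> N / 16"
      "(\<Sum>q\<leftarrow>L. (D_eval (D_clip (fst q)) t)\<^sup>2) \<le> N"
      unfolding sum_list_const_mult by linarith+
  qed
  define L1 where "L1 = map (\<lambda>q. (D_clip (fst q), D_clip (snd q))) L"
  define L2 where "L2 = map (\<lambda>q. (fst q - D_clip (fst q), snd q)) L"
  define L3 where "L3 = map (\<lambda>q. (D_clip (fst q), snd q - D_clip (snd q))) L"
  have "N * pairing_sum \<alpha> ps = pairing_sum \<alpha> L"
    unfolding L_def N_def pairing_sum_def
    by (rule signed_sums_quadratic[symmetric]) (simp_all add: add diff zero)
  also have "\<dots> = pairing_sum \<alpha> L1 + pairing_sum \<alpha> L2 + pairing_sum \<alpha> L3"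
    by (simp add: L1_def L2_def L3_def pairing_sum_def o_def add diff flip: sum_list_addf)
  finally have split: "N * pairing_sum \<alpha> ps = pairing_sum \<alpha> L1 + pairing_sum \<alpha> L2 + pairing_sum \<alpha> L3" .
  have "\<bar>pairing_sum \<alpha> L1\<bar> \<le> length L1 * (B * 4)"
  proof (rule pairing_sum_le_length)
    fix p assume "p \<in> set L1"
    then obtain f g where p: "p = (D_clip f, D_clip g)" by (auto simp: L1_def)
    have "norm (D_clip h) \<le> 2" for h :: "'m D_space"
      by (rule D_norm_leI) (simp add: D_eval_simps clip_bounds)
    then have "norm (D_clip f) * norm (D_clip g) \<le> 2 * 2" by (intro mult_mono) auto
    then have "B * (norm (D_clip f) * norm (D_clip g)) \<le> B * 4" using B_pos by (intro mult_left_mono) auto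
    then show "\<bar>\<alpha> (fst p) (snd p)\<bar> \<le> B * 4"
      using bound[of "D_clip f" "D_clip g"] by (simp add: p mult.assoc)
  qed
  then have 1: "\<bar>pairing_sum \<alpha> L1\<bar> \<le> N * (4 * B)" by (simp add: L1_def len mult.commute)
  have r: "(sqrt N)\<^sup>2 = N" "(sqrt N / 4)\<^sup>2 = N / 16" using N by (simp_all add: power_divide)
  have "\<bar>pairing_sum \<alpha> L2\<bar> \<le> K * (sqrt N / 4 * sqrt N)"
  proof (rule pairing_sum_rescale[OF K T(1)])
    show "set L2 \<subseteq> T \<times> T" using LT T by (auto simp: L2_def intro!: subspace_diff)
    show "square_bounded ((sqrt N / 4)\<^sup>2) ((sqrt N)\<^sup>2) L2"
      unfolding r square_bounded_def
    proof (intro ballI conjI)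
      fix t :: "real ^ 'm" assume t: "t \<in> unit_cube"
      show "(\<Sum>p\<leftarrow>L2. (D_eval (fst p) t)\<^sup>2) \<le> N / 16" "(\<Sum>p\<leftarrow>L2. (D_eval (snd p) t)\<^sup>2) \<le> N"
        using resid(1)[OF t] sq(2)[OF t] by (simp_all add: L2_def o_def)
    qed
  qed (use N in auto)
  then have 2: "\<bar>pairing_sum \<alpha> L2\<bar> \<le> N * (K / 4)" using r(1) by (simp add: power2_eq_square mult.commute)
  have "\<bar>pairing_sum \<alpha> L3\<bar> \<le> K * (sqrt N * (sqrt N / 4))"
  proof (rule pairing_sum_rescale[OF K T(1)])
    show "set L3 \<subseteq> T \<times> T" using LT T by (auto simp: L3_def intro!: subspace_diff)
    show "square_bounded ((sqrt N)\<^sup>2) ((sqrt N / 4)\<^sup>2) L3"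
      unfolding r square_bounded_def
    proof (intro ballI conjI)
      fix t :: "real ^ 'm" assume t: "t \<in> unit_cube"
      show "(\<Sum>p\<leftarrow>L3. (D_eval (fst p) t)\<^sup>2) \<le> N" "(\<Sum>p\<leftarrow>L3. (D_eval (snd p) t)\<^sup>2) \<le> N / 16"
        using resid(2,3)[OF t] by (simp_all add: L3_def o_def)
    qed
  qed (use N in auto)
  then have 3: "\<bar>pairing_sum \<alpha> L3\<bar> \<le> N * (K / 4)" using r(1) by (simp add: power2_eq_square mult.commute)
  have "N * \<bar>pairing_sum \<alpha> ps\<bar> = \<bar>N * pairing_sum \<alpha> ps\<bar>" using N by (simp add: abs_mult)
  also have "\<dots> \<le> N * (4 * B) + N * (K / 4) + N * (K / 4)" using 1 2 3 unfolding split by linarith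
  also have "\<dots> = N * (4 * B + K / 2)" by (simp add: algebra_simps)
  finally show ?thesis using N by simp
qed

text \<open>Finiteness of \<open>K0\<close> makes the supremum \<open>K\<close> a real number, so
  that \<open>K \<le> 4 * B + K / 2\<close> can be solved; the size of \<open>K0\<close> then drops
  out.\<close>

lemma grothendieck_clip_closed:
  assumes K0: "\<And>ps. set ps \<subseteq> T \<times> T \<Longrightarrow> square_bounded 1 1 ps \<Longrightarrow> \<bar>pairing_sum \<alpha> ps\<bar> \<le> K0"
    and T: "subspace T" "\<And>f. f \<in> T \<Longrightarrow> D_clip f \<in> T"
    and ps: "set ps \<subseteq> T \<times> T" "square_bounded 1 1 ps"
  shows "\<bar>pairing_sum \<alpha> ps\<bar> \<le> 8 * B"
proof -
  define V where "V = {ps. set ps \<subseteq> T \<times> T \<and> square_bounded 1 1 ps}"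
  define K where "K = (SUP ps\<in>V. \<bar>pairing_sum \<alpha> ps\<bar>)"
  have K: "\<bar>pairing_sum \<alpha> ps\<bar> \<le> K" if "set ps \<subseteq> T \<times> T" "square_bounded 1 1 ps" for ps
    unfolding K_def using that K0 by (intro cSUP_upper bdd_aboveI2[of _ _ K0]) (auto simp: V_def)
  have "K \<le> 4 * B + K / 2"
    unfolding K_def using ps by (intro cSUP_least grothendieck_improve[OF K[unfolded K_def] T]) (auto simp: V_def)
  then have "K \<le> 8 * B" by simp
  with K[OF ps] show ?thesis by simp
qed


text \<open>Only finitely many values of \<open>f\<close> and \<open>g\<close> enter, with fixed
  coefficients. Hence sampled forms of random elements are measurable, and their expectations come
  from finite tensors.\<close>

lemma form_sample:
  assumes C: "grid C"
  shows "\<alpha> (sample C f) (sample C g)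
    = (\<Sum>c\<in>grid_points C. \<Sum>d\<in>grid_points C. D_eval f c * D_eval g d * \<alpha> (cell C c) (cell C d))"
proof -
  let ?G = "grid_points C :: (real ^ 'm) set"
  have "\<alpha> (sample C f) (sample C g) = \<alpha> (\<Sum>c\<in>?G. D_eval f c *\<^sub>R cell C c) (\<Sum>d\<in>?G. D_eval g d *\<^sub>R cell C d)"
    by (simp flip: step_eq_sum[OF C])
  also have "\<dots> = (\<Sum>c\<in>?G. \<Sum>d\<in>?G. \<alpha> (D_eval f c *\<^sub>R cell C c) (D_eval g d *\<^sub>R cell C d))"
    using bilinear by (simp add: bilinear_sum sum.cartesian_product)
  finally show ?thesis by (simp add: scale mult_ac)
qed

text \<open>Functions constant on the cells of \<open>C\<close> form a subspace closed under
  clipping on which a crude a priori bound is available: after expansion in cells the coefficients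
  are at most 1 by the inequality 2 x y \<le> x^2 + y^2, and the form on a pair of cells is at most
  \<open>B\<close>.\<close>

lemma grothendieck_sampled:
  assumes C: "grid C" and ps: "\<And>p. p \<in> set ps \<Longrightarrow> sample C (fst p) = fst p \<and> sample C (snd p) = snd p"
    and "square_bounded 1 1 ps"
  shows "\<bar>pairing_sum \<alpha> ps\<bar> \<le> 8 * B"
proof -
  define T where "T = {f :: 'm D_space. sample C f = f}"
  have ev: "D_eval f t = D_eval f (grid_point C t)" if "f \<in> T" "t \<in> unit_cube" for f t
    using that D_eval_step[OF C, of "D_eval f" t] by (simp add: T_def)
  have TI: "f \<in> T" if "\<And>t. t \<in> unit_cube \<Longrightarrow> D_eval f t = D_eval f (grid_point C t)" for f
    unfolding T_def using that by (auto intro!: D_eqI simp: D_eval_step[OF C] D_eval_outside)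
  have sub: "subspace T"
    by (rule subspaceI) (use ev in \<open>auto intro!: TI simp: D_eval_simps\<close>)
  let ?G = "grid_points C :: (real ^ 'm) set"
  have K0: "\<bar>pairing_sum \<alpha> qs\<bar> \<le> (\<Sum>c\<in>?G. \<Sum>d\<in>?G. B)" if qs: "set qs \<subseteq> T \<times> T" "square_bounded 1 1 qs" for qs
  proof -
    have exp: "\<alpha> f g = (\<Sum>c\<in>?G. \<Sum>d\<in>?G. D_eval f c * D_eval g d * \<alpha> (cell C c) (cell C d))"
      if "f \<in> T" "g \<in> T" for f g
      using that form_sample[OF C, of f g] by (simp add: T_def)
    have "pairing_sum \<alpha> qs = (\<Sum>p\<leftarrow>qs. \<Sum>c\<in>?G. \<Sum>d\<in>?G. D_eval (fst p) c * D_eval (snd p) d * \<alpha> (cell C c) (cell C d))"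
      unfolding pairing_sum_def using qs(1) by (intro arg_cong[of _ _ sum_list] map_cong exp) auto
    also have "\<dots> = (\<Sum>c\<in>?G. \<Sum>d\<in>?G. (\<Sum>p\<leftarrow>qs. D_eval (fst p) c * D_eval (snd p) d) * \<alpha> (cell C c) (cell C d))"
      by (induction qs) (simp_all add: sum.distrib distrib_right)
    finally have eq: "pairing_sum \<alpha> qs = (\<Sum>c\<in>?G. \<Sum>d\<in>?G. (\<Sum>p\<leftarrow>qs. D_eval (fst p) c * D_eval (snd p) d) * \<alpha> (cell C c) (cell C d))" .
    have "\<bar>pairing_sum \<alpha> qs\<bar> \<le> (\<Sum>c\<in>?G. \<bar>\<Sum>d\<in>?G. (\<Sum>p\<leftarrow>qs. D_eval (fst p) c * D_eval (snd p) d) * \<alpha> (cell C c) (cell C d)\<bar>)"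
      unfolding eq by (rule sum_abs)
    also have "\<dots> \<le> (\<Sum>c\<in>?G. \<Sum>d\<in>?G. \<bar>(\<Sum>p\<leftarrow>qs. D_eval (fst p) c * D_eval (snd p) d) * \<alpha> (cell C c) (cell C d)\<bar>)"
      by (intro sum_mono sum_abs)
    also have "\<dots> \<le> (\<Sum>c\<in>?G. \<Sum>d\<in>?G. B)"
    proof (intro sum_mono)
      fix c d :: "real ^ 'm" assume "c \<in> ?G" "d \<in> ?G"
      then have cd: "c \<in> unit_cube" "d \<in> unit_cube"
        by (auto intro: subsetD[OF grid_points_subset[OF C]])
      have am: "2 * \<bar>\<Sum>p\<leftarrow>qs. D_eval (fst p) c * D_eval (snd p) d\<bar>
          \<le> (\<Sum>p\<leftarrow>qs. (D_eval (fst p) c)\<^sup>2) + (\<Sum>p\<leftarrow>qs. (D_eval (snd p) d)\<^sup>2)"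
      proof (induction qs)
        case (Cons p qs)
        have "2 * \<bar>D_eval (fst p) c * D_eval (snd p) d\<bar> \<le> (D_eval (fst p) c)\<^sup>2 + (D_eval (snd p) d)\<^sup>2"
          using sum_squares_bound[of "\<bar>D_eval (fst p) c\<bar>" "\<bar>D_eval (snd p) d\<bar>"] by (simp add: abs_mult)
        with Cons show ?case
          using abs_triangle_ineq[of "D_eval (fst p) c * D_eval (snd p) d" "\<Sum>p\<leftarrow>qs. D_eval (fst p) c * D_eval (snd p) d"]
          by simp
      qed simp
      have "(\<Sum>p\<leftarrow>qs. (D_eval (fst p) c)\<^sup>2) \<le> 1" "(\<Sum>p\<leftarrow>qs. (D_eval (snd p) d)\<^sup>2) \<le> 1"
        using qs(2) cd by (auto simp: square_bounded_def)
      with am have 1: "\<bar>\<Sum>p\<leftarrow>qs. D_eval (fst p) c * D_eval (snd p) d\<bar> \<le> 1" by linarith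
      have "B * norm (cell C c) * norm (cell C d) \<le> B * 1 * 1"
        using B_pos norm_cell_le[OF C, of c] norm_cell_le[OF C, of d] by (intro mult_mono) auto
      then have "\<bar>\<alpha> (cell C c) (cell C d)\<bar> \<le> B" using bound[of "cell C c" "cell C d"] by simp
      with 1 show "\<bar>(\<Sum>p\<leftarrow>qs. D_eval (fst p) c * D_eval (snd p) d) * \<alpha> (cell C c) (cell C d)\<bar> \<le> B"
        unfolding abs_mult using mult_mono[OF 1 \<open>\<bar>\<alpha> (cell C c) (cell C d)\<bar> \<le> B\<close>] by simp
    qed
    finally show ?thesis .
  qed
  show ?thesis
  proof (rule grothendieck_clip_closed[OF K0 sub])
    show "D_clip f \<in> T" if "f \<in> T" for f
      by (rule TI) (use ev[OF that] in \<open>simp add: D_eval_simps\<close>)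
    show "set ps \<subseteq> T \<times> T" using ps by (auto simp: T_def)
  qed (use assms(3) in auto)
qed

text \<open>Values of a sample are values of the function, so sampling preserves the square bound,
  while a fine common grid hardly moves the pairing. As \<open>8 * B\<close> is independent of the
  grid, it survives the limit.\<close>

theorem grothendieck:
  assumes "square_bounded 1 1 ps"
  shows "\<bar>pairing_sum \<alpha> ps\<bar> \<le> 8 * B"
proof -
  \<comment> \<open>Replacing both entries of a pair by functions at distance at most
    \<open>e\<close> changes the form by at most \<open>B * e * (norm f + norm g)\<close>;
    \<open>e * W\<close> is the total.\<close>
  define W where "W = B * (\<Sum>p\<leftarrow>ps. norm (fst p) + norm (snd p))"
  have W: "W \<ge> 0" using B_pos unfolding W_def by (intro mult_nonneg_nonneg sum_list_nonneg) auto
  have main: "\<bar>pairing_sum \<alpha> ps\<bar> \<le> 8 * B + e * W" if e: "e > 0" for e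
  proof -
    have "\<exists>C. grid C \<and> (\<forall>f\<in>F. norm (f - sample C f) \<le> e)" if "finite F" for F :: "'m D_space set"
    proof -
      have "\<exists>C. grid C \<and> (\<forall>C'. grid C' \<longrightarrow> C \<subseteq> C' \<longrightarrow> (\<forall>f\<in>F. norm (f - sample C' f) \<le> e))"
        using that
      proof (induction F)
        case empty
        have "grid {0}" by (simp add: grid_def)
        then show ?case by blast
      next
        case (insert f F)
        then obtain C where C: "grid C" "\<forall>C'. grid C' \<longrightarrow> C \<subseteq> C' \<longrightarrow> (\<forall>f\<in>F. norm (f - sample C' f) \<le> e)" by blast
        obtain C2 where C2: "grid C2" "\<forall>C'. grid C' \<longrightarrow> C2 \<subseteq> C' \<longrightarrow> norm (f - sample C' f) \<le> e"
          using exists_grid_sample_close[OF e] by blast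
        show ?case using C C2 grid_union[OF C(1) C2(1)] by (intro exI[of _ "C \<union> C2"]) auto
      qed
      then show ?thesis by blast
    qed
    from this[of "fst ` set ps \<union> snd ` set ps"]
    obtain C where C: "grid C" and close: "\<And>p. p \<in> set ps \<Longrightarrow> norm (fst p - sample C (fst p)) \<le> e"
      "\<And>p. p \<in> set ps \<Longrightarrow> norm (snd p - sample C (snd p)) \<le> e"
      by auto
    define qs where "qs = map (\<lambda>p. (sample C (fst p), sample C (snd p))) ps"
    have norm_sample: "norm (sample C f) \<le> norm f" for f :: "'m D_space"
      by (rule D_norm_leI) (simp add: D_eval_step[OF C] D_eval_le_norm)
    have idem: "sample C (sample C f) = sample C f" for f :: "'m D_space"
      by (rule D_eqI) (simp add: D_eval_step[OF C] grid_point_cube[OF C] grid_point_self[OF C grid_point_in[OF C]])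
    have "\<bar>pairing_sum \<alpha> qs\<bar> \<le> 8 * B"
    proof (rule grothendieck_sampled[OF C])
      show "square_bounded 1 1 qs"
        using assms
        by (auto simp: square_bounded_def qs_def o_def D_eval_step[OF C] grid_point_cube[OF C])
    qed (auto simp: qs_def idem)
    moreover have "\<bar>pairing_sum \<alpha> ps - pairing_sum \<alpha> qs\<bar> \<le> e * W"
      unfolding qs_def W_def using close
    proof (induction ps)
      case Nil
      then show ?case by (simp add: pairing_sum_def)
    next
      case (Cons p ps)
      let ?f = "fst p" and ?g = "snd p"
      have "\<alpha> ?f ?g - \<alpha> (sample C ?f) (sample C ?g) = \<alpha> (?f - sample C ?f) ?g + \<alpha> (sample C ?f) (?g - sample C ?g)"
        by (simp add: diff)
      moreover have "\<bar>\<alpha> (?f - sample C ?f) ?g\<bar> \<le> B * e * norm ?g"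
        using bound[of "?f - sample C ?f" ?g] Cons.prems(1)[of p] B_pos
        by (meson list.set_intros(1) mult_left_mono mult_right_mono less_imp_le norm_ge_zero order_trans)
      moreover have "\<bar>\<alpha> (sample C ?f) (?g - sample C ?g)\<bar> \<le> B * norm ?f * e"
      proof -
        have "\<bar>\<alpha> (sample C ?f) (?g - sample C ?g)\<bar> \<le> B * norm (sample C ?f) * norm (?g - sample C ?g)" by (rule bound)
        also have "\<dots> \<le> B * norm ?f * e"
          using B_pos Cons.prems(2)[of p] norm_sample[of ?f] by (intro mult_mono mult_left_mono) auto
        finally show ?thesis .
      qed
      ultimately have "\<bar>\<alpha> ?f ?g - \<alpha> (sample C ?f) (sample C ?g)\<bar> \<le> B * e * norm ?g + B * norm ?f * e" by linarith
      with Cons show ?case by (simp add: pairing_sum_def o_def algebra_simps)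
    qed
    ultimately show ?thesis by linarith
  qed
  show ?thesis
  proof (rule field_le_epsilon)
    fix d :: real assume d: "d > 0"
    then have "\<bar>pairing_sum \<alpha> ps\<bar> \<le> 8 * B + d / (W + 1) * W" using W by (intro main) auto
    also have "d / (W + 1) * W \<le> d" using W d by (simp add: field_simps)
    finally show "\<bar>pairing_sum \<alpha> ps\<bar> \<le> 8 * B + d" by simp
  qed
qed

end

section \<open>Dominating states\<close>

text \<open>Applied to \<open>f\<close> and to \<open>- f\<close>, the condition keeps
  \<open>\<mu> f\<close> between the infimum and the supremum of \<open>f\<close> on the cube. So
  \<open>\<mu>\<close> is positive with value 1 on the constant 1: integration against a finitely
  additive probability.\<close>

definition state :: "('m::finite D_space \<Rightarrow> real) \<Rightarrow> bool" where
  "state \<mu> \<longleftrightarrow> linear \<mu> \<and> (\<forall>f c. (\<forall>t\<in>unit_cube. D_eval f t \<le> c) \<longrightarrow> \<mu> f \<le> c)"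

abbreviation mean_square :: "('m::finite D_space \<Rightarrow> real) \<Rightarrow> 'm D_space \<Rightarrow> real" where
  "mean_square \<mu> f \<equiv> \<mu> (D_mult f f)"

lemma D_mult_bilinear: "bilinear D_mult"
  by (auto simp: bilinear_def linear_iff D_eval_simps algebra_simps intro!: D_eqI)

lemma state_linear: "state \<mu> \<Longrightarrow> linear \<mu>"
  and state_le: "state \<mu> \<Longrightarrow> (\<And>t. t \<in> unit_cube \<Longrightarrow> D_eval f t \<le> c) \<Longrightarrow> \<mu> f \<le> c"
  by (auto simp: state_def)

lemma state_mono:
  assumes "state \<mu>" "\<And>t. t \<in> unit_cube \<Longrightarrow> D_eval f t \<le> D_eval g t"
  shows "\<mu> f \<le> \<mu> g"
proof -
  have "\<mu> (f - g) \<le> 0" by (rule state_le[OF assms(1)]) (simp add: D_eval_simps assms(2))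
  then show ?thesis by (simp add: linear_diff[OF state_linear[OF assms(1)]])
qed

lemma state_nonneg:
  assumes "state \<mu>" "\<And>t. t \<in> unit_cube \<Longrightarrow> 0 \<le> D_eval f t"
  shows "0 \<le> \<mu> f"
  using state_mono[OF assms(1), of 0 f] assms(2) linear_0[OF state_linear[OF assms(1)]]
  by (simp add: D_eval_simps)

lemma mean_square_nonneg: "state \<mu> \<Longrightarrow> 0 \<le> mean_square \<mu> f"
  by (rule state_nonneg) (auto simp: D_eval_simps)

text \<open>This makes the results on bounded forms available for the mean square itself, in
  particular its measurability along \<open>X\<close>.\<close>

lemma state_bounded_bilinear_form:
  assumes "state \<mu>"
  shows "bounded_bilinear_form (\<lambda>f g. \<mu> (D_mult f g)) 1"
proof
  have lin: "linear \<mu>" by (rule state_linear[OF assms])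
  show "bilinear (\<lambda>f g. \<mu> (D_mult f g))"
    unfolding bilinear_def linear_iff
    by (simp add: bilinear_ladd[OF D_mult_bilinear] bilinear_radd[OF D_mult_bilinear]
        bilinear_lmul[OF D_mult_bilinear] bilinear_rmul[OF D_mult_bilinear] linear_add[OF lin] linear_cmul[OF lin])
  fix f g :: "'a D_space"
  have "\<mu> (D_mult f g) \<le> norm f * norm g" for f g
  proof (rule state_le[OF assms])
    fix t :: "real ^ 'a"
    have "D_eval f t * D_eval g t \<le> \<bar>D_eval f t\<bar> * \<bar>D_eval g t\<bar>" by (metis abs_ge_self abs_mult)
    also have "\<dots> \<le> norm f * norm g" by (intro mult_mono D_eval_le_norm) auto
    finally show "D_eval (D_mult f g) t \<le> norm f * norm g" by (simp add: D_eval_simps)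
  qed
  from this[of f g] this[of f "- g"]
  have "\<mu> (D_mult f g) \<le> norm f * norm g" "\<mu> (D_mult f (- g)) \<le> norm f * norm g" by auto
  moreover have "\<mu> (D_mult f (- g)) = - \<mu> (D_mult f g)"
    using bilinear_rneg[OF D_mult_bilinear, of f g] linear_neg[OF lin] by simp
  ultimately show "\<bar>\<mu> (D_mult f g)\<bar> \<le> 1 * norm f * norm g" by simp
qed simp

context bounded_bilinear_form
begin

text \<open>Giving the second copy of \<open>f\<close> the sign of \<open>\<alpha> f f\<close> turns
  the pairing into a sum of absolute values and does not increase any pointwise square.\<close>

lemma grothendieck_quadratic:
  assumes R: "\<And>t. t \<in> unit_cube \<Longrightarrow> (\<Sum>f\<leftarrow>fs. (D_eval f t)\<^sup>2) \<le> R"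
  shows "(\<Sum>f\<leftarrow>fs. \<bar>\<alpha> f f\<bar>) \<le> 8 * B * R"
proof (rule field_le_epsilon)
  fix e :: real assume e: "e > 0"
  obtain s :: "real ^ 'm" where "s \<in> unit_cube" using unit_cube_nonempty by blast
  have "0 \<le> (\<Sum>f\<leftarrow>fs. (D_eval f s)\<^sup>2)" by (rule sum_list_nonneg) auto
  also have "\<dots> \<le> R" by (rule R) fact
  finally have "0 \<le> R" .
  \<comment> \<open>\<open>R\<close> may be 0, but rescaling divides by the root; the increment is
    chosen so that \<open>8 * B * R'\<close> exceeds \<open>8 * B * R\<close> by exactly
    \<open>e\<close>.\<close>
  define R' where "R' = R + e / (8 * B)"
  have R': "R' > 0" "R \<le> R'" using \<open>0 \<le> R\<close> e B_pos by (auto simp: R'_def add_nonneg_pos)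
  define ps where "ps = map (\<lambda>f. (f, sgn (\<alpha> f f) *\<^sub>R f)) fs"
  have "\<bar>pairing_sum \<alpha> ps\<bar> \<le> 8 * B * (sqrt R' * sqrt R')"
  proof (rule pairing_sum_rescale[of UNIV])
    show "square_bounded ((sqrt R')\<^sup>2) ((sqrt R')\<^sup>2) ps"
      unfolding square_bounded_def
    proof (intro ballI)
      fix t :: "real ^ 'm" assume t: "t \<in> unit_cube"
      have "(sgn x * y)\<^sup>2 \<le> y\<^sup>2" for x y :: real by (auto simp: sgn_if)
      then have "(\<Sum>f\<leftarrow>fs. (sgn (\<alpha> f f) * D_eval f t)\<^sup>2) \<le> (\<Sum>f\<leftarrow>fs. (D_eval f t)\<^sup>2)" by (intro sum_list_mono)
      then show "(\<Sum>p\<leftarrow>ps. (D_eval (fst p) t)\<^sup>2) \<le> (sqrt R')\<^sup>2 \<and> (\<Sum>p\<leftarrow>ps. (D_eval (snd p) t)\<^sup>2) \<le> (sqrt R')\<^sup>2"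
        using R[OF t] R' by (simp add: ps_def o_def D_eval_simps)
    qed
  qed (use R' grothendieck in auto)
  moreover have "pairing_sum \<alpha> ps = (\<Sum>f\<leftarrow>fs. \<bar>\<alpha> f f\<bar>)"
    by (simp add: ps_def pairing_sum_def o_def scale abs_sgn mult.commute)
  ultimately have "(\<Sum>f\<leftarrow>fs. \<bar>\<alpha> f f\<bar>) \<le> 8 * B * R'" using R' by simp
  also have "\<dots> = 8 * B * R + e" using B_pos by (simp add: R'_def field_simps)
  finally show "(\<Sum>f\<leftarrow>fs. \<bar>\<alpha> f f\<bar>) \<le> 8 * B * R + e" .
qed

text \<open>
  \<open>S h\<close> collects upper bounds of \<open>h + 8 B \<Sum>f\<^sup>2 - \<Sum>\<bar>\<alpha> f f\<bar>\<close>, so a linear functional below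
  \<open>Inf (S h)\<close> is a state (no \<open>f\<close>) and dominates \<open>\<alpha>\<close> (one \<open>f\<close>, \<open>h = - 8 B f\<^sup>2\<close>); Grothendieck's
  inequality keeps the infimum finite.
\<close>

theorem exists_dominating_state:
  "\<exists>\<mu>. state \<mu> \<and> (\<forall>f. \<bar>\<alpha> f f\<bar> \<le> 8 * B * mean_square \<mu> f)"
proof -
  define S where "S h = {s. \<exists>fs. \<forall>t\<in>unit_cube. D_eval h t + 8 * B * (\<Sum>f\<leftarrow>fs. (D_eval f t)\<^sup>2)
    \<le> s + (\<Sum>f\<leftarrow>fs. \<bar>\<alpha> f f\<bar>)}" for h :: "'m D_space"
  define p where "p h = Inf (S h)" for h
  have B8: "8 * B > 0" using B_pos by simp
  have low: "- norm h \<le> s" if "s \<in> S h" for s and h :: "'m D_space"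
  proof -
    from that obtain fs where fs: "\<And>t. t \<in> unit_cube \<Longrightarrow> D_eval h t + 8 * B * (\<Sum>f\<leftarrow>fs. (D_eval f t)\<^sup>2)
      \<le> s + (\<Sum>f\<leftarrow>fs. \<bar>\<alpha> f f\<bar>)" unfolding S_def by blast
    let ?A = "\<Sum>f\<leftarrow>fs. \<bar>\<alpha> f f\<bar>"
    \<comment> \<open>The factor after \<open>8 * B\<close> is the bound on the sum of squares read
      off from \<open>fs\<close>, using \<open>D_eval h t \<ge> - norm h\<close>. After cancelling
      \<open>?A\<close> this says \<open>0 \<le> s + norm h\<close>.\<close>
    have "?A \<le> 8 * B * ((s + ?A + norm h) / (8 * B))"
    proof (rule grothendieck_quadratic)
      fix t :: "real ^ 'm" assume "t \<in> unit_cube"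
      from fs[OF this] have "(\<Sum>f\<leftarrow>fs. (D_eval f t)\<^sup>2) * (8 * B) \<le> s + ?A + norm h"
        using D_eval_le_norm[of h t] by (simp add: mult.commute)
      then show "(\<Sum>f\<leftarrow>fs. (D_eval f t)\<^sup>2) \<le> (s + ?A + norm h) / (8 * B)"
        using B8 by (simp only: pos_le_divide_eq)
    qed
    then show ?thesis using B8 by simp
  qed
  have bdd: "bdd_below (S h)" for h using low by (rule bdd_belowI)
  have SI: "s \<in> S h" if "\<And>t. t \<in> unit_cube \<Longrightarrow> D_eval h t \<le> s" for s h
    unfolding S_def using that by (auto intro!: exI[of _ "[]"])
  have ne: "S h \<noteq> {}" for h
    using SI[of h "norm h"] D_eval_le_norm[of h] by (auto simp: abs_le_iff)
  have pl: "p h \<le> s" if "s \<in> S h" for s h unfolding p_def by (rule cInf_lower[OF that bdd])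
  have pg: "c \<le> p h" if "\<And>s. s \<in> S h \<Longrightarrow> c \<le> s" for c h unfolding p_def by (rule cInf_greatest[OF ne that])
  have "sublinear p"
    unfolding sublinear_def
  proof (intro conjI allI impI)
    have "p 0 \<le> 0" by (rule pl, rule SI) (simp add: D_eval_simps)
    moreover have "0 \<le> p 0" by (rule pg) (use low[of _ 0] in simp)
    ultimately show "p 0 = 0" by simp
    fix x y :: "'m D_space"
    have "p (x + y) - p x \<le> p y"
    proof (rule pg)
      fix s2 assume s2: "s2 \<in> S y"
      have "p (x + y) - s2 \<le> p x"
      proof (rule pg)
        fix s1 assume s1: "s1 \<in> S x"
        obtain fs gs where
          "\<forall>t\<in>unit_cube. D_eval x t + 8 * B * (\<Sum>f\<leftarrow>fs. (D_eval f t)\<^sup>2) \<le> s1 + (\<Sum>f\<leftarrow>fs. \<bar>\<alpha> f f\<bar>)"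
          "\<forall>t\<in>unit_cube. D_eval y t + 8 * B * (\<Sum>f\<leftarrow>gs. (D_eval f t)\<^sup>2) \<le> s2 + (\<Sum>f\<leftarrow>gs. \<bar>\<alpha> f f\<bar>)"
          using s1 s2 unfolding S_def by blast
        then have "s1 + s2 \<in> S (x + y)"
          unfolding S_def by (intro CollectI exI[of _ "fs @ gs"]) (fastforce simp: D_eval_simps algebra_simps)
        then show "p (x + y) - s2 \<le> s1" using pl by fastforce
      qed
      then show "p (x + y) - p x \<le> s2" by simp
    qed
    then show "p (x + y) \<le> p x + p y" by simp
    fix c :: real assume c: "c > 0"
    have "p (c *\<^sub>R x) / c \<le> p x"
    proof (rule pg)
      fix s assume "s \<in> S x"
      then obtain fs where fs:
        "\<And>t. t\<in>unit_cube \<Longrightarrow> D_eval x t + 8 * B * (\<Sum>f\<leftarrow>fs. (D_eval f t)\<^sup>2) \<le> s + (\<Sum>f\<leftarrow>fs. \<bar>\<alpha> f f\<bar>)"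
        unfolding S_def by blast
      \<comment> \<open>Scaling by \<open>sqrt c\<close> multiplies the squares and the values
        \<open>\<alpha> f f\<close> alike by \<open>c\<close>.\<close>
      let ?gs = "map (\<lambda>f. sqrt c *\<^sub>R f) fs"
      have "(\<Sum>f\<leftarrow>?gs. (D_eval f t)\<^sup>2) = c * (\<Sum>f\<leftarrow>fs. (D_eval f t)\<^sup>2)" for t
        using c by (simp add: o_def D_eval_simps power_mult_distrib sum_list_const_mult)
      moreover have "(\<Sum>f\<leftarrow>?gs. \<bar>\<alpha> f f\<bar>) = c * (\<Sum>f\<leftarrow>fs. \<bar>\<alpha> f f\<bar>)"
        using c by (simp add: o_def scale abs_mult sum_list_const_mult flip: mult.assoc)
      ultimately have "c * s \<in> S (c *\<^sub>R x)"
        unfolding S_def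
      proof (intro CollectI exI[of _ ?gs] ballI)
        fix t :: "real ^ 'm" assume t: "t \<in> unit_cube"
        assume *: "\<And>t. (\<Sum>f\<leftarrow>?gs. (D_eval f t)\<^sup>2) = c * (\<Sum>f\<leftarrow>fs. (D_eval f t)\<^sup>2)"
          "(\<Sum>f\<leftarrow>?gs. \<bar>\<alpha> f f\<bar>) = c * (\<Sum>f\<leftarrow>fs. \<bar>\<alpha> f f\<bar>)"
        show "D_eval (c *\<^sub>R x) t + 8 * B * (\<Sum>f\<leftarrow>?gs. (D_eval f t)\<^sup>2) \<le> c * s + (\<Sum>f\<leftarrow>?gs. \<bar>\<alpha> f f\<bar>)"
          using mult_left_mono[OF fs[OF t], of c] c unfolding * by (simp add: D_eval_simps algebra_simps)
      qed
      then have "p (c *\<^sub>R x) \<le> c * s" by (rule pl)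
      then show "p (c *\<^sub>R x) / c \<le> s" using c by (simp add: field_simps)
    qed
    then show "p (c *\<^sub>R x) \<le> c * p x" using c by (simp add: field_simps)
  qed
  then obtain \<mu> where \<mu>: "linear \<mu>" "\<mu> \<le> p" using sublinear_dominates_linear by blast
  have le: "\<mu> h \<le> s" if "s \<in> S h" for h s using \<mu>(2) pl[OF that] by (meson le_funD order_trans)
  have "state \<mu>" unfolding state_def using \<mu>(1) SI le by blast
  moreover have "\<bar>\<alpha> f f\<bar> \<le> 8 * B * mean_square \<mu> f" for f
  proof -
    have "- \<bar>\<alpha> f f\<bar> \<in> S (- (8 * B) *\<^sub>R D_mult f f)"
      unfolding S_def by (intro CollectI exI[of _ "[f]"]) (simp add: D_eval_simps power2_eq_square)
    from le[OF this] show ?thesis by (simp only: linear_cmul[OF \<mu>(1)]) simp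
  qed
  ultimately show ?thesis by blast
qed

text \<open>Polarisation reduces everything to diagonal values, the only ones that
  \<open>\<mu>\<close> controls: for x = k (f - g) and y = (f + g) / k the mixed terms \<alpha>(x,
  y) + \<alpha>(y, x) equal 2 (\<alpha>(f, f) - \<alpha>(g, g)). The weight \<open>k\<close> lets a
  small mean square of \<open>f - g\<close> be played off against a merely bounded one of
  \<open>f + g\<close>.\<close>

lemma quadratic_difference_le:
  assumes \<mu>: "state \<mu>" and dom: "\<And>f. \<bar>\<alpha> f f\<bar> \<le> C * mean_square \<mu> f" and k: "k > 0"
  shows "\<bar>\<alpha> f f - \<alpha> g g\<bar> \<le> C / 2 * (k\<^sup>2 * mean_square \<mu> (f - g) + mean_square \<mu> (f + g) / k\<^sup>2)"
proof -
  interpret m: bounded_bilinear_form "\<lambda>f g. \<mu> (D_mult f g)" 1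
    by (rule state_bounded_bilinear_form[OF \<mu>])
  define x where "x = k *\<^sub>R (f - g)"
  define y where "y = inverse k *\<^sub>R (f + g)"
  have kk: "k * (inverse k * z) = z" "inverse k * (k * z) = z" for z using k by auto
  have "\<alpha> (x + y) (x + y) - \<alpha> (x - y) (x - y) = 2 * (\<alpha> x y + \<alpha> y x)" by (simp add: add diff)
  also have "\<alpha> x y + \<alpha> y x = 2 * (\<alpha> f f - \<alpha> g g)"
    unfolding x_def y_def scale kk by (simp add: add diff)
  finally have eq: "\<alpha> (x + y) (x + y) - \<alpha> (x - y) (x - y) = 4 * (\<alpha> f f - \<alpha> g g)" by simp
  have "4 * \<bar>\<alpha> f f - \<alpha> g g\<bar> = \<bar>\<alpha> (x + y) (x + y) - \<alpha> (x - y) (x - y)\<bar>"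
    by (simp only: eq abs_mult abs_numeral)
  also have "\<dots> \<le> C * mean_square \<mu> (x + y) + C * mean_square \<mu> (x - y)"
    using dom[of "x + y"] dom[of "x - y"] by linarith
  also have "\<dots> = 2 * C * (mean_square \<mu> x + mean_square \<mu> y)"
    by (simp add: m.add m.diff algebra_simps)
  also have "mean_square \<mu> x = k\<^sup>2 * mean_square \<mu> (f - g)"
    unfolding x_def m.scale by (simp add: power2_eq_square)
  also have "mean_square \<mu> y = mean_square \<mu> (f + g) / k\<^sup>2"
    unfolding y_def m.scale using k by (simp add: power2_eq_square field_simps)
  finally show ?thesis by simp
qed

end

section \<open>Sampling in mean square\<close>

lemma exists_strip:
  fixes i :: "'m::finite"
  assumes c: "0 \<le> c" "c \<le> 1" and d: "d > 0"
  shows "\<exists>s :: 'm D_space. \<forall>t\<in>unit_cube. D_eval s t = of_bool (c \<le> t $ i \<and> t $ i < c + d)"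
proof -
  \<comment> \<open>If \<open>c + d\<close> exceeds 1 it drops out of the grid, but then
    \<open>t $ i < c + d\<close> holds on the whole cube.\<close>
  define C where "C = insert 0 ({c, c + d} \<inter> {0..1})"
  have C: "grid C" by (auto simp: grid_def C_def)
  have "D_eval (step C (\<lambda>s. of_bool (c \<le> s $ i \<and> s $ i < c + d))) t = of_bool (c \<le> t $ i \<and> t $ i < c + d)"
    if t: "t \<in> unit_cube" for t :: "real ^ 'm"
  proof -
    let ?r = "grid_floor C (t $ i)"
    have t01: "0 \<le> t $ i" "t $ i \<le> 1" using t by (auto simp: unit_cube_def)
    note r = grid_floor[OF C t01(1)]
    have "c \<in> C" using c by (simp add: C_def)
    then have "c \<le> ?r \<longleftrightarrow> c \<le> t $ i" using r grid_floor_ge[OF C, of c "t $ i"] by auto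
    moreover have "c + d \<le> ?r" if "c + d \<le> t $ i"
      using that c d t01 by (intro grid_floor_ge[OF C]) (auto simp: C_def)
    then have "?r < c + d \<longleftrightarrow> t $ i < c + d" using r by force
    ultimately show ?thesis using t by (simp add: D_eval_step[OF C] grid_point_def)
  qed
  then show ?thesis by blast
qed

text \<open>Sampling from the left fails on points just to the right of a jump, so the relevant
  quantity is the mass of \<open>[c, c + d)\<close> for small \<open>d\<close>, which for a finitely
  additive state may stay positive. Only \<open>c\<close> in [0,1] and \<open>d > 0\<close> are
  used, where \<open>exists_strip\<close> provides the witness for \<open>SOME\<close>.\<close>

definition strip :: "'m::finite \<Rightarrow> real \<Rightarrow> real \<Rightarrow> 'm D_space" where
  "strip i c d = (SOME s. \<forall>t\<in>unit_cube. D_eval s t = of_bool (c \<le> t $ i \<and> t $ i < c + d))"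

lemma D_eval_strip:
  assumes "0 \<le> c" "c \<le> 1" "d > 0" "t \<in> unit_cube"
  shows "D_eval (strip i c d) t = of_bool (c \<le> t $ i \<and> t $ i < c + d)"
  using someI_ex[OF exists_strip[OF assms(1-3), of i]] assms(4) unfolding strip_def by blast

text \<open>For small \<open>d\<close> the strips at finitely many positions are disjoint, so their
  masses add up to at most 1 and at most \<open>1 / e\<close> positions can be heavy.\<close>

lemma finite_heavy_strips:
  assumes \<mu>: "state \<mu>" and e: "e > 0"
  shows "finite {c \<in> {0..1}. \<forall>d>0. e \<le> \<mu> (strip i c d)}" (is "finite ?H")
proof (rule ccontr)
  assume "infinite ?H"
  obtain n :: nat where n: "1 / e < n" using reals_Archimedean2 by blast
  obtain F where F: "F \<subseteq> ?H" "finite F" "card F = n"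
    using infinite_arbitrarily_large[OF \<open>infinite ?H\<close>, of n] by auto
  have "\<exists>d>0. \<forall>c\<in>F. \<forall>c'\<in>F. c < c' \<longrightarrow> c + d \<le> c'"
  proof -
    \<comment> \<open>The extra \<open>1\<close> keeps \<open>D\<close> nonempty when
      \<open>F\<close> has no two distinct elements.\<close>
    define D where "D = insert 1 ((\<lambda>(c, c'). c' - c) ` {(c, c') \<in> F \<times> F. c < c'})"
    have "finite D" using F(2) by (auto simp: D_def intro: finite_subset[of _ "F \<times> F"])
    moreover have "D \<noteq> {}" "\<And>x. x \<in> D \<Longrightarrow> x > 0" by (auto simp: D_def)
    ultimately have "Min D > 0" by simp
    moreover have "Min D \<le> c' - c" if "c \<in> F" "c' \<in> F" "c < c'" for c c'
      using \<open>finite D\<close> that by (intro Min_le) (force simp: D_def)+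
    ultimately show ?thesis by (intro exI[of _ "Min D"]) fastforce
  qed
  then obtain d where d: "d > 0" "\<And>c c'. c \<in> F \<Longrightarrow> c' \<in> F \<Longrightarrow> c < c' \<Longrightarrow> c + d \<le> c'" by blast
  have "real n * e = (\<Sum>c\<in>F. e)" using F by simp
  also have "\<dots> \<le> (\<Sum>c\<in>F. \<mu> (strip i c d))" using F(1) d(1) by (intro sum_mono) auto
  also have "\<dots> = \<mu> (\<Sum>c\<in>F. strip i c d)" by (rule linear_sum[OF state_linear[OF \<mu>], symmetric])
  also have "\<dots> \<le> 1"
  proof (rule state_le[OF \<mu>])
    fix t :: "real ^ 'a" assume t: "t \<in> unit_cube"
    have sub: "c = c'" if "c \<in> F" "c' \<in> F" "c \<le> t $ i" "t $ i < c + d" "c' \<le> t $ i" "t $ i < c' + d" for c c'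
      using d(2)[of c c'] d(2)[of c' c] that by (cases c c' rule: linorder_cases) auto
    have "D_eval (\<Sum>c\<in>F. strip i c d) t = (\<Sum>c\<in>F. of_bool (c \<le> t $ i \<and> t $ i < c + d))"
      unfolding D_eval_sum using F(1) d(1) t by (intro sum.cong D_eval_strip) auto
    also have "\<dots> = real (card {c \<in> F. c \<le> t $ i \<and> t $ i < c + d})"
      using F(2) by (simp add: of_bool_def sum.If_cases Int_def)
    also have "\<dots> \<le> 1"
      using card_le_Suc0_iff_eq[of "{c \<in> F. c \<le> t $ i \<and> t $ i < c + d}"] F(2) sub by auto
    finally show "D_eval (\<Sum>c\<in>F. strip i c d) t \<le> 1" .
  qed
  finally show False using n e by (simp add: field_simps)
qed

text \<open>At a jump at \<open>c\<close>, sampling errs only where the grid floor is below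
  \<open>c\<close> although \<open>t $ i \<ge> c\<close>. If the strips at \<open>c\<close> keep
  some mass, \<open>c\<close> eventually belongs to the grids; otherwise a rational grid value
  slightly above \<open>c\<close> confines the bad points to a strip of small mass. The grids depend
  on the state and not on \<open>f\<close>.\<close>

theorem exists_sampling_grids:
  fixes \<mu> :: "'m::finite D_space \<Rightarrow> real"
  assumes \<mu>: "state \<mu>"
  shows "\<exists>C. (\<forall>n. grid (C n)) \<and> (\<forall>f. (\<lambda>n. mean_square \<mu> (f - sample (C n) f)) \<longlonglongrightarrow> 0)"
proof -
  define H where "H i k = {c \<in> {0..1}. \<forall>d>0. 1 / real (Suc k) \<le> \<mu> (strip i c d)}" for i k
  \<comment> \<open>The rationals make the grids eventually dense; they also supply 0 for the
    enumeration and 1, to the right of which there is no room for a rational grid value.\<close>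
  define Q where "Q = (\<Union>i. \<Union>k. H i k) \<union> (\<rat> \<inter> {0..1})"
  have "countable Q"
    unfolding Q_def
  proof (intro countable_Un countable_UN)
    show "countable (H i k)" for i k
      unfolding H_def by (rule countable_finite, rule finite_heavy_strips[OF \<mu>]) simp
    show "countable (\<rat> \<inter> {0..1} :: real set)" using countable_rat by (rule countable_subset[rotated]) simp
  qed auto
  moreover have "0 \<in> Q" "Q \<subseteq> {0..1}" by (auto simp: Q_def H_def)
  ultimately obtain q :: "nat \<Rightarrow> real" where q: "range q = Q" using range_from_nat_into[of Q] by blast
  define C where "C n = insert 0 (q ` {..n})" for n
  have C: "grid (C n)" for n using \<open>Q \<subseteq> {0..1}\<close> q by (auto simp: grid_def C_def)
  have inC: "\<exists>N. \<forall>n\<ge>N. x \<in> C n" if x: "x \<in> Q" for x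
  proof -
    obtain N where "x = q N" using x q by blast
    then show ?thesis by (auto simp: C_def intro!: exI[of _ N])
  qed
  have lin: "linear \<mu>" by (rule state_linear[OF \<mu>])
  \<comment> \<open>\<open>s\<close> majorises the indicator of the points whose floor has slipped
    below \<open>c\<close>, for all late grids at once.\<close>
  have jump: "\<exists>s. \<mu> s \<le> \<eta> \<and> (\<forall>t\<in>unit_cube. 0 \<le> D_eval s t) \<and>
      (\<exists>N. \<forall>n\<ge>N. \<forall>t\<in>unit_cube. grid_floor (C n) (t $ i) < c \<longrightarrow> c \<le> t $ i \<longrightarrow> 1 \<le> D_eval s t)"
    if c: "c \<in> {0..1}" and \<eta>: "\<eta> > 0" for c \<eta> and i :: 'm
  proof (cases "c \<in> Q")
    case True
    then obtain N where "\<And>n. n \<ge> N \<Longrightarrow> c \<in> C n" using inC by blast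
    then have "\<not> (grid_floor (C n) (t $ i) < c \<and> c \<le> t $ i)" if "n \<ge> N" for n t
      using that grid_floor_ge[OF C, of c n "t $ i"] by auto
    then show ?thesis
      using \<eta> linear_0[OF lin] by (intro exI[of _ 0] conjI exI[of _ N]) (auto simp: D_eval_simps)
  next
    case False
    obtain k where k: "1 / real (Suc k) < \<eta>" using \<eta> by (metis nat_approx_posE)
    have "c \<notin> H i k" using False by (auto simp: Q_def)
    then obtain d where d: "d > 0" "\<mu> (strip i c d) < 1 / real (Suc k)"
      using c by (auto simp: H_def not_le)
    have "c \<noteq> 1" using False by (auto simp: Q_def)
    then have "c < min 1 (c + d)" using c d by auto
    then obtain x where x: "x \<in> \<rat>" "c < x" "x < min 1 (c + d)" using Rats_dense_in_real by blast
    then have "x \<in> Q" using c by (auto simp: Q_def)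
    then obtain N where N: "\<And>n. n \<ge> N \<Longrightarrow> x \<in> C n" using inC by blast
    have "1 \<le> D_eval (strip i c d) t"
      if "n \<ge> N" "t \<in> unit_cube" "grid_floor (C n) (t $ i) < c" "c \<le> t $ i" for n t
    proof -
      \<comment> \<open>A floor below \<open>c\<close> rules out \<open>x \<le> t $ i\<close>, so
        \<open>t $ i\<close> lies in \<open>[c, x)\<close>, inside the strip.\<close>
      have "\<not> x \<le> t $ i" using grid_floor_ge[OF C N[OF that(1)], of "t $ i"] x that(3) by auto
      then show ?thesis using that x c d by (subst D_eval_strip) auto
    qed
    moreover have "0 \<le> D_eval (strip i c d) t" if "t \<in> unit_cube" for t
      using that c d by (subst D_eval_strip) auto
    ultimately show ?thesis using d k by (intro exI[of _ "strip i c d"]) auto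
  qed
  have "(\<lambda>n. mean_square \<mu> (f - sample (C n) f)) \<longlonglongrightarrow> 0" for f
  proof (rule LIMSEQ_I)
    fix r :: real assume r: "r > 0"
    \<comment> \<open>The estimate ends at 7 e^2, and \<open>r\<close> is 8 e^2.\<close>
    define e where "e = sqrt (r / 8)"
    have e: "e > 0" "8 * e\<^sup>2 = r" using r by (auto simp: e_def)
    obtain C0 where C0: "grid C0" "norm (f - sample C0 f) \<le> e"
      using exists_grid_sample_close[OF e(1), of f] by blast
    define I where "I = C0 \<times> (UNIV :: 'm set)"
    have I: "finite I" using C0(1) by (simp add: I_def grid_def)
    \<comment> \<open>The 12 is 3, from the square of a three-term sum, times 4, from a jump of at
      most \<open>2 * norm f\<close>. Each of the \<open>card I\<close> possible crossings
      contributes with mass at most \<open>\<eta>\<close>, together at most e^2.\<close>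
    define W where "W = 12 * (norm f)\<^sup>2 * card I"
    have W: "W \<ge> 0" by (simp add: W_def)
    define \<eta> where "\<eta> = e\<^sup>2 / (W + 1)"
    have \<eta>: "\<eta> > 0" using e W by (auto simp: \<eta>_def)
    have "\<forall>z\<in>I. \<exists>s. \<mu> s \<le> \<eta> \<and> (\<forall>t\<in>unit_cube. 0 \<le> D_eval s t) \<and>
      (\<exists>N. \<forall>n\<ge>N. \<forall>t\<in>unit_cube. grid_floor (C n) (t $ snd z) < fst z \<longrightarrow> fst z \<le> t $ snd z \<longrightarrow> 1 \<le> D_eval s t)"
      using jump[OF _ \<eta>] C0(1) by (auto simp: I_def grid_def)
    then obtain s N where sN: "\<And>z. z \<in> I \<Longrightarrow> \<mu> (s z) \<le> \<eta>"
      "\<And>z t. z \<in> I \<Longrightarrow> t \<in> unit_cube \<Longrightarrow> 0 \<le> D_eval (s z) t"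
      "\<And>z n t. z \<in> I \<Longrightarrow> n \<ge> N z \<Longrightarrow> t \<in> unit_cube \<Longrightarrow> grid_floor (C n) (t $ snd z) < fst z \<Longrightarrow>
        fst z \<le> t $ snd z \<Longrightarrow> 1 \<le> D_eval (s z) t"
      by metis
    define N0 where "N0 = Max (insert 0 (N ` I))"
    have "norm (mean_square \<mu> (f - sample (C n) f) - 0) < r" if n: "n \<ge> N0" for n
    proof -
      have NI: "n \<ge> N z" if "z \<in> I" for z
        using n that I unfolding N0_def by (meson Max_ge finite_imageI finite_insert imageI insertI2 order_trans)
      define u where "u = step {0} (\<lambda>_. 6 * e\<^sup>2 :: real) + (12 * (norm f)\<^sup>2) *\<^sub>R (\<Sum>z\<in>I. s z)"
      have g0: "grid {0}" by (simp add: grid_def)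
      have "mean_square \<mu> (f - sample (C n) f) \<le> \<mu> u"
      proof (rule state_mono[OF \<mu>])
        fix t :: "real ^ 'm" assume t: "t \<in> unit_cube"
        let ?p = "grid_point (C n) t" and ?g = "grid_point C0"
        have p: "?p \<in> unit_cube" by (rule grid_point_cube[OF C t])
        \<comment> \<open>The error passes through the approximation of \<open>f\<close> on
          \<open>C0\<close>: \<open>a\<close> and \<open>c\<close> are its errors at
          \<open>t\<close> and at the sampling point, and \<open>b\<close> vanishes unless these lie
          in different cells of \<open>C0\<close>.\<close>
        define a where "a = D_eval f t - D_eval f (?g t)"
        define b where "b = D_eval f (?g t) - D_eval f (?g ?p)"
        define c where "c = D_eval f (?g ?p) - D_eval f ?p"
        have close: "\<bar>D_eval f v - D_eval f (?g v)\<bar> \<le> e" if "v \<in> unit_cube" for v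
          using D_eval_le_norm[of "f - sample C0 f" v] C0 that by (simp add: D_eval_simps D_eval_step)
        have a: "a\<^sup>2 \<le> e\<^sup>2" and c: "c\<^sup>2 \<le> e\<^sup>2"
          using close[OF t] close[OF p] e(1) unfolding a_def c_def
          by (auto simp: abs_minus_commute intro!: abs_le_square_iff[THEN iffD1])
        have b: "b\<^sup>2 \<le> 4 * (norm f)\<^sup>2 * (\<Sum>z\<in>I. D_eval (s z) t)"
        proof (cases "?g t = ?g ?p")
          case True
          then show ?thesis using sN(2) t by (auto simp: b_def intro!: mult_nonneg_nonneg sum_nonneg)
        next
          case False
          then obtain i where i: "grid_floor C0 (t $ i) \<noteq> grid_floor C0 (?p $ i)"
            by (auto simp: vec_eq_iff grid_point_def)
          have t01: "0 \<le> t $ i" and p01: "0 \<le> ?p $ i" using t p by (auto simp: unit_cube_def)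
          let ?c = "grid_floor C0 (t $ i)"
          have p_le: "?p $ i \<le> t $ i" using grid_floor[OF C t01] by (simp add: grid_point_def)
          \<comment> \<open>The sampling point lies below \<open>t\<close> in each coordinate, so
            differing floors mean that it has fallen below the value \<open>?c\<close> of
            \<open>C0\<close>: one of the crossings counted by \<open>I\<close>.\<close>
          have "?p $ i < ?c"
          proof (rule ccontr)
            assume "\<not> ?p $ i < ?c"
            then have "grid_floor C0 (?p $ i) = ?c"
              using p01 p_le grid_floor[OF C0(1) t01] grid_floor_ge[OF C0(1), of _ "t $ i"]
              by (intro grid_floor_eqI[OF C0(1)]) auto
            with i show False by simp
          qed
          moreover have "(?c, i) \<in> I" using grid_floor[OF C0(1) t01] by (simp add: I_def)
          ultimately have "1 \<le> D_eval (s (?c, i)) t"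
            using t grid_floor[OF C0(1) t01] by (intro sN(3)[of _ n] NI) (auto simp: grid_point_def)
          also have "\<dots> \<le> (\<Sum>z\<in>I. D_eval (s z) t)"
            using I \<open>(?c, i) \<in> I\<close> sN(2) t by (intro member_le_sum) auto
          finally have 1: "1 \<le> (\<Sum>z\<in>I. D_eval (s z) t)" .
          have "\<bar>b\<bar> \<le> \<bar>2 * norm f\<bar>"
            using D_eval_le_norm[of f "?g t"] D_eval_le_norm[of f "?g ?p"] unfolding b_def by linarith
          then have "b\<^sup>2 \<le> (2 * norm f)\<^sup>2" by (rule abs_le_square_iff[THEN iffD1])
          also have "\<dots> \<le> 4 * (norm f)\<^sup>2 * (\<Sum>z\<in>I. D_eval (s z) t)"
            using mult_left_mono[OF 1, of "4 * (norm f)\<^sup>2"] by (simp add: power_mult_distrib)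
          finally show ?thesis .
        qed
        have "D_eval (D_mult (f - sample (C n) f) (f - sample (C n) f)) t = (a + b + c)\<^sup>2"
          using t by (simp add: D_eval_simps D_eval_step[OF C] a_def b_def c_def power2_eq_square)
        also have "\<dots> \<le> 3 * (a\<^sup>2 + b\<^sup>2 + c\<^sup>2)"
        proof -
          have "0 \<le> (a - b)\<^sup>2 + (b - c)\<^sup>2 + (a - c)\<^sup>2" by simp
          then show ?thesis by (simp add: power2_eq_square algebra_simps)
        qed
        also have "\<dots> \<le> D_eval u t"
          using a b c t by (simp add: u_def D_eval_simps D_eval_step[OF g0] D_eval_sum)
        finally show "D_eval (D_mult (f - sample (C n) f) (f - sample (C n) f)) t \<le> D_eval u t" .
      qed
      also have "\<mu> u = \<mu> (step {0} (\<lambda>_. 6 * e\<^sup>2)) + 12 * (norm f)\<^sup>2 * (\<Sum>z\<in>I. \<mu> (s z))"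
        unfolding u_def by (simp only: linear_add[OF lin] linear_cmul[OF lin] linear_sum[OF lin] real_scaleR_def)
      also have "\<dots> \<le> 6 * e\<^sup>2 + 12 * (norm f)\<^sup>2 * (\<Sum>z\<in>I. \<eta>)"
        by (intro add_mono mult_left_mono sum_mono sN state_le[OF \<mu>]) (auto simp: D_eval_step[OF g0])
      also have "\<dots> = 6 * e\<^sup>2 + W * \<eta>" by (simp add: W_def)
      also have "W * \<eta> \<le> e\<^sup>2" using W e by (simp add: \<eta>_def field_simps)
      finally have "mean_square \<mu> (f - sample (C n) f) \<le> 7 * e\<^sup>2" by simp
      also have "\<dots> < r" using e(2) zero_less_power[OF e(1), of 2] by linarith
      finally show ?thesis using mean_square_nonneg[OF \<mu>, of "f - sample (C n) f"] by simp
    qed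
    then show "\<exists>no. \<forall>n\<ge>no. norm (mean_square \<mu> (f - sample (C n) f) - 0) < r" by blast
  qed
  with C show ?thesis by blast
qed

section \<open>Random elements\<close>

lemma integral_le_of_nn_integral_le:
  fixes f :: "'a \<Rightarrow> real"
  assumes "f \<in> borel_measurable M" "\<And>x. x \<in> space M \<Longrightarrow> 0 \<le> f x" "(\<integral>\<^sup>+x. ennreal (f x) \<partial>M) \<le> ennreal s" "0 \<le> s"
  shows "integrable M f" "(\<integral>x. f x \<partial>M) \<le> s"
proof -
  have "(\<integral>\<^sup>+x. ennreal (norm (f x)) \<partial>M) = (\<integral>\<^sup>+x. ennreal (f x) \<partial>M)"
    using assms(2) by (intro nn_integral_cong) auto
  also have "\<dots> < \<infinity>" using assms(3) by (simp add: order_le_less_trans)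
  finally show int: "integrable M f" using assms(1) by (intro integrableI_bounded)
  have "ennreal (\<integral>x. f x \<partial>M) = (\<integral>\<^sup>+x. ennreal (f x) \<partial>M)"
    using nn_integral_eq_integral[OF int] assms(2) by (simp add: AE_I2)
  with assms(3) have "ennreal (\<integral>x. f x \<partial>M) \<le> ennreal s" by simp
  then show "(\<integral>x. f x \<partial>M) \<le> s" using assms(4) by simp
qed

definition random_element :: "'w measure \<Rightarrow> ('w \<Rightarrow> 'm::finite D_space) \<Rightarrow> bool" where
  "random_element M X \<longleftrightarrow> (\<forall>t. (\<lambda>\<omega>. D_eval (X \<omega>) t) \<in> borel_measurable M)"

lemma random_element_iff: "random_element M X \<longleftrightarrow> X \<in> measurable M D_field"
proof -
  have "(\<lambda>\<omega>. D_eval (X \<omega>) t) \<in> borel_measurable M" if "t \<notin> unit_cube" for t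
    using that by (simp add: D_eval_outside)
  then show ?thesis unfolding random_element_def measurable_D_field_iff by blast
qed

lemma random_element_eval: "random_element M X \<Longrightarrow> (\<lambda>\<omega>. D_eval (X \<omega>) t) \<in> borel_measurable M"
  by (simp add: random_element_def)

lemma random_element_sample: "random_element M X \<Longrightarrow> grid C \<Longrightarrow> random_element M (\<lambda>\<omega>. sample C (X \<omega>))"
  unfolding random_element_def
proof
  fix t assume "\<forall>t. (\<lambda>\<omega>. D_eval (X \<omega>) t) \<in> borel_measurable M" "grid C"
  then show "(\<lambda>\<omega>. D_eval (sample C (X \<omega>)) t) \<in> borel_measurable M"
    by (cases "t \<in> unit_cube") (simp_all add: D_eval_step)
qed

lemma random_element_add:
  "random_element M X \<Longrightarrow> random_element M Y \<Longrightarrow> random_element M (\<lambda>\<omega>. X \<omega> + Y \<omega>)"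
  by (auto simp: random_element_def D_eval_simps intro: borel_measurable_add)

lemma random_element_diff:
  "random_element M X \<Longrightarrow> random_element M Y \<Longrightarrow> random_element M (\<lambda>\<omega>. X \<omega> - Y \<omega>)"
  by (auto simp: random_element_def D_eval_simps intro: borel_measurable_diff)

section \<open>Measurability and mean-square bounds for random elements\<close>

context bounded_bilinear_form
begin

text \<open>In \<open>quadratic_difference_le\<close> the sum of \<open>f\<close> and its sample has
  bounded mean square, so a large fixed \<open>k\<close> makes that term small; the term with the
  difference then tends to 0.\<close>

lemma form_sample_tendsto:
  assumes \<mu>: "state \<mu>" and dom: "\<And>f. \<bar>\<alpha> f f\<bar> \<le> K * mean_square \<mu> f" and K: "K > 0"
    and C: "\<And>n. grid (C n)" and lim: "(\<lambda>n. mean_square \<mu> (f - sample (C n) f)) \<longlonglongrightarrow> 0"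
  shows "(\<lambda>n. \<alpha> (sample (C n) f) (sample (C n) f)) \<longlonglongrightarrow> \<alpha> f f"
proof (rule LIMSEQ_I)
  fix r :: real assume r: "r > 0"
  define V where "V = 4 * (norm f)\<^sup>2"
  have V: "V \<ge> 0" by (simp add: V_def)
  have mV: "mean_square \<mu> (f + sample (C n) f) \<le> V" for n
  proof (rule state_le[OF \<mu>])
    fix t :: "real ^ 'm" assume "t \<in> unit_cube"
    then have "\<bar>D_eval (f + sample (C n) f) t\<bar> \<le> \<bar>2 * norm f\<bar>"
      using D_eval_le_norm[of f t] D_eval_le_norm[of f "grid_point (C n) t"] by (simp add: D_eval_simps D_eval_step[OF C])
    then have "(D_eval (f + sample (C n) f) t)\<^sup>2 \<le> (2 * norm f)\<^sup>2" by (rule abs_le_square_iff[THEN iffD1])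
    then show "D_eval (D_mult (f + sample (C n) f) (f + sample (C n) f)) t \<le> V"
      by (simp add: V_def D_mult.rep_eq power2_eq_square)
  qed
  \<comment> \<open>Chosen so that \<open>K * V / (2 * k2) \<le> r / 2\<close>; the
    \<open>+ 1\<close> keeps it positive when \<open>V\<close> is 0.\<close>
  define k2 where "k2 = (K * V + 1) / r"
  have k2: "k2 > 0" using K V r by (simp add: k2_def add_nonneg_pos)
  define k where "k = sqrt k2"
  have k: "k > 0" "k\<^sup>2 = k2" using k2 by (auto simp: k_def)
  have "r / (K * k2) > 0" using r K k2 by simp
  from LIMSEQ_D[OF lim this] obtain N where N: "\<And>n. n \<ge> N \<Longrightarrow> mean_square \<mu> (f - sample (C n) f) < r / (K * k2)"
    by fastforce
  have "norm (\<alpha> (sample (C n) f) (sample (C n) f) - \<alpha> f f) < r" if "n \<ge> N" for n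
  proof -
    let ?P = "sample (C n) f"
    have "\<bar>\<alpha> f f - \<alpha> ?P ?P\<bar> \<le> K / 2 * (k\<^sup>2 * mean_square \<mu> (f - ?P) + mean_square \<mu> (f + ?P) / k\<^sup>2)"
      by (rule quadratic_difference_le[OF \<mu> dom k(1)])
    also have "\<dots> < K / 2 * (k2 * (r / (K * k2)) + V / k2)"
      using K k2 N[OF that] mV[of n] unfolding k(2)
      by (intro mult_strict_left_mono add_less_le_mono divide_right_mono) auto
    also have "\<dots> = r / 2 + K * V / (2 * k2)" using K k2 by (simp add: field_simps)
    also have "K * V / (2 * k2) \<le> r / 2"
    proof -
      have "K * V \<le> r * k2" using r by (simp add: k2_def)
      then show ?thesis using k2 by (simp add: field_simps)
    qed
    finally show ?thesis by (simp add: abs_minus_commute)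
  qed
  then show "\<exists>no. \<forall>n\<ge>no. norm (\<alpha> (sample (C n) f) (sample (C n) f) - \<alpha> f f) < r" by blast
qed

text \<open>The sampling grids belong to the state, so one sequence serves every
  \<open>\<omega>\<close> and \<open>\<alpha> (X \<omega>) (X \<omega>)\<close> is a pointwise limit
  of quadratic polynomials in evaluations.\<close>

lemma measurable_form_of_dominated:
  assumes X: "random_element M X"
    and \<mu>: "state \<mu>" and dom: "\<And>f. \<bar>\<alpha> f f\<bar> \<le> K * mean_square \<mu> f" and K: "K > 0"
  shows "(\<lambda>\<omega>. \<alpha> (X \<omega>) (X \<omega>)) \<in> borel_measurable M"
proof -
  obtain C where C: "\<And>n. grid (C n)" "\<And>f. (\<lambda>n. mean_square \<mu> (f - sample (C n) f)) \<longlonglongrightarrow> 0"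
    using exists_sampling_grids[OF \<mu>] by blast
  show ?thesis
  proof (rule borel_measurable_LIMSEQ_real)
    show "(\<lambda>n. \<alpha> (sample (C n) (X \<omega>)) (sample (C n) (X \<omega>))) \<longlonglongrightarrow> \<alpha> (X \<omega>) (X \<omega>)" for \<omega>
      by (rule form_sample_tendsto[OF \<mu> dom K C(1) C(2)])
    show "(\<lambda>\<omega>. \<alpha> (sample (C n) (X \<omega>)) (sample (C n) (X \<omega>))) \<in> borel_measurable M" for n
      unfolding form_sample[OF C(1)] using random_element_eval[OF X] by measurable
  qed
qed

lemma measurable_form: "random_element M X \<Longrightarrow> (\<lambda>\<omega>. \<alpha> (X \<omega>) (X \<omega>)) \<in> borel_measurable M"
  using exists_dominating_state B_pos measurable_form_of_dominated[of M X _ "8 * B"] by auto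

end

lemma measurable_mean_square:
  assumes "state \<mu>" "random_element M X"
  shows "(\<lambda>\<omega>. mean_square \<mu> (X \<omega>)) \<in> borel_measurable M"
  using bounded_bilinear_form.measurable_form[OF state_bounded_bilinear_form] assms by blast

text \<open>On a grid the mean square is a combination of squared values with the masses of the
  cells as weights. These are nonnegative with sum at most 1, so the expectation is at most
  \<open>s\<close>, and Fatou's lemma passes to the limit.\<close>

lemma nn_integral_mean_square_le:
  fixes X :: "'w \<Rightarrow> 'm::finite D_space"
  assumes \<mu>: "state \<mu>" and X: "random_element M X"
    and s: "\<And>t. t \<in> unit_cube \<Longrightarrow> (\<integral>\<^sup>+\<omega>. ennreal ((D_eval (X \<omega>) t)\<^sup>2) \<partial>M) \<le> s"
  shows "(\<integral>\<^sup>+\<omega>. ennreal (mean_square \<mu> (X \<omega>)) \<partial>M) \<le> s"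
proof -
  interpret m: bounded_bilinear_form "\<lambda>f g. \<mu> (D_mult f g)" 1
    by (rule state_bounded_bilinear_form[OF \<mu>])
  have lin: "linear \<mu>" by (rule state_linear[OF \<mu>])
  obtain C where C: "\<And>n. grid (C n)" "\<And>f. (\<lambda>n. mean_square \<mu> (f - sample (C n) f)) \<longlonglongrightarrow> 0"
    using exists_sampling_grids[OF \<mu>] by blast
  define Z where "Z n \<omega> = ennreal (mean_square \<mu> (sample (C n) (X \<omega>)))" for n \<omega>
  have lim: "(\<lambda>n. Z n \<omega>) \<longlonglongrightarrow> ennreal (mean_square \<mu> (X \<omega>))" for \<omega>
    unfolding Z_def
    by (intro tendsto_ennrealI m.form_sample_tendsto[OF \<mu>, of 1] C) (auto simp: mean_square_nonneg[OF \<mu>])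
  have Zm: "Z n \<in> borel_measurable M" for n
    unfolding Z_def using measurable_mean_square[OF \<mu> random_element_sample[OF X C(1)]] by measurable
  have le: "(\<integral>\<^sup>+\<omega>. Z n \<omega> \<partial>M) \<le> s" for n
  proof -
    let ?G = "grid_points (C n) :: (real ^ 'm) set"
    have cell0: "0 \<le> \<mu> (cell (C n) c)" for c
      by (rule state_nonneg[OF \<mu>]) (simp add: cell_def D_eval_step[OF C(1)])
    have fin: "finite ?G" by (rule finite_grid_points[OF C(1)])
    have "Z n \<omega> = (\<Sum>c\<in>?G. ennreal (\<mu> (cell (C n) c)) * ennreal ((D_eval (X \<omega>) c)\<^sup>2))" for \<omega>
    proof -
      have "D_mult (sample (C n) f) (sample (C n) f) = step (C n) (\<lambda>t. (D_eval f t)\<^sup>2)" for f :: "'m D_space"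
        by (rule D_eqI) (simp add: D_mult.rep_eq D_eval_step[OF C(1)] power2_eq_square)
      then have "Z n \<omega> = ennreal (\<Sum>c\<in>?G. \<mu> (cell (C n) c) * (D_eval (X \<omega>) c)\<^sup>2)"
        unfolding Z_def by (simp add: step_eq_sum[OF C(1)] linear_sum[OF lin] linear_cmul[OF lin] mult.commute)
      then show ?thesis by (simp add: sum_ennreal cell0 flip: ennreal_mult)
    qed
    then have "(\<integral>\<^sup>+\<omega>. Z n \<omega> \<partial>M) = (\<Sum>c\<in>?G. ennreal (\<mu> (cell (C n) c)) * (\<integral>\<^sup>+\<omega>. ennreal ((D_eval (X \<omega>) c)\<^sup>2) \<partial>M))"
      using random_element_eval[OF X] by (simp add: nn_integral_sum nn_integral_cmult)
    also have "\<dots> \<le> (\<Sum>c\<in>?G. ennreal (\<mu> (cell (C n) c)) * s)"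
      by (intro sum_mono mult_left_mono s) (auto intro: subsetD[OF grid_points_subset[OF C(1)]])
    also have "\<dots> = ennreal (\<Sum>c\<in>?G. \<mu> (cell (C n) c)) * s"
      by (simp add: sum_ennreal cell0 flip: sum_distrib_right)
    also have "(\<Sum>c\<in>?G. \<mu> (cell (C n) c)) = \<mu> (step (C n) (\<lambda>_. 1))"
      by (simp add: step_eq_sum[OF C(1)] linear_sum[OF lin])
    also have "ennreal (\<mu> (step (C n) (\<lambda>_. 1))) * s \<le> 1 * s"
      by (intro mult_right_mono) (auto intro!: state_le[OF \<mu>] simp: D_eval_step[OF C(1)])
    finally show ?thesis by simp
  qed
  have "(\<integral>\<^sup>+\<omega>. ennreal (mean_square \<mu> (X \<omega>)) \<partial>M) = (\<integral>\<^sup>+\<omega>. liminf (\<lambda>n. Z n \<omega>) \<partial>M)"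
    by (intro nn_integral_cong lim_imp_Liminf[symmetric] lim) simp
  also have "\<dots> \<le> liminf (\<lambda>n. \<integral>\<^sup>+\<omega>. Z n \<omega> \<partial>M)"
    by (rule nn_integral_liminf[OF Zm])
  also have "\<dots> \<le> s"
    by (rule Liminf_le) (auto simp: le)
  finally show ?thesis .
qed

lemma mean_square_integrable:
  fixes X :: "'w \<Rightarrow> 'm::finite D_space"
  assumes \<mu>: "state \<mu>" and X: "random_element M X" and s0: "0 \<le> s"
    and s: "\<And>t. t \<in> unit_cube \<Longrightarrow> (\<integral>\<^sup>+\<omega>. ennreal ((D_eval (X \<omega>) t)\<^sup>2) \<partial>M) \<le> ennreal s"
  shows "integrable M (\<lambda>\<omega>. mean_square \<mu> (X \<omega>))" "(\<integral>\<omega>. mean_square \<mu> (X \<omega>) \<partial>M) \<le> s"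
  using integral_le_of_nn_integral_le[OF measurable_mean_square[OF \<mu> X] mean_square_nonneg[OF \<mu>]
      nn_integral_mean_square_le[OF \<mu> X s] s0] by auto

section \<open>Integrability and sampling error of quadratic forms\<close>

context bounded_bilinear_form
begin

lemma integrable_form:
  assumes X: "random_element M X" and s0: "0 \<le> s"
    and s: "\<And>t. t \<in> unit_cube \<Longrightarrow> (\<integral>\<^sup>+\<omega>. ennreal ((D_eval (X \<omega>) t)\<^sup>2) \<partial>M) \<le> ennreal s"
  shows "integrable M (\<lambda>\<omega>. \<alpha> (X \<omega>) (X \<omega>))"
proof -
  obtain \<mu> where \<mu>: "state \<mu>" "\<And>f. \<bar>\<alpha> f f\<bar> \<le> 8 * B * mean_square \<mu> f"
    using exists_dominating_state by blast
  show ?thesis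
  proof (rule Bochner_Integration.integrable_bound)
    show "integrable M (\<lambda>\<omega>. 8 * B * mean_square \<mu> (X \<omega>))"
      using mean_square_integrable(1)[OF \<mu>(1) X s0 s] by simp
    show "AE \<omega> in M. norm (\<alpha> (X \<omega>) (X \<omega>)) \<le> norm (8 * B * mean_square \<mu> (X \<omega>))"
      using \<mu>(2) by (intro AE_I2) (simp, meson abs_ge_self order_trans)
  qed (rule measurable_form[OF X])
qed

text \<open>\<open>quadratic_difference_le\<close> is integrated against a dominating state, which
  then disappears: second moments of the difference are at most \<open>e\<close>, those of the sum
  at most \<open>4 * s\<close>. The bound sees \<open>\<alpha>\<close> only through
  \<open>B\<close>, hence is uniform over the unit ball of functionals.\<close>

lemma integral_form_sample_diff_le:
  fixes X :: "'w \<Rightarrow> 'm D_space"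
  assumes X: "random_element M X" and s0: "0 \<le> s"
    and s: "\<And>t. t \<in> unit_cube \<Longrightarrow> (\<integral>\<^sup>+\<omega>. ennreal ((D_eval (X \<omega>) t)\<^sup>2) \<partial>M) \<le> ennreal s"
    and C: "grid C" and e0: "0 \<le> e"
    and e: "\<And>t. t \<in> unit_cube \<Longrightarrow>
      (\<integral>\<^sup>+\<omega>. ennreal ((D_eval (X \<omega>) t - D_eval (X \<omega>) (grid_point C t))\<^sup>2) \<partial>M) \<le> ennreal e"
    and A: "A \<in> sets M" and k: "k > 0"
  shows "\<bar>(LINT \<omega>:A|M. \<alpha> (X \<omega>) (X \<omega>)) - (LINT \<omega>:A|M. \<alpha> (sample C (X \<omega>)) (sample C (X \<omega>)))\<bar>
    \<le> 4 * B * (k\<^sup>2 * e + 4 * s / k\<^sup>2)"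
proof -
  obtain \<mu> where \<mu>: "state \<mu>" "\<And>f. \<bar>\<alpha> f f\<bar> \<le> 8 * B * mean_square \<mu> f"
    using exists_dominating_state by blast
  let ?P = "\<lambda>\<omega>. sample C (X \<omega>)"
  have P: "random_element M ?P" by (rule random_element_sample[OF X C])
  have Ps: "(\<integral>\<^sup>+\<omega>. ennreal ((D_eval (?P \<omega>) t)\<^sup>2) \<partial>M) \<le> ennreal s" if "t \<in> unit_cube" for t
    using s[OF grid_point_cube[OF C that]] that by (simp add: D_eval_step[OF C])
  have Ds: "(\<integral>\<^sup>+\<omega>. ennreal ((D_eval (X \<omega> - ?P \<omega>) t)\<^sup>2) \<partial>M) \<le> ennreal e" if "t \<in> unit_cube" for t
    using e[OF that] that by (simp add: D_eval_step[OF C] D_eval_simps)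
  have Ss: "(\<integral>\<^sup>+\<omega>. ennreal ((D_eval (X \<omega> + ?P \<omega>) t)\<^sup>2) \<partial>M) \<le> ennreal (4 * s)" if t: "t \<in> unit_cube" for t
  proof -
    have sq: "(x + y)\<^sup>2 \<le> 2 * x\<^sup>2 + 2 * y\<^sup>2" for x y :: real
      using zero_le_power2[of "x - y"] by (simp add: power2_eq_square algebra_simps)
    have "(\<integral>\<^sup>+\<omega>. ennreal ((D_eval (X \<omega> + ?P \<omega>) t)\<^sup>2) \<partial>M)
      \<le> (\<integral>\<^sup>+\<omega>. 2 * ennreal ((D_eval (X \<omega>) t)\<^sup>2) + 2 * ennreal ((D_eval (?P \<omega>) t)\<^sup>2) \<partial>M)"
      using sq by (intro nn_integral_mono)
        (simp add: D_eval_simps ennreal_leI flip: ennreal_plus ennreal_mult ennreal_numeral)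
    also have "\<dots> = 2 * (\<integral>\<^sup>+\<omega>. ennreal ((D_eval (X \<omega>) t)\<^sup>2) \<partial>M) + 2 * (\<integral>\<^sup>+\<omega>. ennreal ((D_eval (?P \<omega>) t)\<^sup>2) \<partial>M)"
      using random_element_eval[OF X] random_element_eval[OF P]
      by (simp add: nn_integral_add nn_integral_cmult)
    also have "\<dots> \<le> 2 * ennreal s + 2 * ennreal s"
      by (intro add_mono mult_left_mono s[OF t] Ps[OF t]) auto
    also have "\<dots> = ennreal (2 * s) + ennreal (2 * s)" using s0 by (simp add: ennreal_mult)
    also have "\<dots> = ennreal (4 * s)" using s0 by (simp flip: ennreal_plus)
    finally show ?thesis .
  qed
  note D = mean_square_integrable[OF \<mu>(1) random_element_diff[OF X P] e0 Ds]
    and S = mean_square_integrable[OF \<mu>(1) random_element_add[OF X P] _ Ss]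
  define h where "h \<omega> = 8 * B / 2 * (k\<^sup>2 * mean_square \<mu> (X \<omega> - ?P \<omega>) + mean_square \<mu> (X \<omega> + ?P \<omega>) / k\<^sup>2)" for \<omega>
  have ih: "integrable M h" unfolding h_def using D(1) S(1) s0 by simp
  have h0: "0 \<le> h \<omega>" for \<omega>
    unfolding h_def using B_pos by (simp add: mean_square_nonneg[OF \<mu>(1)])
  have iX: "integrable M (\<lambda>\<omega>. \<alpha> (X \<omega>) (X \<omega>))" and iP: "integrable M (\<lambda>\<omega>. \<alpha> (?P \<omega>) (?P \<omega>))"
    using integrable_form[OF X s0 s] integrable_form[OF P s0 Ps] by auto
  have iX': "set_integrable M A (\<lambda>\<omega>. \<alpha> (X \<omega>) (X \<omega>))" and iP': "set_integrable M A (\<lambda>\<omega>. \<alpha> (?P \<omega>) (?P \<omega>))"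
    unfolding set_integrable_def using integrable_mult_indicator[OF A iX] integrable_mult_indicator[OF A iP] by auto
  have "\<bar>(LINT \<omega>:A|M. \<alpha> (X \<omega>) (X \<omega>)) - (LINT \<omega>:A|M. \<alpha> (?P \<omega>) (?P \<omega>))\<bar>
      = \<bar>LINT \<omega>|M. indicator A \<omega> *\<^sub>R (\<alpha> (X \<omega>) (X \<omega>) - \<alpha> (?P \<omega>) (?P \<omega>))\<bar>"
    using set_integral_diff(2)[OF iX' iP'] by (simp add: set_lebesgue_integral_def)
  also have "\<dots> \<le> (LINT \<omega>|M. \<bar>indicator A \<omega> *\<^sub>R (\<alpha> (X \<omega>) (X \<omega>) - \<alpha> (?P \<omega>) (?P \<omega>))\<bar>)"
    by (rule integral_abs_bound)
  also have "\<dots> \<le> (LINT \<omega>|M. h \<omega>)"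
  proof (intro integral_mono integrable_abs)
    show "integrable M (\<lambda>\<omega>. indicator A \<omega> *\<^sub>R (\<alpha> (X \<omega>) (X \<omega>) - \<alpha> (?P \<omega>) (?P \<omega>)))"
      by (intro integrable_mult_indicator A Bochner_Integration.integrable_diff iX iP)
    show "\<bar>indicator A \<omega> *\<^sub>R (\<alpha> (X \<omega>) (X \<omega>) - \<alpha> (?P \<omega>) (?P \<omega>))\<bar> \<le> h \<omega>" for \<omega>
      using quadratic_difference_le[OF \<mu> k, of "X \<omega>" "?P \<omega>"] h0[of \<omega>]
      by (cases "\<omega> \<in> A") (auto simp: h_def)
  qed (rule ih)
  also have "\<dots> = 8 * B / 2 * (k\<^sup>2 * (LINT \<omega>|M. mean_square \<mu> (X \<omega> - ?P \<omega>))
      + (LINT \<omega>|M. mean_square \<mu> (X \<omega> + ?P \<omega>)) / k\<^sup>2)"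
    unfolding h_def using D(1) S(1) s0 by simp
  also have "\<dots> \<le> 8 * B / 2 * (k\<^sup>2 * e + 4 * s / k\<^sup>2)"
    using B_pos D(2) S(2) s0 by (intro mult_left_mono add_mono divide_right_mono) auto
  finally show ?thesis by simp
qed

end

section \<open>Uniform integrability\<close>

abbreviation second_moment :: "'w measure \<Rightarrow> ('w \<Rightarrow> 'm::finite D_space) \<Rightarrow> real ^ 'm \<Rightarrow> ennreal" where
  "second_moment M X t \<equiv> \<integral>\<^sup>+\<omega>. ennreal ((D_eval (X \<omega>) t)\<^sup>2) \<partial>M"

definition tail_moment :: "'w measure \<Rightarrow> ('w \<Rightarrow> 'm::finite D_space) \<Rightarrow> real \<Rightarrow> real ^ 'm \<Rightarrow> ennreal" where
  "tail_moment M X K t =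
    (\<integral>\<^sup>+\<omega>. ennreal ((D_eval (X \<omega>) t)\<^sup>2) * indicator {\<omega>. K < (D_eval (X \<omega>) t)\<^sup>2} \<omega> \<partial>M)"

lemma tail_moment_antimono: "K \<le> L \<Longrightarrow> tail_moment M X L t \<le> tail_moment M X K t"
  unfolding tail_moment_def by (intro nn_integral_mono mult_left_mono) (auto split: split_indicator)

lemma uniformly_integrable_iff_tails:
  fixes X :: "'w \<Rightarrow> 'm::finite D_space"
  assumes X: "random_element M X"
  shows "uniformly_integrable M unit_cube (\<lambda>t \<omega>. \<bar>D_eval (X \<omega>) t\<bar>\<^sup>2) \<longleftrightarrow>
    (\<forall>e>0. \<exists>K>0. \<forall>t\<in>unit_cube. tail_moment M X K t \<le> ennreal e)"
proof -
  have meas: "(\<lambda>\<omega>. \<bar>D_eval (X \<omega>) t\<bar>\<^sup>2) \<in> borel_measurable M" for t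
    using random_element_eval[OF X, of t] by simp
  have ui: "uniformly_integrable M unit_cube (\<lambda>t \<omega>. \<bar>D_eval (X \<omega>) t\<bar>\<^sup>2) \<longleftrightarrow>
      ((\<lambda>K. SUP t\<in>unit_cube. tail_moment M X K t) \<longlongrightarrow> 0) at_top"
    unfolding uniformly_integrable_def tail_moment_def using meas by simp
  show ?thesis
    unfolding ui
  proof (intro iffI allI impI)
    fix e :: real assume lim: "((\<lambda>K. SUP t\<in>unit_cube. tail_moment M X K t) \<longlongrightarrow> 0) at_top" and "e > 0"
    then have "\<forall>\<^sub>F K in at_top. (SUP t\<in>unit_cube. tail_moment M X K t) < ennreal e"
      by (intro order_tendstoD(2)[OF lim]) simp
    then have "\<forall>\<^sub>F K in at_top. (SUP t\<in>unit_cube. tail_moment M X K t) < ennreal e \<and> K > 0"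
      using eventually_gt_at_top by (rule eventually_conj)
    then obtain K where K: "(SUP t\<in>unit_cube. tail_moment M X K t) < ennreal e" "K > 0"
      using eventually_happens by fastforce
    then have "tail_moment M X K t \<le> ennreal e" if "t \<in> unit_cube" for t
      using SUP_upper[OF that, of "tail_moment M X K"] by (meson less_imp_le order_trans)
    with K(2) show "\<exists>K>0. \<forall>t\<in>unit_cube. tail_moment M X K t \<le> ennreal e" by blast
  next
    assume tails: "\<forall>e>0. \<exists>K>0. \<forall>t\<in>unit_cube. tail_moment M X K t \<le> ennreal e"
    show "((\<lambda>K. SUP t\<in>unit_cube. tail_moment M X K t) \<longlongrightarrow> 0) at_top"
    proof (rule order_tendstoI)
      fix a :: ennreal assume "0 < a"
      \<comment> \<open>\<open>a\<close> may be infinite; a smaller positive \<open>b\<close> is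
        real, as the tail condition requires.\<close>
      then obtain b where b: "0 < b" "b < a" using dense by blast
      then have "b < \<top>" using less_le_trans top_greatest by blast
      then obtain e where e: "b = ennreal e" "e > 0" using b(1) by (cases b) (auto simp: ennreal_less_zero_iff)
      obtain K where K: "\<And>t. t \<in> unit_cube \<Longrightarrow> tail_moment M X K t \<le> ennreal e" using tails e(2) by blast
      show "\<forall>\<^sub>F K in at_top. (SUP t\<in>unit_cube. tail_moment M X K t) < a"
        using eventually_ge_at_top[of K]
      proof eventually_elim
        case (elim L)
        have "(SUP t\<in>unit_cube. tail_moment M X L t) \<le> ennreal e"
          by (intro SUP_least order_trans[OF tail_moment_antimono[OF elim] K])
        then show ?case using b e by simp
      qed
    qed simp
  qed
qed

lemma second_moment_bounded_of_tail:
  fixes X :: "'w \<Rightarrow> 'm::finite D_space"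
  assumes M: "prob_space M" and X: "random_element M X"
    and K: "0 \<le> K" "tail_moment M X K t \<le> ennreal e" "0 \<le> e"
  shows "second_moment M X t \<le> ennreal (K + e)"
proof -
  interpret prob_space M by fact
  have "second_moment M X t \<le> (\<integral>\<^sup>+\<omega>. ennreal K + ennreal ((D_eval (X \<omega>) t)\<^sup>2) * indicator {\<omega>. K < (D_eval (X \<omega>) t)\<^sup>2} \<omega> \<partial>M)"
  proof (rule nn_integral_mono)
    show "ennreal ((D_eval (X \<omega>) t)\<^sup>2) \<le> ennreal K + ennreal ((D_eval (X \<omega>) t)\<^sup>2) * indicator {\<omega>. K < (D_eval (X \<omega>) t)\<^sup>2} \<omega>" for \<omega>
      by (cases "K < (D_eval (X \<omega>) t)\<^sup>2") (auto simp: ennreal_leI)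
  qed
  also have "\<dots> = ennreal K + tail_moment M X K t"
    unfolding tail_moment_def using random_element_eval[OF X, of t]
    by (subst nn_integral_add) (auto simp: emeasure_space_1)
  also have "\<dots> \<le> ennreal K + ennreal e" by (intro add_left_mono K)
  also have "\<dots> = ennreal (K + e)" using K by (simp add: ennreal_plus)
  finally show ?thesis .
qed

section \<open>Sampling in mean square uniformly over the cube\<close>

lemma abs_clip_le: "0 \<le> L \<Longrightarrow> \<bar>clip L x\<bar> \<le> L"
  by (auto simp: clip_def)

lemma abs_clip_diff_le: "\<bar>clip L x - clip L y\<bar> \<le> \<bar>x - y\<bar>"
  by (auto simp: clip_def max_def min_def)

lemma clip_residual_le:
  assumes "0 \<le> L"
  shows "(x - clip L x)\<^sup>2 \<le> x\<^sup>2 * of_bool (L\<^sup>2 < x\<^sup>2)"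
proof (cases "\<bar>x\<bar> \<le> L")
  case True
  then have "clip L x = x" by (auto simp: clip_def)
  then show ?thesis by simp
next
  case False
  then have "L\<^sup>2 < x\<^sup>2" using assms by (simp add: abs_le_square_iff[symmetric] flip: not_le)
  moreover have "\<bar>x - clip L x\<bar> \<le> \<bar>x\<bar>" using assms by (auto simp: clip_def)
  then have "(x - clip L x)\<^sup>2 \<le> x\<^sup>2" by (rule abs_le_square_iff[THEN iffD1])
  ultimately show ?thesis by simp
qed

text \<open>The limit is fixed before the sequence, so two sequences in one quadrant share
  it.\<close>

lemma quadrant_limit:
  fixes t :: "real ^ 'm::finite"
  assumes "t \<in> unit_cube" "\<forall>i\<in>S. 0 < t $ i"
  obtains l where "\<And>v :: nat \<Rightarrow> real ^ 'm. v \<longlonglongrightarrow> t \<Longrightarrow> (\<And>n. v n \<in> quadrant t S) \<Longrightarrow> (\<lambda>n. D_eval f (v n)) \<longlonglongrightarrow> l"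
proof -
  obtain l where l: "(D_eval f \<longlongrightarrow> l) (inf (nhds t) (principal (quadrant t S)))"
    using D_eval_limits[of f] assms unfolding has_quadrant_limits_def by blast
  have "(\<lambda>n. D_eval f (v n)) \<longlonglongrightarrow> l" if "v \<longlonglongrightarrow> t" "\<And>n. v n \<in> quadrant t S"
    for v :: "nat \<Rightarrow> real ^ 'm"
    by (rule filterlim_compose[OF l]) (simp add: filterlim_inf filterlim_principal that)
  then show thesis by (rule that)
qed

text \<open>Otherwise some quadrant at \<open>t\<close> contains two sequences tending to
  \<open>t\<close> along which \<open>X\<close> stays apart in mean square. Their difference tends
  to 0 pointwise; dominated convergence handles the clipped values, and uniform tails handle the
  rest.\<close>

lemma exists_uniform_sampling_grid:
  fixes X :: "'w \<Rightarrow> 'm::finite D_space"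
  assumes M: "prob_space M" and X: "random_element M X"
    and tails: "\<And>e. e > 0 \<Longrightarrow> \<exists>K>0. \<forall>t\<in>unit_cube. tail_moment M X K t \<le> ennreal e" and e: "e > 0"
  shows "\<exists>C. grid C \<and> (\<forall>t\<in>unit_cube.
    (\<integral>\<^sup>+\<omega>. ennreal ((D_eval (X \<omega>) t - D_eval (X \<omega>) (grid_point C t))\<^sup>2) \<partial>M) \<le> ennreal e)"
proof -
  interpret prob_space M by fact
  note [measurable] = random_element_eval[OF X]
  let ?R = "\<lambda>t s. (\<integral>\<^sup>+\<omega>. ennreal ((D_eval (X \<omega>) t - D_eval (X \<omega>) s)\<^sup>2) \<partial>M) \<le> ennreal e"
  have "\<exists>C. grid C \<and> (\<forall>C'. grid C' \<longrightarrow> C \<subseteq> C' \<longrightarrow> (\<forall>t\<in>unit_cube. ?R t (grid_point C' t)))"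
  proof (rule exists_fine_grid, rule ccontr)
    fix t :: "real ^ 'm" and S assume t: "t \<in> unit_cube" "\<forall>i\<in>S. 0 < t $ i"
    assume no: "\<not> (\<exists>d>0. \<forall>s\<in>quadrant t S. \<forall>s'\<in>quadrant t S. dist s t < d \<longrightarrow> dist s' t < d \<longrightarrow> ?R s s')"
    define Q where "Q n s s' \<longleftrightarrow> s \<in> quadrant t S \<and> s' \<in> quadrant t S \<and> dist s t < 1 / real (Suc n) \<and>
        dist s' t < 1 / real (Suc n) \<and> \<not> ?R s s'" for n s s'
    have "\<exists>s s'. Q n s s'" for n
    proof -
      have "0 < 1 / real (Suc n)" by simp
      with no show ?thesis unfolding Q_def by blast
    qed
    then obtain u v where "\<And>n. Q n (u n) (v n)" by metis
    then have uv: "\<And>n. u n \<in> quadrant t S" "\<And>n. v n \<in> quadrant t S"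
      "\<And>n. dist (u n) t < 1 / real (Suc n)" "\<And>n. dist (v n) t < 1 / real (Suc n)" "\<And>n. \<not> ?R (u n) (v n)"
      unfolding Q_def by auto
    have lim: "w \<longlonglongrightarrow> t" if w: "\<And>n. dist (w n) t < 1 / real (Suc n)" for w
    proof (rule metric_LIMSEQ_I)
      fix r :: real assume "r > 0"
      then obtain n where n: "1 / real (Suc n) < r" by (metis nat_approx_posE)
      have "dist (w k) t < r" if "k \<ge> n" for k
      proof -
        have "1 / real (Suc k) \<le> 1 / real (Suc n)" using that by (simp add: frac_le)
        then show ?thesis using w[of k] n by linarith
      qed
      then show "\<exists>N. \<forall>n\<ge>N. dist (w n) t < r" by blast
    qed
    have "u \<longlonglongrightarrow> t" "v \<longlonglongrightarrow> t" by (intro lim uv)+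
    have quadrant_cube: "s \<in> unit_cube" if "s \<in> quadrant t S" for s
      using that t unfolding quadrant_def unit_cube_def by (smt (verit) mem_Collect_eq)
    have diff0: "(\<lambda>n. D_eval f (u n) - D_eval f (v n)) \<longlonglongrightarrow> 0" for f
    proof -
      obtain l where l: "\<And>v :: nat \<Rightarrow> real ^ 'm. v \<longlonglongrightarrow> t \<Longrightarrow> (\<And>n. v n \<in> quadrant t S) \<Longrightarrow> (\<lambda>n. D_eval f (v n)) \<longlonglongrightarrow> l"
        using quadrant_limit[OF t] by blast
      from tendsto_diff[OF l[OF \<open>u \<longlonglongrightarrow> t\<close> uv(1)] l[OF \<open>v \<longlonglongrightarrow> t\<close> uv(2)]] show ?thesis by simp
    qed
    \<comment> \<open>Two tails of \<open>e / 12\<close> and a clipped part of \<open>e / 6\<close>,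
      multiplied by 3 from squaring a three-term sum, give \<open>e\<close>.\<close>
    obtain K where K: "K > 0" "\<And>s. s \<in> unit_cube \<Longrightarrow> tail_moment M X K s \<le> ennreal (e / 12)"
      using tails[of "e / 12"] e by auto
    define L where "L = sqrt K"
    have L: "0 \<le> L" "L\<^sup>2 = K" using K(1) by (auto simp: L_def)
    define h where "h n \<omega> = (clip L (D_eval (X \<omega>) (u n)) - clip L (D_eval (X \<omega>) (v n)))\<^sup>2" for n \<omega>
    have hm[measurable]: "h n \<in> borel_measurable M" for n unfolding h_def clip_def by measurable
    have "(\<lambda>n. \<integral>\<omega>. h n \<omega> \<partial>M) \<longlonglongrightarrow> (\<integral>\<omega>. 0 \<partial>M)"
    proof (rule integral_dominated_convergence[where w = "\<lambda>_. (2 * L)\<^sup>2"])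
      show "AE \<omega> in M. (\<lambda>n. h n \<omega>) \<longlonglongrightarrow> 0"
      proof (rule AE_I2)
        fix \<omega>
        have "(\<lambda>n. (D_eval (X \<omega>) (u n) - D_eval (X \<omega>) (v n))\<^sup>2) \<longlonglongrightarrow> 0\<^sup>2"
          by (intro tendsto_power diff0)
        then have lim: "(\<lambda>n. (D_eval (X \<omega>) (u n) - D_eval (X \<omega>) (v n))\<^sup>2) \<longlonglongrightarrow> 0" by simp
        show "(\<lambda>n. h n \<omega>) \<longlonglongrightarrow> 0"
        proof (rule tendsto_sandwich[OF _ _ tendsto_const lim])
          show "\<forall>\<^sub>F n in sequentially. h n \<omega> \<le> (D_eval (X \<omega>) (u n) - D_eval (X \<omega>) (v n))\<^sup>2"
            unfolding h_def by (intro always_eventually allI abs_le_square_iff[THEN iffD1] abs_clip_diff_le)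
        qed (simp add: h_def)
      qed
      show "AE \<omega> in M. norm (h n \<omega>) \<le> (2 * L)\<^sup>2" for n
      proof (rule AE_I2)
        fix \<omega>
        have "\<bar>clip L (D_eval (X \<omega>) (u n)) - clip L (D_eval (X \<omega>) (v n))\<bar> \<le> \<bar>2 * L\<bar>"
          using abs_clip_le[OF L(1), of "D_eval (X \<omega>) (u n)"] abs_clip_le[OF L(1), of "D_eval (X \<omega>) (v n)"] by linarith
        then show "norm (h n \<omega>) \<le> (2 * L)\<^sup>2"
          unfolding h_def real_norm_def abs_power2 by (rule abs_le_square_iff[THEN iffD1])
      qed
    qed auto
    then have "(\<lambda>n. \<integral>\<omega>. h n \<omega> \<partial>M) \<longlonglongrightarrow> 0" by simp
    from LIMSEQ_D[OF this, of "e / 6"] obtain n where n: "\<bar>\<integral>\<omega>. h n \<omega> \<partial>M\<bar> < e / 6" using e by auto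
    have hint: "integrable M (h n)"
    proof (rule integrable_const_bound[where B = "(2 * L)\<^sup>2"])
      have "\<bar>clip L (D_eval (X \<omega>) (u n)) - clip L (D_eval (X \<omega>) (v n))\<bar> \<le> \<bar>2 * L\<bar>" for \<omega>
        using abs_clip_le[OF L(1), of "D_eval (X \<omega>) (u n)"] abs_clip_le[OF L(1), of "D_eval (X \<omega>) (v n)"] by linarith
      then show "AE \<omega> in M. norm (h n \<omega>) \<le> (2 * L)\<^sup>2"
        unfolding h_def real_norm_def abs_power2 by (intro AE_I2 abs_le_square_iff[THEN iffD1])
    qed simp
    have hnn: "(\<integral>\<^sup>+\<omega>. ennreal (h n \<omega>) \<partial>M) \<le> ennreal (e / 6)"
    proof (subst nn_integral_eq_integral[OF hint])
      show "AE \<omega> in M. 0 \<le> h n \<omega>" by (simp add: h_def)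
      show "ennreal (\<integral>\<omega>. h n \<omega> \<partial>M) \<le> ennreal (e / 6)" using n by (intro ennreal_leI) linarith
    qed
    define T where "T s \<omega> = ennreal ((D_eval (X \<omega>) s)\<^sup>2) * indicator {\<omega>. K < (D_eval (X \<omega>) s)\<^sup>2} \<omega>" for s \<omega>
    have T_eq: "T s \<omega> = ennreal ((D_eval (X \<omega>) s)\<^sup>2 * of_bool (K < (D_eval (X \<omega>) s)\<^sup>2))" for s \<omega>
      unfolding T_def by (simp split: split_indicator)
    have Tm[measurable]: "T s \<in> borel_measurable M" for s unfolding T_def by measurable
    have Tint: "(\<integral>\<^sup>+\<omega>. T s \<omega> \<partial>M) \<le> ennreal (e / 12)" if "s \<in> unit_cube" for s
      using K(2)[OF that] unfolding tail_moment_def T_def .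
    have "(\<integral>\<^sup>+\<omega>. ennreal ((D_eval (X \<omega>) (u n) - D_eval (X \<omega>) (v n))\<^sup>2) \<partial>M)
        \<le> (\<integral>\<^sup>+\<omega>. 3 * (T (u n) \<omega> + ennreal (h n \<omega>) + T (v n) \<omega>) \<partial>M)"
    proof (rule nn_integral_mono)
      fix \<omega>
      let ?x = "D_eval (X \<omega>) (u n)" and ?y = "D_eval (X \<omega>) (v n)"
      define a where "a = ?x - clip L ?x"
      define b where "b = clip L ?x - clip L ?y"
      define c where "c = clip L ?y - ?y"
      have "0 \<le> (a - b)\<^sup>2 + (b - c)\<^sup>2 + (a - c)\<^sup>2" by simp
      then have "(a + b + c)\<^sup>2 \<le> 3 * (a\<^sup>2 + b\<^sup>2 + c\<^sup>2)" by (simp add: power2_eq_square algebra_simps)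
      also have "c\<^sup>2 = (?y - clip L ?y)\<^sup>2" by (simp add: c_def power2_commute)
      also have "3 * (a\<^sup>2 + b\<^sup>2 + (?y - clip L ?y)\<^sup>2)
          \<le> 3 * (?x\<^sup>2 * of_bool (K < ?x\<^sup>2) + h n \<omega> + ?y\<^sup>2 * of_bool (K < ?y\<^sup>2))"
        using clip_residual_le[OF L(1), of ?x] clip_residual_le[OF L(1), of ?y] L(2)
        by (simp add: a_def b_def h_def)
      finally have "ennreal ((?x - ?y)\<^sup>2) \<le> ennreal (3 * (?x\<^sup>2 * of_bool (K < ?x\<^sup>2) + h n \<omega> + ?y\<^sup>2 * of_bool (K < ?y\<^sup>2)))"
        by (intro ennreal_leI) (simp add: a_def b_def c_def)
      also have "\<dots> = 3 * (ennreal (?x\<^sup>2 * of_bool (K < ?x\<^sup>2)) + ennreal (h n \<omega>) + ennreal (?y\<^sup>2 * of_bool (K < ?y\<^sup>2)))"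
        by (simp add: ennreal_mult ennreal_plus h_def)
      finally show "ennreal ((?x - ?y)\<^sup>2) \<le> 3 * (T (u n) \<omega> + ennreal (h n \<omega>) + T (v n) \<omega>)"
        unfolding T_eq .
    qed
    also have "\<dots> = 3 * ((\<integral>\<^sup>+\<omega>. T (u n) \<omega> \<partial>M) + (\<integral>\<^sup>+\<omega>. ennreal (h n \<omega>) \<partial>M) + (\<integral>\<^sup>+\<omega>. T (v n) \<omega> \<partial>M))"
      by (simp add: nn_integral_cmult nn_integral_add)
    also have "\<dots> \<le> 3 * (ennreal (e / 12) + ennreal (e / 6) + ennreal (e / 12))"
      by (intro mult_left_mono add_mono Tint hnn quadrant_cube uv) simp
    also have "\<dots> = 3 * ennreal (e / 3)" using e by (simp flip: ennreal_plus)
    also have "\<dots> = ennreal e" using ennreal_mult[of 3 "e / 3"] e by simp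
    finally show False using uv(5)[of n] by simp
  qed
  then show ?thesis by blast
qed

section \<open>Limits of evaluation functionals\<close>

text \<open>The limit may be a one-sided limit at a boundary point of a quadrant and need not be an
  evaluation itself.\<close>

lemma exists_limit_functional:
  fixes u :: "nat \<Rightarrow> real ^ 'm::finite"
  assumes "\<And>f. convergent (\<lambda>n. D_eval f (u n))"
  shows "\<exists>\<phi> :: 'm D_space \<Rightarrow>\<^sub>L real. norm \<phi> \<le> 1 \<and> (\<forall>f. (\<lambda>n. D_eval f (u n)) \<longlonglongrightarrow> blinfun_apply \<phi> f)"
proof -
  define l where "l f = lim (\<lambda>n. D_eval f (u n))" for f :: "'m D_space"
  have l: "(\<lambda>n. D_eval f (u n)) \<longlonglongrightarrow> l f" for f
    unfolding l_def using assms convergent_LIMSEQ_iff by blast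
  have le: "\<bar>l f\<bar> \<le> norm f" for f
    by (rule tendsto_upperbound[OF tendsto_rabs[OF l]]) (auto simp: D_eval_le_norm)
  have "l (f + g) = l f + l g" for f g
    by (rule LIMSEQ_unique[OF l]) (use tendsto_add[OF l l, of f g] in \<open>simp add: D_eval_simps\<close>)
  moreover have "l (c *\<^sub>R f) = c * l f" for c f
    by (rule LIMSEQ_unique[OF l]) (use tendsto_mult_left[OF l, of c f] in \<open>simp add: D_eval_simps\<close>)
  ultimately have bl: "bounded_linear l" using le by (intro bounded_linear_intro[of l 1]) auto
  then have "blinfun_apply (Blinfun l) = l" by (rule bounded_linear_Blinfun_apply)
  moreover have "norm (Blinfun l) \<le> 1" using le by (intro norm_blinfun_bound) (auto simp: bounded_linear_Blinfun_apply bl)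
  ultimately show ?thesis using l by metis
qed

text \<open>This replaces weak* sequential compactness: compactness of the cube gives a limit point,
  and since it has finitely many quadrants, a further subsequence stays in one.\<close>

lemma exists_convergent_subsequence:
  fixes u :: "nat \<Rightarrow> real ^ 'm::finite"
  assumes "\<And>n. u n \<in> unit_cube"
  shows "\<exists>r. strict_mono r \<and> (\<forall>f. convergent (\<lambda>n. D_eval f (u (r n))))"
proof -
  obtain t r where t: "t \<in> unit_cube" and r: "strict_mono r" "(u \<circ> r) \<longlonglongrightarrow> t"
    using compact_imp_seq_compact[OF compact_unit_cube] assms unfolding seq_compact_def by metis
  define J where "J n = {i. u (r n) $ i < t $ i}" for n
  have "finite (range J)" by (rule finite_subset[OF subset_UNIV]) simp
  then obtain S where S: "infinite {n. J n = S}"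
    using pigeonhole_infinite[of "UNIV :: nat set" J] by auto
  obtain q :: "nat \<Rightarrow> nat" where q: "strict_mono q" "\<And>n. J (q n) = S"
    using infinite_enumerate[OF S] by auto
  let ?v = "\<lambda>n. u (r (q n))"
  have "?v \<longlonglongrightarrow> t" using LIMSEQ_subseq_LIMSEQ[OF r(2) q(1)] by (simp add: o_def)
  moreover have "?v n \<in> quadrant t S" for n
    using q(2)[of n] assms[of "r (q n)"] unfolding quadrant_def J_def unit_cube_def by (auto simp: not_less)
  moreover have "\<forall>i\<in>S. 0 < t $ i"
  proof
    fix i assume "i \<in> S"
    then have "u (r (q 0)) $ i < t $ i" using q(2)[of 0] by (auto simp: J_def)
    moreover have "0 \<le> u (r (q 0)) $ i" using assms[of "r (q 0)"] by (simp add: unit_cube_def)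
    ultimately show "0 < t $ i" by simp
  qed
  ultimately have "convergent (\<lambda>n. D_eval f (?v n))" for f
    using quadrant_limit[OF t, of S f] unfolding convergent_def by metis
  then show ?thesis using strict_mono_compose[OF r(1) q(1)] by (intro exI[of _ "r \<circ> q"]) (auto simp: o_def)
qed

section \<open>Tensor squares\<close>

text \<open>\<open>tensor_norm\<close> turns functionals into bounded bilinear forms, which yields
  existence of moments. \<open>product_functional\<close> makes evaluations and their pointwise
  limits act on the square, which yields the converses; density carries limits from elementary
  tensors to all elements.\<close>

locale tensor_square =
  fixes \<tau> :: "'m::finite D_space \<Rightarrow> 'm D_space \<Rightarrow> 'e::banach"
  assumes tensor_bilinear: "bilinear \<tau>"
    and tensor_norm: "norm (\<tau> f g) \<le> norm f * norm g"
    and tensor_dense: "closure (span (range (case_prod \<tau>))) = UNIV"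
    and product_functional: "norm (\<phi> :: 'm D_space \<Rightarrow>\<^sub>L real) \<le> 1 \<Longrightarrow>
      \<exists>\<xi> :: 'e \<Rightarrow>\<^sub>L real. norm \<xi> \<le> 1 \<and> (\<forall>f g. blinfun_apply \<xi> (\<tau> f g) = blinfun_apply \<phi> f * blinfun_apply \<phi> g)"
begin

lemma functional_form: "bounded_bilinear_form (\<lambda>f g. blinfun_apply \<xi> (\<tau> f g)) (norm \<xi> + 1)"
proof
  show "bilinear (\<lambda>f g. blinfun_apply \<xi> (\<tau> f g))"
    unfolding bilinear_def linear_iff
    by (simp add: bilinear_ladd[OF tensor_bilinear] bilinear_radd[OF tensor_bilinear]
        bilinear_lmul[OF tensor_bilinear] bilinear_rmul[OF tensor_bilinear] blinfun.add_right blinfun.scaleR_right)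
  fix f g
  have "\<bar>blinfun_apply \<xi> (\<tau> f g)\<bar> \<le> norm \<xi> * norm (\<tau> f g)" using norm_blinfun[of \<xi> "\<tau> f g"] by simp
  also have "\<dots> \<le> (norm \<xi> + 1) * (norm f * norm g)" by (intro mult_mono tensor_norm) auto
  finally show "\<bar>blinfun_apply \<xi> (\<tau> f g)\<bar> \<le> (norm \<xi> + 1) * norm f * norm g" by (simp add: mult.assoc)
qed (simp add: add_nonneg_pos)

text \<open>The uniform norm bound spreads convergence from elementary tensors to their span and on
  to its closure.\<close>

lemma functional_tendsto:
  fixes \<xi> :: "nat \<Rightarrow> 'e \<Rightarrow>\<^sub>L real" and \<zeta> :: "'e \<Rightarrow>\<^sub>L real"
  assumes \<xi>: "\<And>n. norm (\<xi> n) \<le> 1" "norm \<zeta> \<le> 1"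
    and lim: "\<And>f g. (\<lambda>n. blinfun_apply (\<xi> n) (\<tau> f g)) \<longlonglongrightarrow> blinfun_apply \<zeta> (\<tau> f g)"
  shows "(\<lambda>n. blinfun_apply (\<xi> n) z) \<longlonglongrightarrow> blinfun_apply \<zeta> z"
proof (rule LIMSEQ_I)
  fix r :: real assume r: "r > 0"
  have lip: "\<bar>blinfun_apply \<eta> a - blinfun_apply \<eta> b\<bar> \<le> dist a b" if "norm \<eta> \<le> 1" for \<eta> :: "'e \<Rightarrow>\<^sub>L real" and a b
    using norm_blinfun[of \<eta> "a - b"] mult_right_mono[OF that, of "norm (a - b)"]
    by (simp add: blinfun.diff_right dist_norm)
  obtain y where y: "y \<in> span (range (case_prod \<tau>))" "dist y z < r / 3"
    using tensor_dense r closure_approachable[of z] by (metis UNIV_I zero_less_divide_iff zero_less_numeral)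
  have "(\<lambda>n. blinfun_apply (\<xi> n) y) \<longlonglongrightarrow> blinfun_apply \<zeta> y"
    using y(1)
  proof (induction rule: span_induct)
    case base
    show "subspace {y. (\<lambda>n. blinfun_apply (\<xi> n) y) \<longlonglongrightarrow> blinfun_apply \<zeta> y}"
      by (rule subspaceI) (auto simp: blinfun.zero_right blinfun.add_right blinfun.scaleR_right intro: tendsto_add tendsto_mult[OF tendsto_const])
  next
    case (step x)
    then show ?case using lim by auto
  qed
  from LIMSEQ_D[OF this, of "r / 3"] r obtain N where
    N: "\<And>n. n \<ge> N \<Longrightarrow> \<bar>blinfun_apply (\<xi> n) y - blinfun_apply \<zeta> y\<bar> < r / 3" by auto
  have "norm (blinfun_apply (\<xi> n) z - blinfun_apply \<zeta> z) < r" if "n \<ge> N" for n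
    using N[OF that] lip[OF \<xi>(1), of n y z] lip[OF \<xi>(2), of y z] y(2) unfolding real_norm_def by linarith
  then show "\<exists>no. \<forall>n\<ge>no. norm (blinfun_apply (\<xi> n) z - blinfun_apply \<zeta> z) < r" by blast
qed

lemma evaluation_functional:
  "\<exists>\<xi> :: 'e \<Rightarrow>\<^sub>L real. norm \<xi> \<le> 1 \<and> (\<forall>f g. blinfun_apply \<xi> (\<tau> f g) = D_eval f t * D_eval g t)"
proof -
  obtain \<phi> :: "'m D_space \<Rightarrow>\<^sub>L real" where \<phi>: "norm \<phi> \<le> 1" "\<And>f. (\<lambda>n :: nat. D_eval f t) \<longlonglongrightarrow> blinfun_apply \<phi> f"
    using exists_limit_functional[of "\<lambda>_. t"] convergent_const by blast
  have "blinfun_apply \<phi> f = D_eval f t" for f by (rule LIMSEQ_unique[OF \<phi>(2) tendsto_const])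
  then show ?thesis using product_functional[OF \<phi>(1)] by simp
qed

theorem dunford_integrable_iff:
  assumes X: "random_element M X"
  shows "dunford_integrable M (\<lambda>\<omega>. \<tau> (X \<omega>) (X \<omega>)) \<longleftrightarrow> (SUP t\<in>unit_cube. second_moment M X t) < \<infinity>"
proof
  assume dunford: "dunford_integrable M (\<lambda>\<omega>. \<tau> (X \<omega>) (X \<omega>))"
  show "(SUP t\<in>unit_cube. second_moment M X t) < \<infinity>"
  proof (rule ccontr)
    assume inf: "\<not> (SUP t\<in>unit_cube. second_moment M X t) < \<infinity>"
    \<comment> \<open>Second moments above \<open>4 ^ n\<close> against weights
      \<open>(1 / 2) ^ n\<close> force the integral of the weighted sum above every
      \<open>2 ^ n\<close>; all terms are nonnegative, so each bounds the sum from below.\<close>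
    have "\<exists>t\<in>unit_cube. ennreal (4 ^ n) < second_moment M X t" for n
    proof (rule ccontr)
      assume "\<not> (\<exists>t\<in>unit_cube. ennreal (4 ^ n) < second_moment M X t)"
      then have "(SUP t\<in>unit_cube. second_moment M X t) \<le> ennreal (4 ^ n)"
        by (intro SUP_least) (auto simp: not_less)
      also have "\<dots> < \<infinity>" by simp
      finally show False using inf by simp
    qed
    then obtain t where t: "\<And>n. ennreal (4 ^ n) < second_moment M X (t n)" by metis
    have "\<forall>n. \<exists>\<xi> :: 'e \<Rightarrow>\<^sub>L real. norm \<xi> \<le> 1 \<and> (\<forall>f g. blinfun_apply \<xi> (\<tau> f g) = D_eval f (t n) * D_eval g (t n))"
      using evaluation_functional by blast
    from choice[OF this] obtain \<xi> :: "nat \<Rightarrow> 'e \<Rightarrow>\<^sub>L real" where \<xi>: "\<And>n. norm (\<xi> n) \<le> 1"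
      "\<And>n f g. blinfun_apply (\<xi> n) (\<tau> f g) = D_eval f (t n) * D_eval g (t n)"
      by blast
    have sm: "summable (\<lambda>n. (1 / 2 :: real) ^ n *\<^sub>R \<xi> n)"
    proof (rule summable_norm_cancel, rule summable_comparison_test')
      show "summable (\<lambda>n. (1 / 2 :: real) ^ n)" by (rule summable_geometric) simp
      show "norm (norm ((1 / 2 :: real) ^ n *\<^sub>R \<xi> n)) \<le> (1 / 2) ^ n" for n
        using mult_left_mono[OF \<xi>(1)[of n], of "(1/2)^n"] by simp
    qed
    define \<zeta> where "\<zeta> = (\<Sum>n. (1 / 2 :: real) ^ n *\<^sub>R \<xi> n)"
    have \<zeta>: "(1 / 2) ^ n * (D_eval f (t n))\<^sup>2 \<le> blinfun_apply \<zeta> (\<tau> f f)" for f n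
    proof -
      have bl: "bounded_linear (\<lambda>\<eta>. blinfun_apply \<eta> (\<tau> f f))" by (rule blinfun.bounded_linear_left)
      have eq: "blinfun_apply ((1 / 2 :: real) ^ k *\<^sub>R \<xi> k) (\<tau> f f) = (1 / 2) ^ k * (D_eval f (t k))\<^sup>2" for k
        by (simp add: blinfun.scaleR_left \<xi>(2) power2_eq_square)
      have "(\<Sum>k\<in>{n}. (1 / 2) ^ k * (D_eval f (t k))\<^sup>2) \<le> (\<Sum>k. (1 / 2) ^ k * (D_eval f (t k))\<^sup>2)"
        using bounded_linear.summable[OF bl sm] unfolding eq by (intro sum_le_suminf) auto
      also have "\<dots> = blinfun_apply \<zeta> (\<tau> f f)"
        using bounded_linear.suminf[OF bl sm] unfolding \<zeta>_def eq by simp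
      finally show ?thesis by simp
    qed
    have \<zeta>0: "0 \<le> blinfun_apply \<zeta> (\<tau> f f)" for f by (rule order_trans[OF _ \<zeta>[of 0]]) simp
    have int: "integrable M (\<lambda>\<omega>. blinfun_apply \<zeta> (\<tau> (X \<omega>) (X \<omega>)))"
      using dunford unfolding dunford_integrable_def by blast
    let ?I = "\<integral>\<omega>. blinfun_apply \<zeta> (\<tau> (X \<omega>) (X \<omega>)) \<partial>M"
    have "2 ^ n \<le> ?I" for n
    proof -
      have "ennreal (2 ^ n) = ennreal ((1 / 2) ^ n) * ennreal (4 ^ n)"
        by (simp add: power_one_over field_simps flip: ennreal_mult power_mult_distrib)
      also have "\<dots> \<le> ennreal ((1 / 2) ^ n) * second_moment M X (t n)"
        using t[of n] by (intro mult_left_mono) auto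
      also have "\<dots> = (\<integral>\<^sup>+\<omega>. ennreal ((1 / 2) ^ n * (D_eval (X \<omega>) (t n))\<^sup>2) \<partial>M)"
        using random_element_eval[OF X, of "t n"] by (simp add: nn_integral_cmult ennreal_mult)
      also have "\<dots> \<le> (\<integral>\<^sup>+\<omega>. ennreal (blinfun_apply \<zeta> (\<tau> (X \<omega>) (X \<omega>))) \<partial>M)"
        by (intro nn_integral_mono ennreal_leI \<zeta>)
      also have "\<dots> = ennreal ?I" using \<zeta>0 by (intro nn_integral_eq_integral[OF int]) auto
      finally show ?thesis using \<zeta>0 by (subst (asm) ennreal_le_iff) auto
    qed
    moreover obtain n where "?I < 2 ^ n" using real_arch_pow[of 2 ?I] by auto
    ultimately show False by (meson not_le)
  qed
next
  assume fin: "(SUP t\<in>unit_cube. second_moment M X t) < \<infinity>"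
  define s where "s = enn2real (SUP t\<in>unit_cube. second_moment M X t)"
  have eq: "(SUP t\<in>unit_cube. second_moment M X t) = ennreal s" using fin by (simp add: s_def)
  have s: "0 \<le> s" "\<And>t. t \<in> unit_cube \<Longrightarrow> second_moment M X t \<le> ennreal s"
    unfolding eq[symmetric] by (auto simp: s_def intro: SUP_upper)
  show "dunford_integrable M (\<lambda>\<omega>. \<tau> (X \<omega>) (X \<omega>))"
    unfolding dunford_integrable_def
    using bounded_bilinear_form.integrable_form[OF functional_form X s] by blast
qed

theorem uniformly_integrable_of_pettis:
  assumes X: "random_element M X" and pettis: "pettis_integrable M (\<lambda>\<omega>. \<tau> (X \<omega>) (X \<omega>))"
  shows "uniformly_integrable M unit_cube (\<lambda>t \<omega>. \<bar>D_eval (X \<omega>) t\<bar>\<^sup>2)"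
  unfolding uniformly_integrable_iff_tails[OF X]
proof (rule ccontr)
  note [measurable] = random_element_eval[OF X]
  assume "\<not> (\<forall>e>0. \<exists>K>0. \<forall>t\<in>unit_cube. tail_moment M X K t \<le> ennreal e)"
  then obtain e where e: "e > 0" "\<And>K. K > 0 \<Longrightarrow> \<exists>t\<in>unit_cube. ennreal e < tail_moment M X K t"
    by (auto simp: not_le)
  have "\<exists>t\<in>unit_cube. ennreal e < tail_moment M X (real (Suc n)) t" for n by (rule e(2)) simp
  then obtain u where u: "\<And>n. u n \<in> unit_cube" "\<And>n. ennreal e < tail_moment M X (real (Suc n)) (u n)" by metis
  obtain r where r: "strict_mono r" "\<And>f. convergent (\<lambda>n. D_eval f (u (r n)))"
    using exists_convergent_subsequence[of u] u(1) by blast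
  obtain \<phi> :: "'m D_space \<Rightarrow>\<^sub>L real" where \<phi>: "norm \<phi> \<le> 1"
    "\<And>f. (\<lambda>n. D_eval f (u (r n))) \<longlonglongrightarrow> blinfun_apply \<phi> f"
    using exists_limit_functional[of "\<lambda>n. u (r n)"] r(2) by blast
  obtain \<zeta> :: "'e \<Rightarrow>\<^sub>L real" where \<zeta>: "norm \<zeta> \<le> 1"
    "\<And>f g. blinfun_apply \<zeta> (\<tau> f g) = blinfun_apply \<phi> f * blinfun_apply \<phi> g"
    using product_functional[OF \<phi>(1)] by blast
  have "\<forall>n. \<exists>\<xi> :: 'e \<Rightarrow>\<^sub>L real. norm \<xi> \<le> 1 \<and>
      (\<forall>f g. blinfun_apply \<xi> (\<tau> f g) = D_eval f (u (r n)) * D_eval g (u (r n)))"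
    using evaluation_functional by blast
  from choice[OF this] obtain \<xi> :: "nat \<Rightarrow> 'e \<Rightarrow>\<^sub>L real" where \<xi>: "\<And>n. norm (\<xi> n) \<le> 1"
    "\<And>n f g. blinfun_apply (\<xi> n) (\<tau> f g) = D_eval f (u (r n)) * D_eval g (u (r n))"
    by blast
  define F where "F n \<omega> = (D_eval (X \<omega>) (u (r n)))\<^sup>2" for n \<omega>
  define G where "G \<omega> = (blinfun_apply \<phi> (X \<omega>))\<^sup>2" for \<omega>
  have FG: "F n \<omega> = blinfun_apply (\<xi> n) (\<tau> (X \<omega>) (X \<omega>))" "G \<omega> = blinfun_apply \<zeta> (\<tau> (X \<omega>) (X \<omega>))" for n \<omega>
    by (simp_all add: F_def G_def \<xi>(2) \<zeta>(2) power2_eq_square)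
  have int: "integrable M (F n)" "integrable M G" for n
    using pettis unfolding pettis_integrable_def dunford_integrable_def FG[abs_def] by auto
  have [measurable]: "F n \<in> borel_measurable M" "G \<in> borel_measurable M" for n using int by auto
  have lim: "(\<lambda>n. F n \<omega>) \<longlonglongrightarrow> G \<omega>" for \<omega> unfolding F_def G_def by (intro tendsto_power \<phi>)
  obtain z where z: "has_dunford_integral M (space M) (\<lambda>\<omega>. \<tau> (X \<omega>) (X \<omega>)) (bidual_embed z)"
    using pettis unfolding pettis_integrable_def by blast
  have zint: "blinfun_apply \<eta> z = (\<integral>\<omega>. blinfun_apply \<eta> (\<tau> (X \<omega>) (X \<omega>)) \<partial>M)" for \<eta> :: "'e \<Rightarrow>\<^sub>L real"
  proof -
    have "integrable M (\<lambda>\<omega>. blinfun_apply \<eta> (\<tau> (X \<omega>) (X \<omega>)))"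
      using pettis unfolding pettis_integrable_def dunford_integrable_def by blast
    then show ?thesis using z by (simp add: has_dunford_integral_def bidual_embed.rep_eq set_integral_space)
  qed
  have "(\<lambda>n. blinfun_apply (\<xi> n) z) \<longlonglongrightarrow> blinfun_apply \<zeta> z"
  proof (rule functional_tendsto[OF \<xi>(1) \<zeta>(1)])
    show "(\<lambda>n. blinfun_apply (\<xi> n) (\<tau> f g)) \<longlonglongrightarrow> blinfun_apply \<zeta> (\<tau> f g)" for f g
      unfolding \<xi>(2) \<zeta>(2) by (intro tendsto_mult \<phi>)
  qed
  then have "(\<lambda>n. \<integral>\<omega>. F n \<omega> \<partial>M) \<longlonglongrightarrow> (\<integral>\<omega>. G \<omega> \<partial>M)" unfolding zint FG .
  then have "(\<lambda>n. ennreal (\<integral>\<omega>. F n \<omega> \<partial>M)) \<longlonglongrightarrow> ennreal (\<integral>\<omega>. G \<omega> \<partial>M)" by (rule tendsto_ennrealI)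
  then have limsup: "limsup (\<lambda>n. ennreal (\<integral>\<omega>. F n \<omega> \<partial>M)) = ennreal (\<integral>\<omega>. G \<omega> \<partial>M)"
    by (rule lim_imp_Limsup[rotated]) simp
  have F0: "0 \<le> F n \<omega>" "0 \<le> G \<omega>" for n \<omega> by (simp_all add: F_def G_def)
  have nn: "(\<integral>\<^sup>+\<omega>. norm (F n \<omega>) \<partial>M) = ennreal (\<integral>\<omega>. F n \<omega> \<partial>M)" "(\<integral>\<^sup>+\<omega>. norm (G \<omega>) \<partial>M) = ennreal (\<integral>\<omega>. G \<omega> \<partial>M)" for n
    using nn_integral_eq_integral[OF int(1)[of n]] nn_integral_eq_integral[OF int(2)] by (simp_all add: F0)
  have "limsup (\<lambda>n. \<integral>\<^sup>+\<omega>. norm (F n \<omega>) \<partial>M) \<le> (\<integral>\<^sup>+\<omega>. norm (G \<omega>) \<partial>M)"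
    unfolding nn limsup by simp
  with int lim have L1: "(\<lambda>n. \<integral>\<^sup>+\<omega>. norm (F n \<omega> - G \<omega>) \<partial>M) \<longlonglongrightarrow> 0"
    by (intro Scheffe_lemma1) auto
  \<comment> \<open>The tail of \<open>F n\<close> is at most \<bar>F n - G\<bar> plus
    \<open>T n\<close>. The latter vanishes in the limit because \<open>F n \<omega>\<close>
    converges while the levels \<open>Suc (r n)\<close> grow.\<close>
  define T where "T n \<omega> = ennreal (G \<omega>) * indicator {\<omega>. real (Suc (r n)) < F n \<omega>} \<omega>" for n \<omega>
  have "(\<lambda>n. \<integral>\<^sup>+\<omega>. T n \<omega> \<partial>M) \<longlonglongrightarrow> (\<integral>\<^sup>+\<omega>. 0 \<partial>M)"
  proof (rule nn_integral_dominated_convergence[where w = "\<lambda>\<omega>. ennreal (G \<omega>)"])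
    show "T n \<in> borel_measurable M" for n unfolding T_def by measurable
    show "AE \<omega> in M. T n \<omega> \<le> ennreal (G \<omega>)" for n by (intro AE_I2) (auto simp: T_def split: split_indicator)
    show "(\<integral>\<^sup>+\<omega>. ennreal (G \<omega>) \<partial>M) < \<infinity>"
      using nn_integral_eq_integral[OF int(2)] by (auto simp: G_def)
    show "AE \<omega> in M. (\<lambda>n. T n \<omega>) \<longlonglongrightarrow> 0"
    proof (rule AE_I2)
      fix \<omega>
      obtain N :: nat where N: "G \<omega> + 1 < real N" using reals_Archimedean2 by blast
      have "\<forall>\<^sub>F n in sequentially. F n \<omega> < G \<omega> + 1" using order_tendstoD(2)[OF lim, of _ "G \<omega> + 1"] by simp
      then have "\<forall>\<^sub>F n in sequentially. T n \<omega> = 0"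
        using eventually_ge_at_top[of N]
      proof eventually_elim
        case (elim n)
        have "n \<le> r n" by (rule seq_suble[OF r(1)])
        then show ?case using elim N by (auto simp: T_def split: split_indicator)
      qed
      then show "(\<lambda>n. T n \<omega>) \<longlonglongrightarrow> 0" by (rule tendsto_eventually)
    qed
  qed auto
  with L1 have "(\<lambda>n. (\<integral>\<^sup>+\<omega>. norm (F n \<omega> - G \<omega>) \<partial>M) + (\<integral>\<^sup>+\<omega>. T n \<omega> \<partial>M)) \<longlonglongrightarrow> 0 + 0"
    by (intro tendsto_add) auto
  then have "\<forall>\<^sub>F n in sequentially. (\<integral>\<^sup>+\<omega>. norm (F n \<omega> - G \<omega>) \<partial>M) + (\<integral>\<^sup>+\<omega>. T n \<omega> \<partial>M) < ennreal e"
    using e(1) by (intro order_tendstoD(2)) auto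
  then obtain n where n: "(\<integral>\<^sup>+\<omega>. norm (F n \<omega> - G \<omega>) \<partial>M) + (\<integral>\<^sup>+\<omega>. T n \<omega> \<partial>M) < ennreal e"
    using eventually_happens by fastforce
  have "tail_moment M X (real (Suc (r n))) (u (r n)) \<le> (\<integral>\<^sup>+\<omega>. norm (F n \<omega> - G \<omega>) + T n \<omega> \<partial>M)"
    unfolding tail_moment_def
  proof (rule nn_integral_mono)
    fix \<omega>
    have "ennreal (F n \<omega>) \<le> ennreal (\<bar>F n \<omega> - G \<omega>\<bar> + G \<omega>)" by (rule ennreal_leI) simp
    also have "\<dots> = ennreal \<bar>F n \<omega> - G \<omega>\<bar> + ennreal (G \<omega>)" by (rule ennreal_plus) (auto simp: G_def)
    finally show "ennreal ((D_eval (X \<omega>) (u (r n)))\<^sup>2) * indicator {\<omega>. real (Suc (r n)) < (D_eval (X \<omega>) (u (r n)))\<^sup>2} \<omega>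
      \<le> ennreal (norm (F n \<omega> - G \<omega>)) + T n \<omega>"
      unfolding T_def F_def[symmetric] by (auto split: split_indicator)
  qed
  also have "\<dots> = (\<integral>\<^sup>+\<omega>. norm (F n \<omega> - G \<omega>) \<partial>M) + (\<integral>\<^sup>+\<omega>. T n \<omega> \<partial>M)"
    unfolding T_def by (rule nn_integral_add) measurable
  also have "\<dots> < ennreal e" by (rule n)
  finally show False using u(2)[of "r n"] by simp
qed

theorem pettis_of_uniformly_integrable:
  assumes M: "prob_space M" and X: "random_element M X"
    and ui: "uniformly_integrable M unit_cube (\<lambda>t \<omega>. \<bar>D_eval (X \<omega>) t\<bar>\<^sup>2)"
  shows "pettis_integrable M (\<lambda>\<omega>. \<tau> (X \<omega>) (X \<omega>))"
proof -
  have tails: "\<exists>K>0. \<forall>t\<in>unit_cube. tail_moment M X K t \<le> ennreal e" if "e > 0" for e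
    using ui that unfolding uniformly_integrable_iff_tails[OF X] by blast
  obtain K where K: "K > 0" "\<And>t. t \<in> unit_cube \<Longrightarrow> tail_moment M X K t \<le> ennreal 1" using tails[of 1] by auto
  define s where "s = K + 1"
  have s0: "0 \<le> s" using K by (simp add: s_def)
  have s: "second_moment M X t \<le> ennreal s" if "t \<in> unit_cube" for t
    unfolding s_def using second_moment_bounded_of_tail[OF M X _ K(2)[OF that]] K(1) by simp
  have sq_int: "integrable M (\<lambda>\<omega>. (D_eval (X \<omega>) t)\<^sup>2)" if "t \<in> unit_cube" for t
    using integral_le_of_nn_integral_le(1)[OF _ _ s[OF that] s0] random_element_eval[OF X, of t] by simp
  have prod_int: "integrable M (\<lambda>\<omega>. D_eval (X \<omega>) c * D_eval (X \<omega>) d)" if "c \<in> unit_cube" "d \<in> unit_cube" for c d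
  proof (rule Bochner_Integration.integrable_bound[OF Bochner_Integration.integrable_add[OF sq_int[OF that(1)] sq_int[OF that(2)]]])
    show "(\<lambda>\<omega>. D_eval (X \<omega>) c * D_eval (X \<omega>) d) \<in> borel_measurable M"
      using random_element_eval[OF X] by measurable
    have "\<bar>x * y\<bar> \<le> x\<^sup>2 + y\<^sup>2" for x y :: real
    proof -
      have "2 * \<bar>x\<bar> * \<bar>y\<bar> \<le> x\<^sup>2 + y\<^sup>2" using sum_squares_bound[of "\<bar>x\<bar>" "\<bar>y\<bar>"] by simp
      moreover have "0 \<le> \<bar>x\<bar> * \<bar>y\<bar>" by simp
      ultimately show ?thesis unfolding abs_mult by linarith
    qed
    then show "AE \<omega> in M. norm (D_eval (X \<omega>) c * D_eval (X \<omega>) d) \<le> norm ((D_eval (X \<omega>) c)\<^sup>2 + (D_eval (X \<omega>) d)\<^sup>2)"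
      by (intro AE_I2) simp
  qed
  have dunford: "integrable M (\<lambda>\<omega>. blinfun_apply \<xi> (\<tau> (X \<omega>) (X \<omega>)))" for \<xi> :: "'e \<Rightarrow>\<^sub>L real"
    using bounded_bilinear_form.integrable_form[OF functional_form X s0 s, of \<xi>] by simp
  \<comment> \<open>Errors \<open>(1 / 4) ^ n\<close> leave \<open>(1 / 2) ^ n\<close> after the
    weight 2^n in the polarisation estimate, which is also the order of the other term.\<close>
  have "\<exists>C. grid C \<and> (\<forall>t\<in>unit_cube.
      (\<integral>\<^sup>+\<omega>. ennreal ((D_eval (X \<omega>) t - D_eval (X \<omega>) (grid_point C t))\<^sup>2) \<partial>M) \<le> ennreal ((1 / 4) ^ n))" for n :: nat
    by (rule exists_uniform_sampling_grid[OF M X tails]) auto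
  then obtain C where C: "\<And>n. grid (C n)" "\<And>n t. t \<in> unit_cube \<Longrightarrow>
      (\<integral>\<^sup>+\<omega>. ennreal ((D_eval (X \<omega>) t - D_eval (X \<omega>) (grid_point (C n) t))\<^sup>2) \<partial>M) \<le> ennreal ((1 / 4) ^ n)"
    by metis
  have "\<exists>z. has_dunford_integral M A (\<lambda>\<omega>. \<tau> (X \<omega>) (X \<omega>)) (bidual_embed z)" if A: "A \<in> sets M" for A
  proof -
    define I where "I \<xi> = (LINT \<omega>:A|M. blinfun_apply \<xi> (\<tau> (X \<omega>) (X \<omega>)))" for \<xi> :: "'e \<Rightarrow>\<^sub>L real"
    \<comment> \<open>The integral over \<open>A\<close> of the tensor square of the sampled
      element, written as a finite tensor.\<close>
    define z where "z n = (\<Sum>c\<in>grid_points (C n). \<Sum>d\<in>grid_points (C n).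
      (LINT \<omega>:A|M. D_eval (X \<omega>) c * D_eval (X \<omega>) d) *\<^sub>R \<tau> (cell (C n) c) (cell (C n) d))" for n
    define W where "W = 4 * (1 + 4 * s)"
    have W: "W > 0" using s0 by (simp add: W_def add_pos_nonneg)
    have approx: "\<bar>I \<xi> - blinfun_apply \<xi> (z n)\<bar> \<le> (norm \<xi> + 1) * W * (1 / 2) ^ n" for \<xi> n
    proof -
      interpret b: bounded_bilinear_form "\<lambda>f g. blinfun_apply \<xi> (\<tau> f g)" "norm \<xi> + 1" by (rule functional_form)
      let ?G = "grid_points (C n) :: (real ^ 'm) set"
      have G: "c \<in> unit_cube" if "c \<in> ?G" for c using subsetD[OF grid_points_subset[OF C(1)] that] .
      let ?x = "\<lambda>c d \<omega>. D_eval (X \<omega>) c * D_eval (X \<omega>) d"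
      let ?w = "\<lambda>c d. blinfun_apply \<xi> (\<tau> (cell (C n) c) (cell (C n) d))"
      have "(LINT \<omega>:A|M. blinfun_apply \<xi> (\<tau> (sample (C n) (X \<omega>)) (sample (C n) (X \<omega>))))
          = (\<integral>\<omega>. (\<Sum>c\<in>?G. \<Sum>d\<in>?G. (indicator A \<omega> *\<^sub>R ?x c d \<omega>) * ?w c d) \<partial>M)"
        unfolding b.form_sample[OF C(1)] set_lebesgue_integral_def by (simp add: sum_distrib_left mult.assoc)
      also have "\<dots> = (\<Sum>c\<in>?G. \<Sum>d\<in>?G. (\<integral>\<omega>. indicator A \<omega> *\<^sub>R ?x c d \<omega> \<partial>M) * ?w c d)"
      proof -
        have i: "integrable M (\<lambda>\<omega>. (indicator A \<omega> *\<^sub>R ?x c d \<omega>) * ?w c d)" if "c \<in> ?G" "d \<in> ?G" for c d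
          by (intro integrable_mult_left integrable_mult_indicator A prod_int G that)
        have "(\<integral>\<omega>. (\<Sum>c\<in>?G. \<Sum>d\<in>?G. (indicator A \<omega> *\<^sub>R ?x c d \<omega>) * ?w c d) \<partial>M)
            = (\<Sum>c\<in>?G. \<integral>\<omega>. (\<Sum>d\<in>?G. (indicator A \<omega> *\<^sub>R ?x c d \<omega>) * ?w c d) \<partial>M)"
          by (rule Bochner_Integration.integral_sum) (intro Bochner_Integration.integrable_sum i)
        also have "\<dots> = (\<Sum>c\<in>?G. \<Sum>d\<in>?G. \<integral>\<omega>. (indicator A \<omega> *\<^sub>R ?x c d \<omega>) * ?w c d \<partial>M)"
          by (intro sum.cong refl Bochner_Integration.integral_sum i)
        finally show ?thesis by simp
      qed
      also have "\<dots> = blinfun_apply \<xi> (z n)"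
        by (simp add: z_def blinfun.sum_right blinfun.scaleR_right set_lebesgue_integral_def)
      finally have eq: "(LINT \<omega>:A|M. blinfun_apply \<xi> (\<tau> (sample (C n) (X \<omega>)) (sample (C n) (X \<omega>)))) = blinfun_apply \<xi> (z n)" .
      define k where "k = sqrt (2 ^ n)"
      have k: "k > 0" "k\<^sup>2 = 2 ^ n" by (simp_all add: k_def)
      have "\<bar>I \<xi> - blinfun_apply \<xi> (z n)\<bar> \<le> 4 * (norm \<xi> + 1) * (k\<^sup>2 * (1 / 4) ^ n + 4 * s / k\<^sup>2)"
        unfolding I_def eq[symmetric]
        by (rule b.integral_form_sample_diff_le[OF X s0 s C(1) _ C(2) A k(1)]) auto
      also have "k\<^sup>2 * (1 / 4) ^ n + 4 * s / k\<^sup>2 = (1 + 4 * s) * (1 / 2) ^ n"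
      proof -
        have "(2 :: real) ^ n * (1 / 4) ^ n = (1 / 2) ^ n" by (simp flip: power_mult_distrib)
        moreover have "4 * s / 2 ^ n = 4 * s * (1 / 2) ^ n" by (simp add: power_one_over)
        ultimately show ?thesis by (simp only: k(2) distrib_right mult_1)
      qed
      finally show ?thesis by (simp add: W_def algebra_simps)
    qed
    have dist_le: "dist (z n) (z m) \<le> 2 * W * (1 / 2) ^ n + 2 * W * (1 / 2) ^ m" for n m
    proof -
      \<comment> \<open>A norming functional may depend on \<open>n\<close> and \<open>m\<close>:
        \<open>approx\<close> depends on it only through its norm, so the estimate becomes one in
        the tensor norm.\<close>
      obtain \<xi> :: "'e \<Rightarrow>\<^sub>L real" where \<xi>: "norm \<xi> \<le> 1" "blinfun_apply \<xi> (z n - z m) = norm (z n - z m)"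
        using norming_functional by blast
      have "(norm \<xi> + 1) * W * (1 / 2) ^ k \<le> 2 * W * (1 / 2) ^ k" for k
        using \<xi>(1) W by (intro mult_right_mono) auto
      then have "\<bar>I \<xi> - blinfun_apply \<xi> (z k)\<bar> \<le> 2 * W * (1 / 2) ^ k" for k
        using approx[of \<xi> k] by (rule order_trans[rotated])
      from this[of n] this[of m] show ?thesis
        using \<xi>(2) unfolding dist_norm blinfun.diff_right by linarith
    qed
    have small: "\<exists>N. \<forall>n\<ge>N. c * (1 / 2) ^ n < e" if e: "e > 0" for c e :: real
    proof -
      have "(\<lambda>n. c * (1 / 2) ^ n) \<longlonglongrightarrow> c * 0" by (intro tendsto_mult_left LIMSEQ_realpow_zero) auto
      from order_tendstoD(2)[OF this, of e] e show ?thesis by (simp add: eventually_sequentially)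
    qed
    have "Cauchy z"
    proof (rule metric_CauchyI)
      fix e :: real assume "e > 0"
      then obtain N where "\<And>n. n \<ge> N \<Longrightarrow> 2 * W * (1 / 2) ^ n < e / 2" using small[of "e / 2" "2 * W"] by auto
      then show "\<exists>N. \<forall>m\<ge>N. \<forall>n\<ge>N. dist (z m) (z n) < e"
        using dist_le by (intro exI[of _ N] allI impI) (smt (verit) field_sum_of_halves)
    qed
    then obtain y where y: "z \<longlonglongrightarrow> y" using Cauchy_convergent convergent_def by blast
    have "blinfun_apply \<xi> y = I \<xi>" for \<xi>
    proof (rule LIMSEQ_unique)
      show "(\<lambda>n. blinfun_apply \<xi> (z n)) \<longlonglongrightarrow> blinfun_apply \<xi> y"
        by (intro tendsto_intros y)
      show "(\<lambda>n. blinfun_apply \<xi> (z n)) \<longlonglongrightarrow> I \<xi>"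
      proof (rule LIMSEQ_I)
        fix e :: real assume "e > 0"
        then obtain N where "\<And>n. n \<ge> N \<Longrightarrow> (norm \<xi> + 1) * W * (1 / 2) ^ n < e"
          using small[of e "(norm \<xi> + 1) * W"] by auto
        then show "\<exists>N. \<forall>n\<ge>N. norm (blinfun_apply \<xi> (z n) - I \<xi>) < e"
          using approx[of \<xi>] by (intro exI[of _ N]) (fastforce simp: abs_minus_commute intro: le_less_trans)
      qed
    qed
    then show ?thesis by (intro exI[of _ y]) (simp add: has_dunford_integral_def bidual_embed.rep_eq I_def)
  qed
  then show ?thesis unfolding pettis_integrable_def dunford_integrable_def using dunford by blast
qed

end

section \<open>The projective and the injective tensor square\<close>

text \<open>The completion consists of elements of the bidual, so evaluation at
  \<open>\<psi>\<close> is the extension.\<close>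

lemma extend_functional:
  fixes \<psi> :: "'a::real_normed_vector \<Rightarrow>\<^sub>L real"
  shows "\<exists>\<xi> :: 'a completion \<Rightarrow>\<^sub>L real. norm \<xi> \<le> norm \<psi> \<and> (\<forall>x. blinfun_apply \<xi> (to_completion x) = blinfun_apply \<psi> x)"
proof -
  define l where "l z = blinfun_apply (Rep_completion z) \<psi>" for z
  have le: "\<bar>l z\<bar> \<le> norm z * norm \<psi>" for z
    using norm_blinfun[of "Rep_completion z" \<psi>] by (simp add: l_def norm_completion.rep_eq)
  have bl: "bounded_linear l"
    by (rule bounded_linear_intro[of l "norm \<psi>"])
      (use le in \<open>auto simp: l_def plus_completion.rep_eq scaleR_completion.rep_eq blinfun.add_left blinfun.scaleR_left\<close>)
  have "norm (Blinfun l) \<le> norm \<psi>"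
    using le by (intro norm_blinfun_bound) (auto simp: bounded_linear_Blinfun_apply[OF bl] mult.commute)
  moreover have "blinfun_apply (Blinfun l) (to_completion x) = blinfun_apply \<psi> x" for x
    by (simp add: bounded_linear_Blinfun_apply[OF bl] l_def to_completion.rep_eq bidual_embed.rep_eq)
  ultimately show ?thesis by blast
qed

lemma proj_norm_pair_le: "proj_norm (tensor_pair x y) \<le> norm x * norm y"
  using proj_norm_le[of "[(x, y)]"] by (simp add: tensor_pair.abs_eq)

lemma inj_norm_le_proj_norm: "inj_norm u \<le> proj_norm u"
  by (rule inj_norm_le) (rule product_form_le_proj_norm)

lemma completion_dense_spanI:
  fixes J :: "('a::real_vector, 'b::real_vector) tensor \<Rightarrow> 'v::real_normed_vector"
  assumes J: "linear J" "surj J"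
  shows "closure (span (range (\<lambda>(f, g). to_completion (J (tensor_pair f g))))) = UNIV"
proof -
  let ?S = "span (range (\<lambda>(f, g). to_completion (J (tensor_pair f g))))"
  have lin: "linear (\<lambda>u. to_completion (J u))"
    using J(1) linear_to_completion by (rule linear_compose[unfolded o_def])
  have "to_completion (J u) \<in> ?S" for u
  proof -
    obtain xs where u: "u = (\<Sum>(x, y)\<leftarrow>xs. tensor_pair x y)" using abs_tensor_surj abs_tensor_eq_sum by metis
    show ?thesis
      unfolding u
    proof (induction xs)
      case Nil
      then show ?case using linear_0[OF lin] by (simp add: span_zero)
    next
      case (Cons p xs)
      obtain f g where p: "p = (f, g)" by fastforce
      have "to_completion (J (tensor_pair f g)) \<in> range (\<lambda>(f, g). to_completion (J (tensor_pair f g)))"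
        by (rule range_eqI[of _ _ "(f, g)"]) simp
      then have "to_completion (J (tensor_pair f g)) \<in> ?S" by (rule span_base)
      from span_add[OF this Cons] show ?case by (simp add: p linear_add[OF lin])
    qed
  qed
  then have "range to_completion \<subseteq> ?S" using J(2) by (metis image_subsetI surjD)
  then show ?thesis using closure_mono dense_to_completion by blast
qed

text \<open>The bound does two things: it makes the product form depend on \<open>J u\<close> alone,
  and it gives the induced functional norm at most 1 before the extension to the completion.\<close>

lemma product_functional_completion:
  fixes J :: "('a::real_normed_vector, 'a) tensor \<Rightarrow> 'v::real_normed_vector"
  assumes J: "linear J" "surj J" and \<phi>: "norm (\<phi> :: 'a \<Rightarrow>\<^sub>L real) \<le> 1"
    and bound: "\<And>u. \<bar>tensor_form (\<lambda>x y. blinfun_apply \<phi> x * blinfun_apply \<phi> y) u\<bar> \<le> norm (J u)"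
  shows "\<exists>\<xi> :: 'v completion \<Rightarrow>\<^sub>L real. norm \<xi> \<le> 1 \<and>
    (\<forall>x y. blinfun_apply \<xi> (to_completion (J (tensor_pair x y))) = blinfun_apply \<phi> x * blinfun_apply \<phi> y)"
proof -
  let ?t = "tensor_form (\<lambda>x y. blinfun_apply \<phi> x * blinfun_apply \<phi> y)"
  have t_diff: "?t (u - v) = ?t u - ?t v" for u v
    using tensor_form_add[of _ "u - v" v] by (simp add: algebra_simps)
  have "J u = J v \<Longrightarrow> ?t u = ?t v" for u v
    using bound[of "u - v"] by (simp add: linear_diff[OF J(1)] t_diff)
  then have "\<exists>l. \<forall>u. l (J u) = ?t u"
    by (intro exI[of _ "\<lambda>v. ?t (inv J v)"]) (metis J(2) surj_f_inv_f)
  then obtain l where l: "\<And>u. l (J u) = ?t u" by blast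
  have J_ex: "\<exists>u. v = J u" for v using J(2) by (rule surjD)
  have bl: "bounded_linear l"
  proof (rule bounded_linear_intro[of l 1])
    show "l (v + w) = l v + l w" for v w
      using J_ex[of v] J_ex[of w] by (metis l linear_add[OF J(1)] tensor_form_add)
    show "l (c *\<^sub>R v) = c *\<^sub>R l v" for c v
      using J_ex[of v] by (metis l linear_cmul[OF J(1)] tensor_form_scaleR real_scaleR_def)
    show "norm (l v) \<le> norm v * 1" for v
      using J_ex[of v] bound l by (metis mult.right_neutral real_norm_def)
  qed
  have "norm (Blinfun l) \<le> 1"
  proof (rule norm_blinfun_bound)
    show "norm (blinfun_apply (Blinfun l) v) \<le> 1 * norm v" for v
      using J_ex[of v] bound l by (metis bl bounded_linear_Blinfun_apply mult_1 real_norm_def)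
  qed simp
  moreover have "?t (tensor_pair x y) = blinfun_apply \<phi> x * blinfun_apply \<phi> y" for x y
    by (simp add: tensor_pair.abs_eq tensor_form_abs[OF bilinear_product_form])
  ultimately show ?thesis
    using extend_functional[of "Blinfun l"] bl l by (metis bounded_linear_Blinfun_apply order_trans)
qed

lemma linear_Ptensor: "linear Ptensor" and surj_Ptensor: "surj Ptensor"
  by (simp_all add: linear_iff plus_ptensor.abs_eq scaleR_ptensor.abs_eq eq_onp_def)
    (metis surjI un_ptensor_inverse)

lemma linear_Itensor: "linear Itensor" and surj_Itensor: "surj Itensor"
  by (simp_all add: linear_iff plus_itensor.abs_eq scaleR_itensor.abs_eq eq_onp_def)
    (metis surjI un_itensor_inverse)

lemma norm_Ptensor: "norm (Ptensor u) = proj_norm u"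
  by (simp add: norm_ptensor.abs_eq)

lemma norm_Itensor: "norm (Itensor u) = inj_norm u"
  by (simp add: norm_itensor.abs_eq)

lemma bilinear_completion:
  assumes "linear J"
  shows "bilinear (\<lambda>x y. to_completion (J (tensor_pair x y)))"
  unfolding bilinear_def linear_iff
  by (simp add: bilinear_ladd[OF bilinear_tensor_pair] bilinear_radd[OF bilinear_tensor_pair]
      bilinear_lmul[OF bilinear_tensor_pair] bilinear_rmul[OF bilinear_tensor_pair]
      linear_add[OF assms] linear_cmul[OF assms] linear_add[OF linear_to_completion] linear_cmul[OF linear_to_completion])

interpretation proj: tensor_square
  "\<lambda>f g :: 'm::finite D_space. to_completion (Ptensor (tensor_pair f g))"
proof
  show "bilinear (\<lambda>f g :: 'm D_space. to_completion (Ptensor (tensor_pair f g)))"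
    by (rule bilinear_completion[OF linear_Ptensor])
  show "norm (to_completion (Ptensor (tensor_pair f g))) \<le> norm f * norm g" for f g :: "'m D_space"
    by (simp add: norm_to_completion norm_Ptensor proj_norm_pair_le)
  show "closure (span (range (\<lambda>(f, g :: 'm D_space). to_completion (Ptensor (tensor_pair f g :: ('m D_space, 'm D_space) tensor))))) = UNIV"
    by (rule completion_dense_spanI[OF linear_Ptensor surj_Ptensor])
  fix \<phi> :: "'m D_space \<Rightarrow>\<^sub>L real" assume \<phi>: "norm \<phi> \<le> 1"
  show "\<exists>\<xi> :: ('m D_space, 'm D_space) ptensor completion \<Rightarrow>\<^sub>L real. norm \<xi> \<le> 1 \<and>
      (\<forall>f g. blinfun_apply \<xi> (to_completion (Ptensor (tensor_pair f g))) = blinfun_apply \<phi> f * blinfun_apply \<phi> g)"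
    by (rule product_functional_completion[OF linear_Ptensor surj_Ptensor \<phi>])
      (simp add: norm_Ptensor product_form_le_proj_norm[OF \<phi> \<phi>])
qed

interpretation inj: tensor_square
  "\<lambda>f g :: 'm::finite D_space. to_completion (Itensor (tensor_pair f g))"
proof
  show "bilinear (\<lambda>f g :: 'm D_space. to_completion (Itensor (tensor_pair f g)))"
    by (rule bilinear_completion[OF linear_Itensor])
  show "norm (to_completion (Itensor (tensor_pair f g))) \<le> norm f * norm g" for f g :: "'m D_space"
    using order_trans[OF inj_norm_le_proj_norm proj_norm_pair_le] by (simp add: norm_to_completion norm_Itensor)
  show "closure (span (range (\<lambda>(f, g :: 'm D_space). to_completion (Itensor (tensor_pair f g :: ('m D_space, 'm D_space) tensor))))) = UNIV"
    by (rule completion_dense_spanI[OF linear_Itensor surj_Itensor])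
  fix \<phi> :: "'m D_space \<Rightarrow>\<^sub>L real" assume \<phi>: "norm \<phi> \<le> 1"
  show "\<exists>\<xi> :: ('m D_space, 'm D_space) itensor completion \<Rightarrow>\<^sub>L real. norm \<xi> \<le> 1 \<and>
      (\<forall>f g. blinfun_apply \<xi> (to_completion (Itensor (tensor_pair f g))) = blinfun_apply \<phi> f * blinfun_apply \<phi> g)"
    by (rule product_functional_completion[OF linear_Itensor surj_Itensor \<phi>])
      (simp add: norm_Itensor product_form_le_inj_norm[OF \<phi> \<phi>])
qed

theorem theorem8p8:
  fixes M :: "'w measure" and X :: "'w \<Rightarrow> 'm::finite D_space"
  assumes "prob_space M"
    and "X \<in> measurable M D_field"
  shows
    "((dunford_integrable M (\<lambda>\<omega>. proj_square (X \<omega>)) \<longleftrightarrow>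
         dunford_integrable M (\<lambda>\<omega>. inj_square (X \<omega>))) \<and>
      (dunford_integrable M (\<lambda>\<omega>. inj_square (X \<omega>)) \<longleftrightarrow>
         (SUP t\<in>unit_cube. \<integral>\<^sup>+\<omega>. ennreal (\<bar>D_eval (X \<omega>) t\<bar>\<^sup>2) \<partial>M) < \<infinity>)) \<and>
     ((pettis_integrable M (\<lambda>\<omega>. proj_square (X \<omega>)) \<longleftrightarrow>
         pettis_integrable M (\<lambda>\<omega>. inj_square (X \<omega>))) \<and>
      (pettis_integrable M (\<lambda>\<omega>. inj_square (X \<omega>)) \<longleftrightarrow>
         uniformly_integrable M unit_cube (\<lambda>t \<omega>. \<bar>D_eval (X \<omega>) t\<bar>\<^sup>2)))"
proof -
  have X: "random_element M X" using assms(2) by (simp add: random_element_iff)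
  show ?thesis
    unfolding proj_square_def inj_square_def power2_abs
    using proj.dunford_integrable_iff[OF X] inj.dunford_integrable_iff[OF X]
      proj.uniformly_integrable_of_pettis[OF X] inj.uniformly_integrable_of_pettis[OF X]
      proj.pettis_of_uniformly_integrable[OF assms(1) X] inj.pettis_of_uniformly_integrable[OF assms(1) X]
    unfolding power2_abs by blast
qed

end
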